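(* Let $d_1,d_2,r,l>0$, $0<b<1$ and $a>\dfrac{(b+1)^2}{2(1-b)}$. If $l\in L_{TTH}$, then the diffusive Holling–Tanner system (HT) undergoes a Hopf–double-zero (Hopf–double-Turing) bifurcation (at the constant steady state $(u_0,v_0)$) at $r=r_i^H(l)=r_j^T(l)=r_k^T(l)$, where $0\le i\le N_1<j<k\le N_2$. Moreover, the bifurcation solutions can be stable only when $a,b,d_1,d_2,l$ also satisfy one of the conditions (A5$'$), (A6$'$) listed in the context and $r=r_0^H(l)=r_j^T(l)=r_k^T(l)=A_0$ $(N_1+1\le j<k\le N_2)$.
   Context: $\mathbb N=\{0,1,2,\dots\}$. The system (HT) is $$u_t-d_1\Delta u=u(1-u)-\frac{auv}{u+b},\qquad v_t-d_2\Delta v=rv\Big(1-\frac{v}{u}\Big),\qquad x\in(0,l\pi),\ t>0,$$ with $u_x=v_x=0$ at $x=0$ and $x=l\pi$ for $t>0$, and initial data $u(x,0)=u_0(x)$, $v(x,0)=v_0(x)$. Its positive constant steady state is $(u_0,v_0)$ with $u_0=v_0=\frac12[(1-a-b)+\sqrt{(a+b-1)^2+4b}]$. The bifurcation parameters are $r$ and $l$. Set $A_0=\frac{u_0}{b+u_0}(1-b-2u_0)$, $B_0=-\frac{au_0}{b+u_0}=u_0-1$. The eigenvalues of the linearization at $(u_0,v_0)$ are the roots of $\lambda^2-T_n(r,l)\lambda+D_n(r,l)=0$, $n\in\mathbb N$, where $T_n(r,l)=A_0-(d_1+d_2)\frac{n^2}{l^2}-r$ and $D_n(r,l)=d_2\frac{n^2}{l^2}(d_1\frac{n^2}{l^2}-A_0)+r(d_1\frac{n^2}{l^2}-A_0-B_0)$.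 Define $$r_n^H(l)=A_0-(d_1+d_2)\frac{n^2}{l^2},\qquad r_n^T(l)=-\frac{d_2\frac{n^2}{l^2}(d_1\frac{n^2}{l^2}-A_0)}{d_1\frac{n^2}{l^2}-A_0-B_0}.$$ Let $\bar x=\frac{1}{2d_1^2}\big[2d_1A_0+(d_1+d_2)B_0+\sqrt{(d_1+d_2)^2B_0^2+4d_1d_2A_0B_0}\big]$, $l_n^H=n/\sqrt{\bar x}$, $l_n^T=n\sqrt{d_1/A_0}$. For given $l$, $N_1=N_1(l)$ and $N_2=N_2(l)$ are the non-negative integers with $l_{N_1}^H<l\le l_{N_1+1}^H$ and $l_{N_2}^T<l\le l_{N_2+1}^T$. With $N_2\ge1$ and $S_2=(l_{N_1}^H,l_{N_1+1}^H]\cap(l_{N_2}^T,l_{N_2+1}^T]$, $$L_{TTH}=\{l\in S_2:\ r_i^H(l)=r_j^T(l)=r_k^T(l)\text{ for some }0\le i\le N_1<j<k\le N_2\}.$$ Let $\hat x=\frac1{d_1}[(A_0+B_0)+\sqrt{B_0(A_0+B_0)}]$ and, for $d_1\ne d_2$, $$b_*=\frac{[(d_1+d_2)^2-\sqrt{(d_1+d_2)^4-(d_1-d_2)^4}]^2}{(d_1-d_2)^4},$$ $$a_\pm=\frac{(1-b)(d_1+d_2)^4\pm(d_1+d_2)^2\sqrt{(b+1)^2(d_1-d_2)^4-4b(d_1+d_2)^4}}{(d_1+d_2)^4-(d_1-d_2)^4},$$ $$x_\pm=\frac{1}{2d_1d_2}\big[(d_2-d_1)A_0\pm\sqrt{(d_1+d_2)^2A_0^2+4d_1d_2A_0B_0}\big],\quad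 l_n^\pm=n/\sqrt{x_\pm},$$ and let $M_1,M_2\in\mathbb N$ be such that $l_{M_1-1}^-\le l<l_{M_1}^-$ and $l_{M_2}^+<l\le l_{M_2+1}^+$ ($a_\pm$ are used only when $d_2>d_1$, $0<b\le b_*$; $x_\pm,M_1,M_2$ only when moreover $a_-<a<a_+$). (A5$'$): $d_2>d_1$, $0<b\le b_*$, $a=a_-$ or $a=a_+$, and $l=n\sqrt{1/\hat x}$ for some $n\in\mathbb N$. (A6$'$): $d_2>d_1$, $0<b<b_*$, $a_-<a<a_+$, $M_1(l)>M_2(l)$, and $l=n\sqrt{1/x_-}$ or $l=n\sqrt{1/x_+}$ for some $n\in\mathbb N$. Terminology: a Hopf–double-zero bifurcation is understood in the usual sense, associated with the simultaneous occurrence of a pair of purely imaginary eigenvalues and two zero eigenvalues of the linearization; the bifurcation solutions are the solutions of (HT) emanating from $(u_0,v_0)$ there. *)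

theory Defs
  imports "HOL-Analysis.Analysis" "HOL-Library.Function_Algebras"
begin

section \<open>The diffusive Holling--Tanner system\<close>

definition react_u :: "real \<Rightarrow> real \<Rightarrow> real \<Rightarrow> real \<Rightarrow> real" where
  "react_u a b u v = u * (1 - u) - a * u * v / (u + b)"

definition react_v :: "real \<Rightarrow> real \<Rightarrow> real \<Rightarrow> real" where
  "react_v r u v = r * v * (1 - v / u)"

text \<open>Both components of the positive constant steady state are equal to this number.\<close>

definition u_star :: "real \<Rightarrow> real \<Rightarrow> real" where
  "u_star a b = (1 / 2) * ((1 - a - b) + sqrt ((a + b - 1)^2 + 4 * b))"

text \<open>A function of \<open>x\<close> and \<open>t\<close>, continuous up to \<open>t = 0\<close>, that for \<open>t > 0\<close> has the continuous
  derivatives \<open>ut\<close>, \<open>ux\<close>, \<open>uxx\<close> (one-sided in \<open>x\<close> at the end points) and satisfies the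
  homogeneous Neumann condition.  Values off the domain are irrelevant.\<close>

definition classical_neumann ::
  "real \<Rightarrow> (real \<Rightarrow> real \<Rightarrow> real) \<Rightarrow> (real \<Rightarrow> real \<Rightarrow> real) \<Rightarrow> (real \<Rightarrow> real \<Rightarrow> real) \<Rightarrow>
   (real \<Rightarrow> real \<Rightarrow> real) \<Rightarrow> bool" where
  "classical_neumann l u ut ux uxx \<longleftrightarrow>
     continuous_on ({0..l * pi} \<times> {0..}) (\<lambda>(x, t). u x t) \<and>
     continuous_on ({0..l * pi} \<times> {0<..}) (\<lambda>(x, t). ut x t) \<and>
     continuous_on ({0..l * pi} \<times> {0<..}) (\<lambda>(x, t). ux x t) \<and>
     continuous_on ({0..l * pi} \<times> {0<..}) (\<lambda>(x, t). uxx x t) \<and>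
     (\<forall>x\<in>{0..l * pi}. \<forall>t>0.
        ((\<lambda>s. u x s) has_real_derivative ut x t) (at t) \<and>
        ((\<lambda>y. u y t) has_real_derivative ux x t) (at x within {0..l * pi}) \<and>
        ((\<lambda>y. ux y t) has_real_derivative uxx x t) (at x within {0..l * pi})) \<and>
     (\<forall>t>0. ux 0 t = 0 \<and> ux (l * pi) t = 0)"

text \<open>Global classical solutions of (HT) on \<open>[0, l\<pi>] \<times> [0, \<infinity>)\<close>.  Positivity of \<open>u\<close> is part of the
  definition because the reaction term contains \<open>v / u\<close>.\<close>

definition HT_solution ::
  "real \<Rightarrow> real \<Rightarrow> real \<Rightarrow> real \<Rightarrow> real \<Rightarrow> real \<Rightarrow>
   (real \<Rightarrow> real \<Rightarrow> real) \<Rightarrow> (real \<Rightarrow> real \<Rightarrow> real) \<Rightarrow> bool" where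
  "HT_solution d1 d2 a b r l u v \<longleftrightarrow>
     (\<forall>x\<in>{0..l * pi}. \<forall>t\<ge>0. u x t > 0) \<and>
     (\<exists>ut ux uxx vt vx vxx.
        classical_neumann l u ut ux uxx \<and> classical_neumann l v vt vx vxx \<and>
        (\<forall>x\<in>{0<..<l * pi}. \<forall>t>0.
           ut x t - d1 * uxx x t = react_u a b (u x t) (v x t) \<and>
           vt x t - d2 * vxx x t = react_v r (u x t) (v x t)))"

text \<open>Solutions defined for all times \<open>t \<in> \<real>\<close> (steady states, time-periodic and quasi-periodic
  solutions, connecting orbits): every time shift is a solution.\<close>

definition HT_entire_solution ::
  "real \<Rightarrow> real \<Rightarrow> real \<Rightarrow> real \<Rightarrow> real \<Rightarrow> real \<Rightarrow>
   (real \<Rightarrow> real \<Rightarrow> real) \<Rightarrow> (real \<Rightarrow> real \<Rightarrow> real) \<Rightarrow> bool" where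
  "HT_entire_solution d1 d2 a b r l u v \<longleftrightarrow>
     (\<forall>s. HT_solution d1 d2 a b r l (\<lambda>x t. u x (t + s)) (\<lambda>x t. v x (t + s)))"

text \<open>Orbital Lyapunov stability, in the supremum norm, of an entire solution: for initial data
  close to \<open>(u(\<cdot>,0), v(\<cdot>,0))\<close> the solution of (HT) exists globally and stays close to the orbit.
  For a steady state this is Lyapunov stability.\<close>

definition HT_stable ::
  "real \<Rightarrow> real \<Rightarrow> real \<Rightarrow> real \<Rightarrow> real \<Rightarrow> real \<Rightarrow>
   (real \<Rightarrow> real \<Rightarrow> real) \<Rightarrow> (real \<Rightarrow> real \<Rightarrow> real) \<Rightarrow> bool" where
  "HT_stable d1 d2 a b r l u v \<longleftrightarrow>
     (\<forall>\<epsilon>>0. \<exists>\<delta>>0. \<forall>p q.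
        continuous_on {0..l * pi} p \<and> continuous_on {0..l * pi} q \<and>
        (\<forall>x\<in>{0..l * pi}. \<bar>p x - u x 0\<bar> < \<delta> \<and> \<bar>q x - v x 0\<bar> < \<delta>) \<longrightarrow>
        (\<exists>U V. HT_solution d1 d2 a b r l U V \<and>
           (\<forall>x\<in>{0..l * pi}. U x 0 = p x \<and> V x 0 = q x) \<and>
           (\<forall>t\<ge>0. \<exists>s. \<forall>x\<in>{0..l * pi}.
              \<bar>U x t - u x s\<bar> < \<epsilon> \<and> \<bar>V x t - v x s\<bar> < \<epsilon>)))"

text \<open>Bifurcation solutions: a sequence of nontrivial entire solutions \<open>(U m, V m)\<close> of (HT), with
  parameters \<open>(R m, \<Lambda> m)\<close> tending to the critical values \<open>(r, l)\<close>, that shrinks to the constant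
  steady state uniformly in space and time.\<close>

definition bifurcation_solutions ::
  "real \<Rightarrow> real \<Rightarrow> real \<Rightarrow> real \<Rightarrow> real \<Rightarrow> real \<Rightarrow> (nat \<Rightarrow> real) \<Rightarrow> (nat \<Rightarrow> real) \<Rightarrow>
   (nat \<Rightarrow> real \<Rightarrow> real \<Rightarrow> real) \<Rightarrow> (nat \<Rightarrow> real \<Rightarrow> real \<Rightarrow> real) \<Rightarrow> bool" where
  "bifurcation_solutions d1 d2 a b r l R \<Lambda> U V \<longleftrightarrow>
     (\<forall>m. R m > 0 \<and> \<Lambda> m > 0) \<and> R \<longlonglongrightarrow> r \<and> \<Lambda> \<longlonglongrightarrow> l \<and>
     (\<forall>m. HT_entire_solution d1 d2 a b (R m) (\<Lambda> m) (U m) (V m)) \<and>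
     (\<forall>m. \<exists>x\<in>{0..\<Lambda> m * pi}. \<exists>t. U m x t \<noteq> u_star a b \<or> V m x t \<noteq> u_star a b) \<and>
     (\<forall>\<epsilon>>0. \<forall>\<^sub>F m in sequentially. \<forall>x\<in>{0..\<Lambda> m * pi}. \<forall>t.
        \<bar>U m x t - u_star a b\<bar> < \<epsilon> \<and> \<bar>V m x t - u_star a b\<bar> < \<epsilon>)"

section \<open>The linearization at the constant steady state\<close>

text \<open>Pairs of complex functions on \<open>[0, l\<pi>]\<close> are represented by functions on \<open>\<real>\<close> that vanish
  outside the interval, so that dimensions of spaces of such pairs are meaningful.\<close>

definition cscale :: "complex \<Rightarrow> (real \<Rightarrow> complex \<times> complex) \<Rightarrow> real \<Rightarrow> complex \<times> complex" where
  "cscale c w = (\<lambda>x. (c * fst (w x), c * snd (w x)))"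

interpretation cfun: vector_space cscale
  by unfold_locales (auto simp: cscale_def fun_eq_iff prod_eq_iff algebra_simps)

definition ddx :: "real \<Rightarrow> (real \<Rightarrow> complex \<times> complex) \<Rightarrow> real \<Rightarrow> complex \<times> complex" where
  "ddx l w x = vector_derivative w (at x within {0..l * pi})"

definition neumann_domain :: "real \<Rightarrow> (real \<Rightarrow> complex \<times> complex) set" where
  "neumann_domain l =
     {w. (\<forall>x. x \<notin> {0..l * pi} \<longrightarrow> w x = 0) \<and>
         w differentiable_on {0..l * pi} \<and> ddx l w differentiable_on {0..l * pi} \<and>
         continuous_on {0..l * pi} (ddx l (ddx l w)) \<and>
         ddx l w 0 = 0 \<and> ddx l w (l * pi) = 0}"

definition linearization ::
  "real \<Rightarrow> real \<Rightarrow> real \<Rightarrow> real \<Rightarrow> real \<Rightarrow> real \<Rightarrow>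
   (real \<Rightarrow> complex \<times> complex) \<Rightarrow> real \<Rightarrow> complex \<times> complex" where
  "linearization d1 d2 a b r l w = (\<lambda>x.
     if x \<in> {0..l * pi} then
       (let e = u_star a b; \<phi> = fst (w x); \<psi> = snd (w x); w2 = ddx l (ddx l w) x in
         (of_real d1 * fst w2 + of_real (deriv (\<lambda>u. react_u a b u e) e) * \<phi>
            + of_real (deriv (\<lambda>v. react_u a b e v) e) * \<psi>,
          of_real d2 * snd w2 + of_real (deriv (\<lambda>u. react_v r u e) e) * \<phi>
            + of_real (deriv (\<lambda>v. react_v r e v) e) * \<psi>))
     else 0)"

definition eigenspace ::
  "real \<Rightarrow> real \<Rightarrow> real \<Rightarrow> real \<Rightarrow> real \<Rightarrow> real \<Rightarrow> complex \<Rightarrow> (real \<Rightarrow> complex \<times> complex) set" where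
  "eigenspace d1 d2 a b r l \<mu> =
     {w \<in> neumann_domain l. linearization d1 d2 a b r l w = cscale \<mu> w}"

definition is_eigenvalue ::
  "real \<Rightarrow> real \<Rightarrow> real \<Rightarrow> real \<Rightarrow> real \<Rightarrow> real \<Rightarrow> complex \<Rightarrow> bool" where
  "is_eigenvalue d1 d2 a b r l \<mu> \<longleftrightarrow> (\<exists>w\<in>eigenspace d1 d2 a b r l \<mu>. w \<noteq> 0)"

text \<open>The kernel of the \<open>m\<close>-th power of (linearization minus \<open>\<mu>\<close>).\<close>

primrec power_kernel ::
  "real \<Rightarrow> real \<Rightarrow> real \<Rightarrow> real \<Rightarrow> real \<Rightarrow> real \<Rightarrow> complex \<Rightarrow> nat \<Rightarrow>
   (real \<Rightarrow> complex \<times> complex) set" where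
  "power_kernel d1 d2 a b r l \<mu> 0 = {0}"
| "power_kernel d1 d2 a b r l \<mu> (Suc m) =
     {w \<in> neumann_domain l.
        linearization d1 d2 a b r l w - cscale \<mu> w \<in> power_kernel d1 d2 a b r l \<mu> m}"

definition alg_multiplicity ::
  "real \<Rightarrow> real \<Rightarrow> real \<Rightarrow> real \<Rightarrow> real \<Rightarrow> real \<Rightarrow> complex \<Rightarrow> nat" where
  "alg_multiplicity d1 d2 a b r l \<mu> = cfun.dim (\<Union>m. power_kernel d1 d2 a b r l \<mu> m)"

text \<open>Hopf--double-zero bifurcation at \<open>r\<close> (for the given \<open>l\<close>): the critical spectrum consists of
  one pair of simple purely imaginary eigenvalues and the eigenvalue zero of multiplicity two, and
  all four critical eigenvalues move through their critical values with nonzero speed as \<open>r\<close>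
  varies.  The independence of \<open>w1 s\<close> and \<open>w2 s\<close> ensures that the branches \<open>\<mu>1\<close> and \<open>\<mu>2\<close> account
  for both zero eigenvalues.  (The branch through the conjugate eigenvalue \<open>-\<i>\<omega>\<close> is the conjugate
  of \<open>\<kappa>\<close>, the linearization having real coefficients.)\<close>

definition Hopf_double_zero_bifurcation ::
  "real \<Rightarrow> real \<Rightarrow> real \<Rightarrow> real \<Rightarrow> real \<Rightarrow> real \<Rightarrow> bool" where
  "Hopf_double_zero_bifurcation d1 d2 a b r l \<longleftrightarrow>
     (\<exists>\<omega>::real. \<omega> > 0 \<and>
        alg_multiplicity d1 d2 a b r l (\<i> * of_real \<omega>) = 1 \<and>
        alg_multiplicity d1 d2 a b r l (- \<i> * of_real \<omega>) = 1 \<and>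
        alg_multiplicity d1 d2 a b r l 0 = 2 \<and>
        (\<forall>\<mu>. is_eigenvalue d1 d2 a b r l \<mu> \<and> Re \<mu> = 0 \<longrightarrow>
              \<mu> \<in> {\<i> * of_real \<omega>, - \<i> * of_real \<omega>, 0}) \<and>
        (\<exists>(\<kappa>::real \<Rightarrow> complex) \<kappa>'. \<kappa> r = \<i> * of_real \<omega> \<and>
           (\<kappa> has_vector_derivative \<kappa>') (at r) \<and> Re \<kappa>' \<noteq> 0 \<and>
           (\<forall>\<^sub>F s in nhds r. is_eigenvalue d1 d2 a b s l (\<kappa> s)))) \<and>
     (\<exists>(\<mu>1::real \<Rightarrow> complex) \<mu>1' (\<mu>2::real \<Rightarrow> complex) \<mu>2' w1 w2.
        \<mu>1 r = 0 \<and> (\<mu>1 has_vector_derivative \<mu>1') (at r) \<and> Re \<mu>1' \<noteq> 0 \<and>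
        \<mu>2 r = 0 \<and> (\<mu>2 has_vector_derivative \<mu>2') (at r) \<and> Re \<mu>2' \<noteq> 0 \<and>
        (\<forall>\<^sub>F s in nhds r.
           w1 s \<in> eigenspace d1 d2 a b s l (\<mu>1 s) \<and> w2 s \<in> eigenspace d1 d2 a b s l (\<mu>2 s) \<and>
           w1 s \<noteq> w2 s \<and> cfun.independent {w1 s, w2 s}))"

text \<open>The double-Turing case: the zero eigenvalue is semisimple and its eigenfunctions are
  spatially inhomogeneous.\<close>

definition Hopf_double_Turing_bifurcation ::
  "real \<Rightarrow> real \<Rightarrow> real \<Rightarrow> real \<Rightarrow> real \<Rightarrow> real \<Rightarrow> bool" where
  "Hopf_double_Turing_bifurcation d1 d2 a b r l \<longleftrightarrow>
     Hopf_double_zero_bifurcation d1 d2 a b r l \<and>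
     cfun.dim (eigenspace d1 d2 a b r l 0) = 2 \<and>
     (\<forall>w\<in>eigenspace d1 d2 a b r l 0. w \<noteq> 0 \<longrightarrow> \<not> (\<exists>c. \<forall>x\<in>{0..l * pi}. w x = c))"

section \<open>Critical parameter values\<close>

definition A0 :: "real \<Rightarrow> real \<Rightarrow> real" where
  "A0 a b = u_star a b / (b + u_star a b) * (1 - b - 2 * u_star a b)"

definition B0 :: "real \<Rightarrow> real \<Rightarrow> real" where
  "B0 a b = - (a * u_star a b / (b + u_star a b))"

definition r_H :: "real \<Rightarrow> real \<Rightarrow> real \<Rightarrow> real \<Rightarrow> nat \<Rightarrow> real \<Rightarrow> real" where
  "r_H d1 d2 a b n l = A0 a b - (d1 + d2) * (real n ^ 2 / l ^ 2)"

definition r_T :: "real \<Rightarrow> real \<Rightarrow> real \<Rightarrow> real \<Rightarrow> nat \<Rightarrow> real \<Rightarrow> real" where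
  "r_T d1 d2 a b n l =
     - (d2 * (real n ^ 2 / l ^ 2) * (d1 * (real n ^ 2 / l ^ 2) - A0 a b)
        / (d1 * (real n ^ 2 / l ^ 2) - A0 a b - B0 a b))"

definition x_bar :: "real \<Rightarrow> real \<Rightarrow> real \<Rightarrow> real \<Rightarrow> real" where
  "x_bar d1 d2 a b = 1 / (2 * d1 ^ 2) *
     (2 * d1 * A0 a b + (d1 + d2) * B0 a b
      + sqrt ((d1 + d2) ^ 2 * B0 a b ^ 2 + 4 * d1 * d2 * A0 a b * B0 a b))"

definition l_H :: "real \<Rightarrow> real \<Rightarrow> real \<Rightarrow> real \<Rightarrow> nat \<Rightarrow> real" where
  "l_H d1 d2 a b n = real n / sqrt (x_bar d1 d2 a b)"

definition l_T :: "real \<Rightarrow> real \<Rightarrow> real \<Rightarrow> nat \<Rightarrow> real" where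
  "l_T d1 a b n = real n * sqrt (d1 / A0 a b)"

text \<open>Membership in \<open>S2 \<dots> N1 N2\<close> says precisely that \<open>N1 = N1(l)\<close> and \<open>N2 = N2(l)\<close>.\<close>

definition S2 :: "real \<Rightarrow> real \<Rightarrow> real \<Rightarrow> real \<Rightarrow> nat \<Rightarrow> nat \<Rightarrow> real set" where
  "S2 d1 d2 a b N1 N2 =
     {l_H d1 d2 a b N1 <.. l_H d1 d2 a b (N1 + 1)} \<inter> {l_T d1 a b N2 <.. l_T d1 a b (N2 + 1)}"

definition L_TTH :: "real \<Rightarrow> real \<Rightarrow> real \<Rightarrow> real \<Rightarrow> nat \<Rightarrow> nat \<Rightarrow> real set" where
  "L_TTH d1 d2 a b N1 N2 =
     {l \<in> S2 d1 d2 a b N1 N2. \<exists>i j k. i \<le> N1 \<and> N1 < j \<and> j < k \<and> k \<le> N2 \<and>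
        r_H d1 d2 a b i l = r_T d1 d2 a b j l \<and> r_T d1 d2 a b j l = r_T d1 d2 a b k l}"

section \<open>The conditions (A5') and (A6')\<close>

definition x_hat :: "real \<Rightarrow> real \<Rightarrow> real \<Rightarrow> real" where
  "x_hat d1 a b = 1 / d1 * ((A0 a b + B0 a b) + sqrt (B0 a b * (A0 a b + B0 a b)))"

definition b_crit :: "real \<Rightarrow> real \<Rightarrow> real" where
  "b_crit d1 d2 =
     ((d1 + d2) ^ 2 - sqrt ((d1 + d2) ^ 4 - (d1 - d2) ^ 4)) ^ 2 / (d1 - d2) ^ 4"

definition a_minus :: "real \<Rightarrow> real \<Rightarrow> real \<Rightarrow> real" where
  "a_minus d1 d2 b =
     ((1 - b) * (d1 + d2) ^ 4
      - (d1 + d2) ^ 2 * sqrt ((b + 1) ^ 2 * (d1 - d2) ^ 4 - 4 * b * (d1 + d2) ^ 4))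
     / ((d1 + d2) ^ 4 - (d1 - d2) ^ 4)"

definition a_plus :: "real \<Rightarrow> real \<Rightarrow> real \<Rightarrow> real" where
  "a_plus d1 d2 b =
     ((1 - b) * (d1 + d2) ^ 4
      + (d1 + d2) ^ 2 * sqrt ((b + 1) ^ 2 * (d1 - d2) ^ 4 - 4 * b * (d1 + d2) ^ 4))
     / ((d1 + d2) ^ 4 - (d1 - d2) ^ 4)"

definition x_minus :: "real \<Rightarrow> real \<Rightarrow> real \<Rightarrow> real \<Rightarrow> real" where
  "x_minus d1 d2 a b = 1 / (2 * d1 * d2) *
     ((d2 - d1) * A0 a b
      - sqrt ((d1 + d2) ^ 2 * A0 a b ^ 2 + 4 * d1 * d2 * A0 a b * B0 a b))"

definition x_plus :: "real \<Rightarrow> real \<Rightarrow> real \<Rightarrow> real \<Rightarrow> real" where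
  "x_plus d1 d2 a b = 1 / (2 * d1 * d2) *
     ((d2 - d1) * A0 a b
      + sqrt ((d1 + d2) ^ 2 * A0 a b ^ 2 + 4 * d1 * d2 * A0 a b * B0 a b))"

definition l_minus :: "real \<Rightarrow> real \<Rightarrow> real \<Rightarrow> real \<Rightarrow> nat \<Rightarrow> real" where
  "l_minus d1 d2 a b n = real n / sqrt (x_minus d1 d2 a b)"

definition l_plus :: "real \<Rightarrow> real \<Rightarrow> real \<Rightarrow> real \<Rightarrow> nat \<Rightarrow> real" where
  "l_plus d1 d2 a b n = real n / sqrt (x_plus d1 d2 a b)"

definition cond_A5' :: "real \<Rightarrow> real \<Rightarrow> real \<Rightarrow> real \<Rightarrow> real \<Rightarrow> bool" where
  "cond_A5' d1 d2 a b l \<longleftrightarrow>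
     d2 > d1 \<and> 0 < b \<and> b \<le> b_crit d1 d2 \<and> (a = a_minus d1 d2 b \<or> a = a_plus d1 d2 b) \<and>
     (\<exists>n::nat. l = real n * sqrt (1 / x_hat d1 a b))"

text \<open>For \<open>l > 0\<close> the inequalities determine \<open>M1\<close> and \<open>M2\<close>, and they force \<open>M1 \<ge> 1\<close>, so the
  truncated subtraction \<open>M1 - 1\<close> is harmless.\<close>

definition cond_A6' :: "real \<Rightarrow> real \<Rightarrow> real \<Rightarrow> real \<Rightarrow> real \<Rightarrow> bool" where
  "cond_A6' d1 d2 a b l \<longleftrightarrow>
     d2 > d1 \<and> 0 < b \<and> b < b_crit d1 d2 \<and> a_minus d1 d2 b < a \<and> a < a_plus d1 d2 b \<and>
     (\<exists>M1 M2. l_minus d1 d2 a b (M1 - 1) \<le> l \<and> l < l_minus d1 d2 a b M1 \<and>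
        l_plus d1 d2 a b M2 < l \<and> l \<le> l_plus d1 d2 a b (M2 + 1) \<and> M1 > M2) \<and>
     (\<exists>n::nat. l = real n * sqrt (1 / x_minus d1 d2 a b) \<or>
               l = real n * sqrt (1 / x_plus d1 d2 a b))"

end

theory Submission
  imports Defs
begin

text \<open>The linearization at the constant steady state leaves every cosine mode \<open>cos (n x / l)\<close> invariant and acts on
  it by a two-by-two matrix with trace \<open>T\<^sub>n\<close> and determinant \<open>D\<^sub>n\<close>.  The relations \<open>r = r_H i\<close> and \<open>r = r_T j = r_T k\<close>
  say that \<open>T\<^sub>i = 0\<close> and \<open>D\<^sub>j = D\<^sub>k = 0\<close>.  Since \<open>T\<^sub>n\<close> decreases with \<open>n\<close> and \<open>D\<^sub>n\<close> is a convex quadratic polynomial in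
  \<open>n\<^sup>2 / l\<^sup>2\<close>, no other mode is critical, and at the critical modes the critical eigenvalues are simple.
  Parseval's identity for the cosines (\<open>cos_parseval\<close>) turns this into a statement about the differential
  operator: \<open>generalized_eigenspace\<close> and \<open>eigenspace_dim\<close> compute the algebraic multiplicities, and the
  quadratic formula supplies the branches through the critical eigenvalues (\<open>Hopf_double_Turing\<close>).\<close>

text \<open>For the second assertion it suffices that linear instability at the critical parameters rules out stable
  solutions near the steady state (\<open>no_stable_bifurcation\<close>), for such an instability is present unless
  \<open>i = 0\<close> and \<open>k = j + 1\<close>.  The difference of two solutions that stay near the steady state solves the
  linearized system up to an error that is a small multiple of the difference itself.  Let \<open>J\<close> be the
  quadratic functional of the difference that on each of finitely many low modes is the form solving
  the Lyapunov equation for the mode matrix shifted by a small \<open>\<sigma> > 0\<close> (\<open>lyapunov_2x2\<close>), and on the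
  high modes is minus the squared \<open>L\<^sup>2\<close> norm.  Then \<open>J' \<ge> 2 \<sigma> J\<close> (\<open>functional_growth\<close>).  A perturbation along an
  unstable mode makes \<open>J\<close> initially positive, so \<open>J\<close> grows exponentially and the perturbed solution cannot
  stay near the steady state, as stability would demand.\<close>

text \<open>In the remaining case \<open>i = 0\<close>, \<open>k = j + 1\<close>, one has \<open>r = A0\<close>, and the two critical wave numbers are the
  distinct roots \<open>x_minus\<close> and \<open>x_plus\<close> of a quadratic; positivity of their sum and of the discriminant,
  together with \<open>k = j + 1\<close>, amounts to condition (A6') (\<open>marginal_A6'\<close>).\<close>

section \<open>Cosine series on an interval\<close>

text \<open>The eigenfunctions of the Neumann Laplacian on \<open>[0, l\<pi>]\<close>, normalized in \<open>L\<^sup>2\<close>; the constant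
  mode has its own normalizing factor.\<close>

definition cos_mode :: "real \<Rightarrow> nat \<Rightarrow> real \<Rightarrow> real" where
  "cos_mode l n x = cos (real n * x / l) / sqrt (if n = 0 then l * pi else l * pi / 2)"

text \<open>Vector-valued functions are admitted so that the same coefficient serves the real solutions
  of the parabolic system and the complex pairs on which the linearization acts.\<close>

definition cos_coeff :: "real \<Rightarrow> nat \<Rightarrow> (real \<Rightarrow> 'a::euclidean_space) \<Rightarrow> 'a" where
  "cos_coeff l n f = integral {0..l * pi} (\<lambda>x. cos_mode l n x *\<^sub>R f x)"

lemma continuous_on_cos_mode [continuous_intros]:
  fixes f :: "real \<Rightarrow> real"
  shows
  "continuous_on S f \<Longrightarrow> continuous_on S (\<lambda>x. cos_mode l n (f x))"
  unfolding cos_mode_def divide_inverse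
  by (intro continuous_on_mult continuous_on_cos continuous_on_const)

lemma cos_coeff_integrable:
  fixes f :: "real \<Rightarrow> 'a::euclidean_space"
  assumes "continuous_on {0..l * pi} f"
  shows "(\<lambda>x. cos_mode l n x *\<^sub>R f x) integrable_on {0..l * pi}"
  by (intro integrable_continuous_real continuous_intros assms)

lemma cos_coeff_add:
  assumes "continuous_on {0..l * pi} f" "continuous_on {0..l * pi} g"
  shows "cos_coeff l n (\<lambda>x. f x + g x) = cos_coeff l n f + cos_coeff l n g"
  unfolding cos_coeff_def
  by (simp add: scaleR_add_right integral_add cos_coeff_integrable assms)

lemma cos_coeff_diff:
  assumes "continuous_on {0..l * pi} f" "continuous_on {0..l * pi} g"
  shows "cos_coeff l n (\<lambda>x. f x - g x) = cos_coeff l n f - cos_coeff l n g"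
  unfolding cos_coeff_def
  by (simp add: scaleR_diff_right integral_diff cos_coeff_integrable assms)

lemma cos_coeff_bounded_linear:
  assumes "continuous_on {0..l * pi} f" "bounded_linear h"
  shows "cos_coeff l n (\<lambda>x. h (f x)) = h (cos_coeff l n f)"
proof -
  interpret bounded_linear h by fact
  show ?thesis
    using integral_linear[OF cos_coeff_integrable[OF assms(1)] assms(2), of n]
    unfolding cos_coeff_def o_def by (simp add: scaleR)
qed

lemma cos_coeff_scaleR:
  assumes "continuous_on {0..l * pi} f"
  shows "cos_coeff l n (\<lambda>x. c *\<^sub>R f x) = c *\<^sub>R cos_coeff l n f"
  by (rule cos_coeff_bounded_linear[OF assms bounded_linear_scaleR_right])

lemma cos_coeff_mult:
  fixes f :: "real \<Rightarrow> real"
  assumes "continuous_on {0..l * pi} f"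
  shows "cos_coeff l n (\<lambda>x. c * f x) = c * cos_coeff l n f"
  using cos_coeff_scaleR[OF assms] by simp

lemma cos_coeff_inner:
  assumes "continuous_on {0..l * pi} f"
  shows "cos_coeff l n (\<lambda>x. f x \<bullet> b) = cos_coeff l n f \<bullet> b"
  by (rule cos_coeff_bounded_linear[OF assms bounded_linear_inner_left])

lemma cos_coeff_cong:
  "(\<And>x. x \<in> {0..l * pi} \<Longrightarrow> f x = g x) \<Longrightarrow> cos_coeff l n f = cos_coeff l n g"
  unfolding cos_coeff_def by (rule integral_cong) auto

lemma cos_coeff_zero [simp]: "cos_coeff l n (\<lambda>x. 0) = 0"
  by (simp add: cos_coeff_def)

lemma cos_coeff_sum:
  assumes "finite S" "\<And>k. k \<in> S \<Longrightarrow> continuous_on {0..l * pi} (f k)"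
  shows "cos_coeff l n (\<lambda>x. \<Sum>k\<in>S. f k x) = (\<Sum>k\<in>S. cos_coeff l n (f k))"
  using assms
proof (induction rule: finite_induct)
  case (insert k S)
  have "continuous_on {0..l * pi} (\<lambda>x. \<Sum>k\<in>S. f k x)"
    using insert by (intro continuous_intros) auto
  with insert show ?case by (simp add: cos_coeff_add)
qed simp

lemma has_integral_cos_multiple:
  assumes "l > 0" "sin (d * pi) = 0" "d \<noteq> 0"
  shows "((\<lambda>x. cos (d * x / l)) has_integral 0) {0..l * pi}"
proof -
  have "((\<lambda>x. cos (d * x / l)) has_integral
      (l / d * sin (d * (l * pi) / l) - l / d * sin (d * 0 / l))) {0..l * pi}"
    using assms
    by (intro fundamental_theorem_of_calculus)
       (auto intro!: derivative_eq_intros simp flip: has_real_derivative_iff_has_vector_derivative)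
  with assms show ?thesis by simp
qed

lemma has_integral_cos_difference:
  assumes "l > 0"
  shows "((\<lambda>x. cos ((real n - real m) * x / l)) has_integral (if n = m then l * pi else 0)) {0..l * pi}"
proof (cases "n = m")
  case True
  with has_integral_const_real[of "1::real" 0 "l * pi"] assms show ?thesis by simp
next
  case False
  have "sin ((real n - real m) * pi) = 0"
    by (simp add: left_diff_distrib sin_diff)
  with False assms has_integral_cos_multiple[of l "real n - real m"] show ?thesis by simp
qed

lemma has_integral_cos_sum:
  assumes "l > 0"
  shows "((\<lambda>x. cos ((real n + real m) * x / l)) has_integral (if n = 0 \<and> m = 0 then l * pi else 0)) {0..l * pi}"
  using has_integral_cos_difference[OF assms, of "n + m" 0] by simp

lemma cos_coeff_cos_mode:
  assumes "l > 0"
  shows "cos_coeff l n (cos_mode l m) = (if n = m then 1 else 0)"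
proof -
  define c where "c k = sqrt (if k = (0::nat) then l * pi else l * pi / 2)" for k
  have prod: "cos (real n * x / l) * cos (real m * x / l) =
      (cos ((real n - real m) * x / l) + cos ((real n + real m) * x / l)) / 2" for x
    by (simp add: cos_times_cos left_diff_distrib distrib_right add_divide_distrib diff_divide_distrib)
  have "((\<lambda>x. (cos ((real n - real m) * x / l) + cos ((real n + real m) * x / l)) * (1 / (2 * c n * c m)))
      has_integral ((if n = m then l * pi else 0) + (if n = 0 \<and> m = 0 then l * pi else 0))
        * (1 / (2 * c n * c m))) {0..l * pi}"
    by (intro has_integral_mult_left has_integral_add has_integral_cos_difference
        has_integral_cos_sum assms)
  moreover have "(cos ((real n - real m) * x / l) + cos ((real n + real m) * x / l)) * (1 / (2 * c n * c m))
      = cos_mode l n x *\<^sub>R cos_mode l m x" for x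
    unfolding cos_mode_def c_def[symmetric] real_scaleR_def times_divide_times_eq prod by simp
  moreover have "((if n = m then l * pi else 0) + (if n = 0 \<and> m = 0 then l * pi else 0))
        * (1 / (2 * c n * c m)) = (if n = m then 1 else 0)"
    using assms real_sqrt_mult_self[of "l * pi / 2"] real_sqrt_mult_self[of "l * pi"] by (auto simp: c_def simp del: real_sqrt_mult_self)
  ultimately show ?thesis
    unfolding cos_coeff_def by (simp add: integral_unique)
qed

lemma cos_coeff_cos_mode_vec:
  fixes v :: "'a::euclidean_space"
  assumes "l > 0"
  shows "cos_coeff l n (\<lambda>x. cos_mode l m x *\<^sub>R v) = (if n = m then v else 0)"
  using cos_coeff_bounded_linear[OF _ bounded_linear_scaleR_left, of l "cos_mode l m" n v]
    cos_coeff_cos_mode[OF assms, of n m]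
  by (simp add: continuous_on_cos_mode)

text \<open>Two integrations by parts, done at once: \<open>\<phi> f' - \<phi>' f\<close> is a primitive of \<open>\<phi> f'' - \<phi>'' f\<close>.  It vanishes
  at both end points, since \<open>f'\<close> and the derivative of the cosine do.\<close>

lemma cos_coeff_second_derivative:
  fixes f :: "real \<Rightarrow> 'a::euclidean_space"
  assumes l: "l > 0"
    and f: "\<And>x. x \<in> {0..l * pi} \<Longrightarrow> (f has_vector_derivative f' x) (at x within {0..l * pi})"
    and f': "\<And>x. x \<in> {0..l * pi} \<Longrightarrow> (f' has_vector_derivative f'' x) (at x within {0..l * pi})"
    and f'': "continuous_on {0..l * pi} f''"
    and bc: "f' 0 = 0" "f' (l * pi) = 0"
  shows "cos_coeff l n f'' = - (real n ^ 2 / l ^ 2) *\<^sub>R cos_coeff l n f"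
proof -
  define c where "c = sqrt (if n = 0 then l * pi else l * pi / 2)"
  have l0: "l \<noteq> 0" and c: "c \<noteq> 0" using l by (simp_all add: c_def)
  have cm: "cos_mode l n x = cos (real n * x / l) / c" for x by (simp add: cos_mode_def c_def)
  define s where "s x = real n / l * sin (real n * x / l) / c" for x
  have dc: "(cos_mode l n has_real_derivative - s x) (at x within {0..l * pi})" for x
    unfolding s_def cos_mode_def c_def[symmetric]
    by (auto intro!: derivative_eq_intros simp: c l0)
  have ds: "(s has_real_derivative (real n ^ 2 / l ^ 2) * cos_mode l n x) (at x within {0..l * pi})" for x
    unfolding s_def cm
    by (auto intro!: derivative_eq_intros simp: power2_eq_square c l0 mult_ac)
  define F where "F x = cos_mode l n x *\<^sub>R f' x + s x *\<^sub>R f x" for x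
  have "(F has_vector_derivative
      (cos_mode l n x *\<^sub>R f'' x + (real n ^ 2 / l ^ 2) *\<^sub>R (cos_mode l n x *\<^sub>R f x))) (at x within {0..l * pi})"
    if x: "x \<in> {0..l * pi}" for x
    unfolding F_def
    by (auto intro!: derivative_eq_intros dc ds f[OF x] f'[OF x]
        has_vector_derivative_scaleR[THEN has_vector_derivative_eq_rhs])
  hence "((\<lambda>x. cos_mode l n x *\<^sub>R f'' x + (real n ^ 2 / l ^ 2) *\<^sub>R (cos_mode l n x *\<^sub>R f x))
      has_integral F (l * pi) - F 0) {0..l * pi}"
    using l by (intro fundamental_theorem_of_calculus) auto
  moreover have "F (l * pi) = 0" "F 0 = 0"
    using bc l by (auto simp: F_def s_def mult.commute[of l pi])
  ultimately have *: "integral {0..l * pi}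
      (\<lambda>x. cos_mode l n x *\<^sub>R f'' x + (real n ^ 2 / l ^ 2) *\<^sub>R (cos_mode l n x *\<^sub>R f x)) = 0"
    by (simp add: integral_unique)
  have cf: "continuous_on {0..l * pi} f"
    using f by (meson continuous_on_vector_derivative)
  have int: "(\<lambda>x. cos_mode l n x *\<^sub>R f'' x) integrable_on {0..l * pi}"
    "(\<lambda>x. (real n ^ 2 / l ^ 2) *\<^sub>R (cos_mode l n x *\<^sub>R f x)) integrable_on {0..l * pi}"
    by (rule cos_coeff_integrable[OF f''], rule integrable_cmul[OF cos_coeff_integrable[OF cf]])
  have "cos_coeff l n f'' + (real n ^ 2 / l ^ 2) *\<^sub>R cos_coeff l n f = 0"
    using * unfolding integral_add[OF int] integral_cmul cos_coeff_def .
  thus ?thesis by (simp add: eq_neg_iff_add_eq_0)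
qed

subsection \<open>Parseval's identity\<close>

text \<open>An inductive description, since closure under products, which the Stone--Weierstrass theorem
  needs, then follows from the product formula for two cosines by two inductions.\<close>

inductive trig_poly :: "real \<Rightarrow> (real \<Rightarrow> real) \<Rightarrow> bool" for l where
  trig_zero: "trig_poly l (\<lambda>x. 0)"
| trig_step: "trig_poly l f \<Longrightarrow> trig_poly l (\<lambda>x. f x + c * cos (real n * x / l))"

lemma trig_add:
  assumes "trig_poly l g" "trig_poly l f"
  shows "trig_poly l (\<lambda>x. f x + g x)"
  using assms by induction (auto simp: add.assoc[symmetric] intro: trig_step)

lemma trig_mult_cos:
  assumes "trig_poly l f"
  shows "trig_poly l (\<lambda>x. f x * (c * cos (real m * x / l)))"
  using assms
proof induction
  case trig_zero
  show ?case by (simp add: trig_poly.trig_zero)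
next
  case (trig_step f d n)
  have red: "cos (real n * x / l) * cos (real m * x / l) =
      (cos (real (nat \<bar>int n - int m\<bar>) * x / l) + cos (real (n + m) * x / l)) / 2" for x
  proof -
    have "real (nat \<bar>int n - int m\<bar>) = \<bar>real n - real m\<bar>" by auto
    hence "cos (real (nat \<bar>int n - int m\<bar>) * x / l) = cos ((real n - real m) * x / l)"
      by (auto simp: abs_if minus_mult_left[symmetric] simp del: minus_diff_eq)
    thus ?thesis
      by (simp add: cos_times_cos left_diff_distrib distrib_right add_divide_distrib diff_divide_distrib)
  qed
  have "(f x + d * cos (real n * x / l)) * (c * cos (real m * x / l)) =
      f x * (c * cos (real m * x / l)) + c * d / 2 * cos (real (nat \<bar>int n - int m\<bar>) * x / l)
        + c * d / 2 * cos (real (n + m) * x / l)" for x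
    using red[of x] by (simp add: algebra_simps) (simp add: field_simps)
  thus ?case
    by (simp only:) (intro trig_poly.trig_step trig_step.IH)
qed

lemma trig_mult:
  assumes "trig_poly l g" "trig_poly l f"
  shows "trig_poly l (\<lambda>x. f x * g x)"
  using assms
  by induction (auto simp: distrib_left intro: trig_poly.trig_zero trig_add trig_mult_cos)

lemma trig_continuous: "trig_poly l f \<Longrightarrow> continuous_on S f"
  by (induction rule: trig_poly.induct) (auto intro!: continuous_intros simp: divide_inverse)

text \<open>The Stone--Weierstrass theorem applies because \<open>cos (x / l)\<close> alone separates the points of
  \<open>[0, l\<pi>]\<close>.\<close>

lemma trig_dense:
  assumes "l > 0" "continuous_on {0..l * pi} f" "e > 0"
  obtains p where "trig_poly l p" "\<And>x. x \<in> {0..l * pi} \<Longrightarrow> \<bar>f x - p x\<bar> < e"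
proof -
  have "\<exists>p. trig_poly l p \<and> (\<forall>x\<in>{0..l * pi}. \<bar>f x - p x\<bar> < e)"
  proof (rule Stone_Weierstrass_HOL)
    show "trig_poly l (\<lambda>x. c)" for c
      using trig_step[OF trig_zero, of l c 0] by simp
    show "\<exists>p. trig_poly l p \<and> p x \<noteq> p y"
      if "x \<in> {0..l * pi} \<and> y \<in> {0..l * pi} \<and> x \<noteq> y" for x y
    proof (intro exI conjI)
      show "trig_poly l (\<lambda>x. cos (x / l))"
        using trig_step[OF trig_zero, of l 1 1] by simp
      have "0 \<le> x / l" "x / l \<le> pi" "0 \<le> y / l" "y / l \<le> pi"
        using that assms(1) by (auto simp: field_simps)
      thus "cos (x / l) \<noteq> cos (y / l)"
        using that assms(1) cos_inj_pi[of "x / l" "y / l"] by auto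
    qed
  qed (use assms in \<open>auto intro: trig_continuous trig_add trig_mult\<close>)
  thus ?thesis using that by blast
qed

definition cos_partial :: "real \<Rightarrow> nat \<Rightarrow> (real \<Rightarrow> real) \<Rightarrow> real \<Rightarrow> real" where
  "cos_partial l N f x = (\<Sum>n<N. cos_coeff l n f * cos_mode l n x)"

lemma trig_poly_cos_partial:
  assumes l: "l > 0" and "trig_poly l p"
  shows "\<exists>N. \<forall>M\<ge>N. cos_partial l M p = p"
  using assms(2)
proof induction
  case trig_zero
  show ?case by (auto simp: cos_partial_def)
next
  case (trig_step f c n)
  then obtain N where N: "\<And>M. M \<ge> N \<Longrightarrow> cos_partial l M f = f" by blast
  define d where "d = c * sqrt (if n = 0 then l * pi else l * pi / 2)"
  have cm: "c * cos (real n * x / l) = d * cos_mode l n x" for x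
    using l by (simp add: d_def cos_mode_def)
  have cf: "cos_coeff l k (\<lambda>x. f x + d * cos_mode l n x) = cos_coeff l k f + d * (if k = n then 1 else 0)" for k
    using trig_continuous[OF trig_step(1)]
    by (simp add: cos_coeff_add cos_coeff_mult cos_coeff_cos_mode[OF l] continuous_intros)
  show ?case unfolding cm
  proof (intro exI[of _ "max N (Suc n)"] allI impI ext)
    fix M x assume M: "M \<ge> max N (Suc n)"
    have "cos_partial l M (\<lambda>x. f x + d * cos_mode l n x) x =
        cos_partial l M f x + (\<Sum>k<M. if k = n then d * cos_mode l n x else 0)"
      unfolding cos_partial_def cf sum.distrib[symmetric]
      by (intro sum.cong) (auto simp: algebra_simps)
    also have "\<dots> = f x + d * cos_mode l n x"
      using M N[of M] by (simp add: sum.delta)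
    finally show "cos_partial l M (\<lambda>x. f x + d * cos_mode l n x) x = f x + d * cos_mode l n x" .
  qed
qed

lemma continuous_on_cos_partial [continuous_intros]: "continuous_on S (cos_partial l N f)"
  unfolding cos_partial_def by (intro continuous_intros)

lemma integral_mult_cos_partial:
  fixes f g :: "real \<Rightarrow> real"
  assumes "continuous_on {0..l * pi} g"
  shows "integral {0..l * pi} (\<lambda>x. cos_partial l N f x * g x) = (\<Sum>n<N. cos_coeff l n f * cos_coeff l n g)"
proof -
  have "integral {0..l * pi} (\<lambda>x. \<Sum>n<N. cos_coeff l n f * (cos_mode l n x * g x)) =
      (\<Sum>n<N. integral {0..l * pi} (\<lambda>x. cos_coeff l n f * (cos_mode l n x * g x)))"
    using assms by (intro integral_sum) (auto intro!: integrable_continuous_real continuous_intros)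
  also have "\<dots> = (\<Sum>n<N. cos_coeff l n f * cos_coeff l n g)"
    by (simp add: cos_coeff_def)
  finally show ?thesis by (simp add: cos_partial_def sum_distrib_right mult.assoc)
qed

lemma integral_cos_partial_error:
  fixes f :: "real \<Rightarrow> real"
  assumes l: "l > 0" and f: "continuous_on {0..l * pi} f"
  shows "integral {0..l * pi} (\<lambda>x. (f x - cos_partial l N f x)\<^sup>2) =
    integral {0..l * pi} (\<lambda>x. (f x)\<^sup>2) - (\<Sum>n<N. (cos_coeff l n f)\<^sup>2)"
proof -
  define P where "P = cos_partial l N f"
  have P: "continuous_on {0..l * pi} P" unfolding P_def by (intro continuous_intros)
  have coP: "cos_coeff l n P = cos_coeff l n f" if "n < N" for n
  proof -
    have "cos_coeff l n P = (\<Sum>k<N. cos_coeff l k f * (if n = k then 1 else 0))"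
      unfolding P_def cos_partial_def
      by (simp add: cos_coeff_sum cos_coeff_mult cos_coeff_cos_mode[OF l] continuous_intros)
    also have "\<dots> = (\<Sum>k<N. if n = k then cos_coeff l n f else 0)"
      by (intro sum.cong) auto
    finally show ?thesis using that by simp
  qed
  have int: "(\<lambda>x. (f x)\<^sup>2) integrable_on {0..l * pi}" "(\<lambda>x. 2 * (P x * f x)) integrable_on {0..l * pi}"
    "(\<lambda>x. P x * P x) integrable_on {0..l * pi}"
    by (auto intro!: integrable_continuous_real continuous_intros f P)
  have "integral {0..l * pi} (\<lambda>x. (f x - P x)\<^sup>2) =
      integral {0..l * pi} (\<lambda>x. ((f x)\<^sup>2 - 2 * (P x * f x)) + P x * P x)"
    by (intro integral_cong) (simp add: power2_eq_square algebra_simps)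
  also have "\<dots> = integral {0..l * pi} (\<lambda>x. (f x)\<^sup>2) - 2 * integral {0..l * pi} (\<lambda>x. P x * f x)
      + integral {0..l * pi} (\<lambda>x. P x * P x)"
    using int by (simp add: integral_add integral_diff integrable_diff)
  also have "integral {0..l * pi} (\<lambda>x. P x * f x) = (\<Sum>n<N. (cos_coeff l n f)\<^sup>2)"
    unfolding P_def integral_mult_cos_partial[OF f] by (simp add: power2_eq_square)
  also have "integral {0..l * pi} (\<lambda>x. P x * P x) = (\<Sum>n<N. (cos_coeff l n f)\<^sup>2)"
    using integral_mult_cos_partial[OF P, of N f] coP
    unfolding P_def[symmetric] by (simp add: power2_eq_square)
  finally show ?thesis unfolding P_def by simp
qed

lemma cos_bessel:
  fixes f :: "real \<Rightarrow> real"
  assumes "l > 0" "continuous_on {0..l * pi} f"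
  shows "(\<Sum>n<N. (cos_coeff l n f)\<^sup>2) \<le> integral {0..l * pi} (\<lambda>x. (f x)\<^sup>2)"
proof -
  have "0 \<le> integral {0..l * pi} (\<lambda>x. (f x - cos_partial l N f x)\<^sup>2)"
    by (intro integral_nonneg integrable_continuous_real continuous_intros assms) auto
  thus ?thesis using integral_cos_partial_error[OF assms, of N] by simp
qed

text \<open>A uniform approximation \<open>p\<close> of \<open>f\<close> by a cosine polynomial is reproduced by its own partial sums, so
  the remainder of \<open>f\<close> equals the remainder of \<open>f - p\<close>, which has small norm.\<close>

theorem cos_parseval:
  fixes f :: "real \<Rightarrow> real"
  assumes l: "l > 0" and f: "continuous_on {0..l * pi} f"
  shows "(\<lambda>n. (cos_coeff l n f)\<^sup>2) sums integral {0..l * pi} (\<lambda>x. (f x)\<^sup>2)"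
  unfolding sums_def
proof (rule LIMSEQ_I)
  fix r :: real assume r: "r > 0"
  define e where "e = sqrt (r / (2 * (l * pi)))"
  have lp: "l * pi > 0" using l by simp
  have e: "e > 0" using r lp by (simp add: e_def)
  obtain p where p: "trig_poly l p" "\<And>x. x \<in> {0..l * pi} \<Longrightarrow> \<bar>f x - p x\<bar> < e"
    using trig_dense[OF l f e] by blast
  obtain N where N: "\<And>M. M \<ge> N \<Longrightarrow> cos_partial l M p = p"
    using trig_poly_cos_partial[OF l p(1)] by blast
  define h where "h x = f x - p x" for x
  have h: "continuous_on {0..l * pi} h"
    unfolding h_def by (intro continuous_intros f trig_continuous[OF p(1)])
  have "integral {0..l * pi} (\<lambda>x. (h x)\<^sup>2) \<le> integral {0..l * pi} (\<lambda>x. e\<^sup>2)"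
  proof (intro integral_le integrable_continuous_real continuous_intros h)
    fix x assume "x \<in> {0..l * pi}"
    from p(2)[OF this] show "(h x)\<^sup>2 \<le> e\<^sup>2" unfolding h_def by (simp add: abs_le_square_iff[symmetric])
  qed
  also have "\<dots> = r / 2" using l r by (simp add: e_def)
  finally have hb: "integral {0..l * pi} (\<lambda>x. (h x)\<^sup>2) \<le> r / 2" .
  show "\<exists>no. \<forall>n\<ge>no. norm ((\<Sum>k<n. (cos_coeff l k f)\<^sup>2) - integral {0..l * pi} (\<lambda>x. (f x)\<^sup>2)) < r"
  proof (intro exI[of _ N] allI impI)
    fix M assume M: "M \<ge> N"
    have "cos_coeff l n h = cos_coeff l n f - cos_coeff l n p" for n
      unfolding h_def by (rule cos_coeff_diff[OF f trig_continuous[OF p(1)]])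
    hence "cos_partial l M h x = cos_partial l M f x - p x" for x
      using N[OF M, THEN fun_cong, of x]
      by (simp add: cos_partial_def left_diff_distrib sum_subtractf)
    hence "integral {0..l * pi} (\<lambda>x. (f x - cos_partial l M f x)\<^sup>2)
        = integral {0..l * pi} (\<lambda>x. (h x - cos_partial l M h x)\<^sup>2)"
      by (simp add: h_def)
    also have "\<dots> = integral {0..l * pi} (\<lambda>x. (h x)\<^sup>2) - (\<Sum>n<M. (cos_coeff l n h)\<^sup>2)"
      by (rule integral_cos_partial_error[OF l h])
    also have "\<dots> \<le> r / 2"
      using hb sum_nonneg[of "{..<M}" "\<lambda>n. (cos_coeff l n h)\<^sup>2"] by simp
    finally have "integral {0..l * pi} (\<lambda>x. (f x)\<^sup>2) - (\<Sum>n<M. (cos_coeff l n f)\<^sup>2) < r"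
      using integral_cos_partial_error[OF l f, of M] r by simp
    with cos_bessel[OF l f, of M]
    show "norm ((\<Sum>k<M. (cos_coeff l k f)\<^sup>2) - integral {0..l * pi} (\<lambda>x. (f x)\<^sup>2)) < r"
      by simp
  qed
qed

text \<open>By polarization, from the identity for \<open>f + g\<close> and \<open>f - g\<close>.\<close>

lemma cos_parseval_product:
  fixes f g :: "real \<Rightarrow> real"
  assumes l: "l > 0" and f: "continuous_on {0..l * pi} f" and g: "continuous_on {0..l * pi} g"
  shows "(\<lambda>n. cos_coeff l n f * cos_coeff l n g) sums integral {0..l * pi} (\<lambda>x. f x * g x)"
proof -
  have int: "(\<lambda>x. (f x + g x)\<^sup>2) integrable_on {0..l * pi}" "(\<lambda>x. (f x - g x)\<^sup>2) integrable_on {0..l * pi}"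
    by (auto intro!: integrable_continuous_real continuous_intros f g)
  have "(\<lambda>n. ((cos_coeff l n (\<lambda>x. f x + g x))\<^sup>2 - (cos_coeff l n (\<lambda>x. f x - g x))\<^sup>2) / 4) sums
     ((integral {0..l * pi} (\<lambda>x. (f x + g x)\<^sup>2) - integral {0..l * pi} (\<lambda>x. (f x - g x)\<^sup>2)) / 4)"
    by (intro sums_divide sums_diff cos_parseval l continuous_intros f g)
  also have "(integral {0..l * pi} (\<lambda>x. (f x + g x)\<^sup>2) - integral {0..l * pi} (\<lambda>x. (f x - g x)\<^sup>2)) / 4
      = integral {0..l * pi} (\<lambda>x. ((f x + g x)\<^sup>2 - (f x - g x)\<^sup>2) / 4)"
    using int by (simp add: integral_diff)
  also have "(\<lambda>x. ((f x + g x)\<^sup>2 - (f x - g x)\<^sup>2) / 4) = (\<lambda>x. f x * g x)"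
    by (simp add: power2_eq_square field_simps)
  also have "(\<lambda>n. ((cos_coeff l n (\<lambda>x. f x + g x))\<^sup>2 - (cos_coeff l n (\<lambda>x. f x - g x))\<^sup>2) / 4)
      = (\<lambda>n. cos_coeff l n f * cos_coeff l n g)"
    unfolding cos_coeff_add[OF f g] cos_coeff_diff[OF f g]
    by (simp add: power2_eq_square field_simps)
  finally show ?thesis .
qed

lemma cos_complete:
  fixes f :: "real \<Rightarrow> 'a::euclidean_space"
  assumes l: "l > 0" and f: "continuous_on {0..l * pi} f"
    and zero: "\<And>n. cos_coeff l n f = 0" and x: "x \<in> {0..l * pi}"
  shows "f x = 0"
proof (rule euclidean_eqI)
  fix b :: 'a assume "b \<in> Basis"
  define g where "g x = f x \<bullet> b" for x
  have g: "continuous_on {0..l * pi} g" unfolding g_def by (intro continuous_intros f)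
  have "cos_coeff l n g = 0" for n
    unfolding g_def by (simp add: cos_coeff_inner[OF f] zero)
  with cos_parseval[OF l g] have "integral {0..l * pi} (\<lambda>x. (g x)\<^sup>2) = 0"
    by (simp add: sums_iff)
  moreover have "continuous_on {0..l * pi} (\<lambda>x. (g x)\<^sup>2)" by (intro continuous_intros g)
  ultimately have "(g x)\<^sup>2 = 0"
    using integral_eq_0_iff[of 0 "l * pi" "\<lambda>x. (g x)\<^sup>2"] l x by auto
  thus "f x \<bullet> b = 0 \<bullet> b" by (simp add: g_def)
qed

section \<open>The constant steady state and the mode matrices\<close>

lemma u_star_pos: "b > 0 \<Longrightarrow> u_star a b > 0"
proof -
  assume b: "b > 0"
  have "\<bar>a + b - 1\<bar> < sqrt ((a + b - 1)^2 + 4 * b)"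
    using b by (intro real_less_rsqrt) simp
  thus ?thesis by (simp add: u_star_def)
qed

lemma u_star_root:
  assumes "b > 0"
  shows "(1 - u_star a b) * (u_star a b + b) = a * u_star a b"
proof -
  have "(sqrt ((a + b - 1)^2 + 4 * b))\<^sup>2 = (a + b - 1)^2 + 4 * b"
    using assms by simp
  thus ?thesis unfolding u_star_def by (simp add: power2_eq_square field_simps)
qed

lemma B0_neg:
  assumes "b > 0" "a > 0"
  shows "B0 a b < 0"
  using u_star_pos[OF assms(1), of a] assms unfolding B0_def by simp

lemma A0_plus_B0:
  assumes "b > 0"
  shows "A0 a b + B0 a b = - (u_star a b / (b + u_star a b)) * sqrt ((a + b - 1)^2 + 4 * b)"
proof -
  have s: "sqrt ((a + b - 1)^2 + 4 * b) = 2 * u_star a b - (1 - a - b)"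
    unfolding u_star_def by algebra
  show ?thesis unfolding s A0_def B0_def by (simp add: ring_distribs add_divide_distrib diff_divide_distrib mult_ac)
qed

text \<open>This makes the homogeneous mode's determinant \<open>- r (A0 + B0)\<close> positive, and it makes every mode
  determinant a strictly increasing function of \<open>r\<close>.\<close>

lemma A0_plus_B0_neg:
  assumes "b > 0"
  shows "A0 a b + B0 a b < 0"
proof -
  have "sqrt ((a + b - 1)^2 + 4 * b) > 0" using assms by (simp add: add_nonneg_pos)
  thus ?thesis
    unfolding A0_plus_B0[OF assms] using u_star_pos[OF assms, of a] assms by simp
qed

lemma deriv_react_u_u:
  assumes "b > 0"
  shows "deriv (\<lambda>u. react_u a b u (u_star a b)) (u_star a b) = A0 a b"
proof (rule DERIV_imp_deriv)
  define e where "e = u_star a b"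
  have e: "e > 0" "(1 - e) * (e + b) = a * e"
    using u_star_pos[OF assms] u_star_root[OF assms] by (simp_all add: e_def)
  have "((\<lambda>u. react_u a b u e) has_real_derivative (1 - 2 * e - a * e * b / (e + b)\<^sup>2)) (at e)"
    unfolding react_u_def using e(1) assms
    by (auto intro!: derivative_eq_intros simp: power2_eq_square algebra_simps)
  also have "a * e * b / (e + b)\<^sup>2 = (1 - e) * b / (e + b)"
    using e assms unfolding e(2)[symmetric] by (simp add: power2_eq_square)
  also have "1 - 2 * e - (1 - e) * b / (e + b) = A0 a b"
    using e(1) assms unfolding A0_def e_def[symmetric] by (simp add: field_simps)
  finally show "((\<lambda>u. react_u a b u (u_star a b)) has_real_derivative A0 a b) (at (u_star a b))"
    by (simp add: e_def)
qed

lemma deriv_react_u_v: "deriv (\<lambda>v. react_u a b (u_star a b) v) (u_star a b) = B0 a b"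
  by (rule DERIV_imp_deriv)
     (auto simp: react_u_def B0_def divide_inverse add.commute intro!: derivative_eq_intros)

lemma deriv_react_v_u:
  assumes "b > 0"
  shows "deriv (\<lambda>u. react_v r u (u_star a b)) (u_star a b) = r"
  using u_star_pos[OF assms, of a] unfolding react_v_def
  by (intro DERIV_imp_deriv) (auto intro!: derivative_eq_intros simp: field_simps)

lemma deriv_react_v_v:
  assumes "b > 0"
  shows "deriv (\<lambda>v. react_v r (u_star a b) v) (u_star a b) = - r"
  using u_star_pos[OF assms, of a] unfolding react_v_def
  by (intro DERIV_imp_deriv) (auto intro!: derivative_eq_intros simp: field_simps)

text \<open>The eigenvalues of the negative Neumann Laplacian.\<close>

definition wave :: "real \<Rightarrow> nat \<Rightarrow> real" where
  "wave l n = real n ^ 2 / l ^ 2"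

lemma wave_zero [simp]: "wave l 0 = 0"
  by (simp add: wave_def)

lemma wave_nonneg: "wave l n \<ge> 0"
  by (simp add: wave_def)

lemma wave_less_iff: "l > 0 \<Longrightarrow> wave l m < wave l n \<longleftrightarrow> m < n"
  by (simp add: wave_def divide_less_cancel linorder_not_le[symmetric] divide_le_cancel del: of_nat_less_iff)

lemma wave_eq_iff: "l > 0 \<Longrightarrow> wave l m = wave l n \<longleftrightarrow> m = n"
  by (simp add: wave_def)

text \<open>Trace and determinant of the matrix by which the linearization acts on the mode with Laplace
  eigenvalue \<open>x\<close>; this matrix has the rows \<open>(A0 - d1 x, B0)\<close> and \<open>(r, - r - d2 x)\<close>.\<close>

definition mode_trace :: "real \<Rightarrow> real \<Rightarrow> real \<Rightarrow> real \<Rightarrow> real \<Rightarrow> real \<Rightarrow> real" where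
  "mode_trace d1 d2 a b r x = A0 a b - (d1 + d2) * x - r"

definition mode_det :: "real \<Rightarrow> real \<Rightarrow> real \<Rightarrow> real \<Rightarrow> real \<Rightarrow> real \<Rightarrow> real" where
  "mode_det d1 d2 a b r x = d2 * x * (d1 * x - A0 a b) + r * (d1 * x - A0 a b - B0 a b)"

lemma r_H_iff: "r = r_H d1 d2 a b n l \<longleftrightarrow> mode_trace d1 d2 a b r (wave l n) = 0"
  unfolding r_H_def mode_trace_def wave_def by auto

lemma det_coeff_pos:
  assumes "b > 0" "d1 > 0" "x \<ge> 0"
  shows "d1 * x - A0 a b - B0 a b > 0"
proof -
  have "d1 * x \<ge> 0" using assms by simp
  thus ?thesis using A0_plus_B0_neg[OF assms(1), of a] by linarith
qed

lemma r_T_iff: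
  assumes "b > 0" "d1 > 0"
  shows "r = r_T d1 d2 a b n l \<longleftrightarrow> mode_det d1 d2 a b r (wave l n) = 0"
proof -
  have "d1 * wave l n - A0 a b - B0 a b \<noteq> 0"
    using det_coeff_pos[OF assms wave_nonneg[of l n], of a] by simp
  thus ?thesis unfolding r_T_def mode_det_def wave_def[symmetric]
    by (auto simp: field_simps)
qed

section \<open>The spectrum of the linearization\<close>

lemma neumann_domainD:
  assumes "w \<in> neumann_domain l" "x \<in> {0..l * pi}"
  shows "(w has_vector_derivative ddx l w x) (at x within {0..l * pi})"
    and "(ddx l w has_vector_derivative ddx l (ddx l w) x) (at x within {0..l * pi})"
  using assms vector_derivative_works
  unfolding neumann_domain_def ddx_def[abs_def] differentiable_on_def by blast+

lemma neumann_domain_continuous: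
  assumes "w \<in> neumann_domain l"
  shows "continuous_on {0..l * pi} w" "continuous_on {0..l * pi} (ddx l (ddx l w))"
  using assms unfolding neumann_domain_def by (auto intro: differentiable_imp_continuous_on)

lemma neumann_domainI:
  assumes l: "l > 0"
    and f: "\<And>x. x \<in> {0..l * pi} \<Longrightarrow> (f has_vector_derivative f' x) (at x within {0..l * pi})"
    and f': "\<And>x. x \<in> {0..l * pi} \<Longrightarrow> (f' has_vector_derivative f'' x) (at x within {0..l * pi})"
    and f'': "continuous_on {0..l * pi} f''"
    and bc: "f' 0 = 0" "f' (l * pi) = 0"
    and off: "\<And>x. x \<notin> {0..l * pi} \<Longrightarrow> f x = 0"
  shows "f \<in> neumann_domain l" and "\<And>x. x \<in> {0..l * pi} \<Longrightarrow> ddx l (ddx l f) x = f'' x"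
proof -
  have lp: "0 < l * pi" using l by simp
  have d1: "ddx l f x = f' x" if "x \<in> {0..l * pi}" for x
    unfolding ddx_def using vector_derivative_within_cbox[of 0 "l * pi" x f "f' x"] lp that f by simp
  have d: "(ddx l f has_vector_derivative f'' x) (at x within {0..l * pi})" if x: "x \<in> {0..l * pi}" for x
    by (rule has_vector_derivative_transform[OF x _ f'[OF x]]) (simp add: d1)
  show d2: "ddx l (ddx l f) x = f'' x" if x: "x \<in> {0..l * pi}" for x
    unfolding ddx_def[of l "ddx l f"]
    using vector_derivative_within_cbox[of 0 "l * pi" x "ddx l f" "f'' x"] lp that d by simp
  have "continuous_on {0..l * pi} (ddx l (ddx l f))"
    by (rule continuous_on_eq[OF f'']) (simp add: d2)
  thus "f \<in> neumann_domain l"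
    unfolding neumann_domain_def differentiable_on_def
    using differentiableI_vector[OF f] differentiableI_vector[OF d] off bc lp d1 by auto
qed

definition vector_mode :: "real \<Rightarrow> nat \<Rightarrow> complex \<times> complex \<Rightarrow> real \<Rightarrow> complex \<times> complex" where
  "vector_mode l n v x = (if x \<in> {0..l * pi} then cos_mode l n x *\<^sub>R v else 0)"

lemma vector_mode_neumann:
  assumes l: "l > 0"
  shows "vector_mode l n v \<in> neumann_domain l"
    and "\<And>x. x \<in> {0..l * pi} \<Longrightarrow> ddx l (ddx l (vector_mode l n v)) x = - wave l n *\<^sub>R vector_mode l n v x"
proof -
  define c where "c = sqrt (if n = 0 then l * pi else l * pi / 2)"
  have l0: "l \<noteq> 0" and c: "c \<noteq> 0" using l by (simp_all add: c_def)
  define s where "s x = - (real n / l * sin (real n * x / l) / c)" for x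
  have dc: "(cos_mode l n has_real_derivative s x) (at x within {0..l * pi})" for x
    unfolding s_def cos_mode_def c_def[symmetric]
    by (auto intro!: derivative_eq_intros simp: c l0)
  have ds: "(s has_real_derivative - wave l n * cos_mode l n x) (at x within {0..l * pi})" for x
    unfolding s_def cos_mode_def c_def[symmetric] wave_def
    by (auto intro!: derivative_eq_intros simp: power2_eq_square c l0 mult_ac)
  have f: "(vector_mode l n v has_vector_derivative s x *\<^sub>R v) (at x within {0..l * pi})"
    if x: "x \<in> {0..l * pi}" for x
  proof (rule has_vector_derivative_transform[OF x])
    show "((\<lambda>x. cos_mode l n x *\<^sub>R v) has_vector_derivative s x *\<^sub>R v) (at x within {0..l * pi})"
      using has_vector_derivative_scaleR[OF dc[of x] has_vector_derivative_const[of v]] by simp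
  qed (simp add: vector_mode_def)
  have f': "((\<lambda>x. s x *\<^sub>R v) has_vector_derivative (- wave l n * cos_mode l n x) *\<^sub>R v) (at x within {0..l * pi})" for x
    using has_vector_derivative_scaleR[OF ds[of x] has_vector_derivative_const[of v]] by simp
  have f'': "continuous_on {0..l * pi} (\<lambda>x. (- wave l n * cos_mode l n x) *\<^sub>R v)"
    by (intro continuous_intros)
  have bc: "s 0 *\<^sub>R v = 0" "s (l * pi) *\<^sub>R v = 0"
    using l by (auto simp: s_def mult.commute[of l pi])
  have off: "vector_mode l n v x = 0" if "x \<notin> {0..l * pi}" for x
    using that by (simp only: vector_mode_def if_False)
  note nd = neumann_domainI[OF l f f' f'' bc off]
  show "vector_mode l n v \<in> neumann_domain l" by (rule nd(1)) assumption+
  fix x assume x: "x \<in> {0..l * pi}"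
  have "ddx l (ddx l (vector_mode l n v)) x = (- wave l n * cos_mode l n x) *\<^sub>R v"
    using x by (rule nd(2)[rotated 2])
  thus "ddx l (ddx l (vector_mode l n v)) x = - wave l n *\<^sub>R vector_mode l n v x"
    using x by (simp only: vector_mode_def if_True scaleR_scaleR)
qed

lemma cos_coeff_vector_mode:
  assumes "l > 0"
  shows "cos_coeff l n (vector_mode l m v) = (if n = m then v else 0)"
  unfolding cos_coeff_cos_mode_vec[OF assms, of n m v, symmetric]
  by (rule cos_coeff_cong) (simp add: vector_mode_def)

lemma continuous_on_vector_mode: "continuous_on {0..l * pi} (vector_mode l n v)"
proof -
  have "continuous_on {0..l * pi} (\<lambda>x. cos_mode l n x *\<^sub>R v)" by (intro continuous_intros)
  thus ?thesis by (rule continuous_on_cong[THEN iffD1, rotated 2]) (auto simp: vector_mode_def)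
qed

lemma sum_fun_apply: "finite K \<Longrightarrow> (\<Sum>k\<in>K. F k) x = (\<Sum>k\<in>K. F k (x :: 'b) :: 'a::comm_monoid_add)"
  by (induction rule: finite_induct) auto

text \<open>The action of (linearization minus \<open>\<mu>\<close>) on the cosine coefficients of one mode.\<close>

definition shifted_mode :: "real \<Rightarrow> real \<Rightarrow> real \<Rightarrow> real \<Rightarrow> real \<Rightarrow> real \<Rightarrow> complex
    \<Rightarrow> complex \<times> complex \<Rightarrow> complex \<times> complex" where
  "shifted_mode d1 d2 a b r x \<mu> p =
     ((of_real (A0 a b - d1 * x) - \<mu>) * fst p + of_real (B0 a b) * snd p,
      of_real r * fst p + (of_real (- r - d2 * x) - \<mu>) * snd p)"

definition char_poly :: "real \<Rightarrow> real \<Rightarrow> real \<Rightarrow> real \<Rightarrow> real \<Rightarrow> real \<Rightarrow> complex \<Rightarrow> complex" where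
  "char_poly d1 d2 a b r x \<mu> =
     \<mu>\<^sup>2 - of_real (mode_trace d1 d2 a b r x) * \<mu> + of_real (mode_det d1 d2 a b r x)"

lemma char_poly_eq:
  "char_poly d1 d2 a b r x \<mu> = (of_real (A0 a b - d1 * x) - \<mu>) * (of_real (- r - d2 * x) - \<mu>)
     - of_real (B0 a b) * of_real r"
  by (simp add: char_poly_def mode_trace_def mode_det_def power2_eq_square algebra_simps)

text \<open>The Cayley--Hamilton identity for the shifted mode matrix.\<close>

lemma shifted_mode_square:
  "shifted_mode d1 d2 a b r x \<mu> (shifted_mode d1 d2 a b r x \<mu> p) =
     (let t = of_real (mode_trace d1 d2 a b r x) - 2 * \<mu>; q = shifted_mode d1 d2 a b r x \<mu> p;
          D = char_poly d1 d2 a b r x \<mu>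
      in (t * fst q - D * fst p, t * snd q - D * snd p))"
  unfolding char_poly_eq
  by (simp add: shifted_mode_def Let_def mode_trace_def algebra_simps)

lemma shifted_mode_zero [simp]: "shifted_mode d1 d2 a b r x \<mu> 0 = 0"
  by (simp add: shifted_mode_def zero_prod_def)

lemma shifted_mode_inj:
  assumes "char_poly d1 d2 a b r x \<mu> \<noteq> 0" "shifted_mode d1 d2 a b r x \<mu> p = 0"
  shows "p = 0"
  using shifted_mode_square[of d1 d2 a b r x \<mu> p] assms
  by (auto simp: Let_def prod_eq_iff)

lemma shifted_mode_scale:
  "shifted_mode d1 d2 a b r x \<mu> (c * p, c * q) =
    (c * fst (shifted_mode d1 d2 a b r x \<mu> (p, q)), c * snd (shifted_mode d1 d2 a b r x \<mu> (p, q)))"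
  by (simp add: shifted_mode_def algebra_simps)

text \<open>If \<open>\<mu>\<close> is an eigenvalue of the mode matrix but not half its trace, it is a simple eigenvalue, and
  by Cayley--Hamilton the shifted matrix acts on its own range as multiplication by a nonzero
  number; hence its powers have the same kernel.\<close>

lemma shifted_mode_semisimple:
  assumes nd: "char_poly d1 d2 a b r x \<mu> = 0 \<Longrightarrow> of_real (mode_trace d1 d2 a b r x) \<noteq> 2 * \<mu>"
    and "(shifted_mode d1 d2 a b r x \<mu> ^^ m) p = 0"
  shows "shifted_mode d1 d2 a b r x \<mu> p = 0"
proof (cases "char_poly d1 d2 a b r x \<mu> = 0")
  case False
  have "p = 0" using assms(2)
    by (induction m) (auto dest: shifted_mode_inj[OF False])
  thus ?thesis by simp
next
  case True
  define t where "t = of_real (mode_trace d1 d2 a b r x) - 2 * \<mu>"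
  have t: "t \<noteq> 0" using nd[OF True] by (simp add: t_def)
  define q where "q = shifted_mode d1 d2 a b r x \<mu> p"
  have sq: "shifted_mode d1 d2 a b r x \<mu> q = (t * fst q, t * snd q)"
    unfolding q_def shifted_mode_square Let_def True t_def[symmetric] by simp
  have pow: "(shifted_mode d1 d2 a b r x \<mu> ^^ k) q = (t ^ k * fst q, t ^ k * snd q)" for k
  proof (induction k)
    case (Suc k)
    have "(shifted_mode d1 d2 a b r x \<mu> ^^ Suc k) q = shifted_mode d1 d2 a b r x \<mu> (t ^ k * fst q, t ^ k * snd q)"
      using Suc by simp
    thus ?case using shifted_mode_scale[of d1 d2 a b r x \<mu> "t ^ k" "fst q" "snd q"] sq
      by (simp add: mult_ac)
  qed simp
  have "(shifted_mode d1 d2 a b r x \<mu> ^^ m) q =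
      shifted_mode d1 d2 a b r x \<mu> ((shifted_mode d1 d2 a b r x \<mu> ^^ m) p)"
    unfolding q_def by (rule funpow_swap1[symmetric])
  also have "\<dots> = 0" by (simp add: assms(2))
  finally show ?thesis using pow[of m] t
    by (simp add: q_def[symmetric] zero_prod_def prod_eq_iff)
qed

lemma linearization_eq:
  assumes "b > 0" "x \<in> {0..l * pi}"
  shows "linearization d1 d2 a b r l w x =
    (of_real d1 * fst (ddx l (ddx l w) x) + of_real (A0 a b) * fst (w x) + of_real (B0 a b) * snd (w x),
     of_real d2 * snd (ddx l (ddx l w) x) + of_real r * fst (w x) + of_real (- r) * snd (w x))"
  using assms
  by (simp add: linearization_def Let_def deriv_react_u_u deriv_react_u_v deriv_react_v_u deriv_react_v_v)

lemma linearization_off: "x \<notin> {0..l * pi} \<Longrightarrow> linearization d1 d2 a b r l w x = 0"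
  by (auto simp: linearization_def)

text \<open>Taking cosine coefficients turns the differential operator into a sequence of matrices; this
  and the completeness of the cosines reduce the spectral theory to two-by-two algebra.\<close>

lemma cos_coeff_linearization:
  assumes l: "l > 0" and b: "b > 0" and w: "w \<in> neumann_domain l"
  shows "continuous_on {0..l * pi} (linearization d1 d2 a b r l w - cscale \<mu> w)"
    and "cos_coeff l n (linearization d1 d2 a b r l w - cscale \<mu> w) =
      shifted_mode d1 d2 a b r (wave l n) \<mu> (cos_coeff l n w)"
proof -
  define h1 :: "complex \<times> complex \<Rightarrow> complex \<times> complex" where
    "h1 p = (of_real d1 * fst p, of_real d2 * snd p)" for p
  define h2 where "h2 = shifted_mode d1 d2 a b r 0 \<mu>"
  have h1: "bounded_linear h1"
    unfolding linear_conv_bounded_linear[symmetric]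
    by (rule linearI) (auto simp: h1_def prod_eq_iff algebra_simps)
  have h2: "bounded_linear h2"
    unfolding linear_conv_bounded_linear[symmetric]
    by (rule linearI) (auto simp: h2_def shifted_mode_def prod_eq_iff algebra_simps scaleR_conv_of_real)
  have eq: "(linearization d1 d2 a b r l w - cscale \<mu> w) x = h1 (ddx l (ddx l w) x) + h2 (w x)"
    if "x \<in> {0..l * pi}" for x
    using that
    by (simp add: linearization_eq[OF b] cscale_def h1_def h2_def shifted_mode_def algebra_simps)
  note cont = neumann_domain_continuous[OF w]
  have c1: "continuous_on {0..l * pi} (\<lambda>x. h1 (ddx l (ddx l w) x))"
    and c2: "continuous_on {0..l * pi} (\<lambda>x. h2 (w x))"
    using bounded_linear.continuous_on[OF h1 cont(2)] bounded_linear.continuous_on[OF h2 cont(1)] by auto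
  show "continuous_on {0..l * pi} (linearization d1 d2 a b r l w - cscale \<mu> w)"
    by (rule continuous_on_eq[OF continuous_on_add[OF c1 c2]]) (simp only: eq)
  have "cos_coeff l n (linearization d1 d2 a b r l w - cscale \<mu> w)
      = cos_coeff l n (\<lambda>x. h1 (ddx l (ddx l w) x) + h2 (w x))"
    by (rule cos_coeff_cong) (rule eq)
  also have "\<dots> = h1 (cos_coeff l n (ddx l (ddx l w))) + h2 (cos_coeff l n w)"
    by (simp add: cos_coeff_add[OF c1 c2] cos_coeff_bounded_linear[OF cont(2) h1]
        cos_coeff_bounded_linear[OF cont(1) h2])
  also have "cos_coeff l n (ddx l (ddx l w)) = - wave l n *\<^sub>R cos_coeff l n w"
    unfolding wave_def using w
    by (intro cos_coeff_second_derivative[OF l neumann_domainD(1)[OF w] neumann_domainD(2)[OF w] cont(2)])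
      (auto simp: neumann_domain_def)
  also have "h1 (- wave l n *\<^sub>R cos_coeff l n w) + h2 (cos_coeff l n w) =
      shifted_mode d1 d2 a b r (wave l n) \<mu> (cos_coeff l n w)"
    by (simp add: h1_def h2_def shifted_mode_def prod_eq_iff algebra_simps scaleR_conv_of_real)
  finally show "cos_coeff l n (linearization d1 d2 a b r l w - cscale \<mu> w) =
      shifted_mode d1 d2 a b r (wave l n) \<mu> (cos_coeff l n w)" .
qed

lemma eigenspace_coeff:
  assumes "l > 0" "b > 0" "w \<in> eigenspace d1 d2 a b r l \<mu>"
  shows "shifted_mode d1 d2 a b r (wave l n) \<mu> (cos_coeff l n w) = 0"
proof -
  have w: "w \<in> neumann_domain l" and "linearization d1 d2 a b r l w - cscale \<mu> w = (\<lambda>x. 0)"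
    using assms(3) by (auto simp: eigenspace_def)
  thus ?thesis using cos_coeff_linearization(2)[OF assms(1,2) w, of n d1 d2 a r \<mu>] by simp
qed

lemma eigenspaceI:
  assumes l: "l > 0" and b: "b > 0" and w: "w \<in> neumann_domain l"
    and z: "\<And>n. shifted_mode d1 d2 a b r (wave l n) \<mu> (cos_coeff l n w) = 0"
  shows "w \<in> eigenspace d1 d2 a b r l \<mu>"
proof -
  have "(linearization d1 d2 a b r l w - cscale \<mu> w) x = 0" for x
  proof (cases "x \<in> {0..l * pi}")
    case True
    show ?thesis
      by (rule cos_complete[OF l cos_coeff_linearization(1)[OF l b w] _ True])
        (simp only: cos_coeff_linearization(2)[OF l b w] z)
  next
    case False
    hence "w x = 0" using w by (auto simp: neumann_domain_def)
    with False show ?thesis by (simp add: linearization_off cscale_def zero_prod_def)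
  qed
  hence "linearization d1 d2 a b r l w = cscale \<mu> w" by (simp add: fun_eq_iff)
  with w show ?thesis by (simp add: eigenspace_def)
qed

lemma power_kernel_coeff:
  assumes "l > 0" "b > 0" "w \<in> power_kernel d1 d2 a b r l \<mu> m"
  shows "(shifted_mode d1 d2 a b r (wave l n) \<mu> ^^ m) (cos_coeff l n w) = 0"
  using assms(3)
proof (induction m arbitrary: w)
  case 0
  hence "w = (\<lambda>x. 0)" by (simp add: zero_fun_def)
  thus ?case by simp
next
  case (Suc m)
  hence w: "w \<in> neumann_domain l"
    and k: "linearization d1 d2 a b r l w - cscale \<mu> w \<in> power_kernel d1 d2 a b r l \<mu> m" by auto
  from Suc.IH[OF k] show ?case
    unfolding cos_coeff_linearization(2)[OF assms(1,2) w] by (simp only: funpow_Suc_right o_def)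
qed

text \<open>No generalized eigenfunctions exist when every mode matrix is semisimple at \<open>\<mu>\<close>: the coefficients
  of a generalized eigenfunction lie in the kernels of the mode matrices, and by completeness it
  is an eigenfunction.\<close>

lemma generalized_eigenspace:
  assumes l: "l > 0" and b: "b > 0"
    and nd: "\<And>n. char_poly d1 d2 a b r (wave l n) \<mu> = 0 \<Longrightarrow>
      of_real (mode_trace d1 d2 a b r (wave l n)) \<noteq> 2 * \<mu>"
  shows "(\<Union>m. power_kernel d1 d2 a b r l \<mu> m) = eigenspace d1 d2 a b r l \<mu>"
proof (intro equalityI subsetI)
  fix w assume "w \<in> eigenspace d1 d2 a b r l \<mu>"
  hence "w \<in> power_kernel d1 d2 a b r l \<mu> (Suc 0)" by (simp add: eigenspace_def)
  thus "w \<in> (\<Union>m. power_kernel d1 d2 a b r l \<mu> m)" by blast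
next
  fix w assume "w \<in> (\<Union>m. power_kernel d1 d2 a b r l \<mu> m)"
  then obtain m where m: "w \<in> power_kernel d1 d2 a b r l \<mu> m" by blast
  have "w \<in> neumann_domain l"
  proof (cases m)
    case 0
    have "vector_mode l 0 0 = w" using m 0 by (auto simp: vector_mode_def fun_eq_iff)
    with vector_mode_neumann(1)[OF l, of 0 0] show ?thesis by simp
  qed (use m in auto)
  thus "w \<in> eigenspace d1 d2 a b r l \<mu>"
    by (rule eigenspaceI[OF l b])
      (rule shifted_mode_semisimple[OF nd power_kernel_coeff[OF l b m]])
qed

text \<open>Since \<open>B0\<close> is nonzero, the first row of the mode matrix determines the eigenvector, which therefore
  depends on \<open>\<mu>\<close> without any case distinction.\<close>

definition eigvec :: "real \<Rightarrow> real \<Rightarrow> real \<Rightarrow> real \<Rightarrow> complex \<Rightarrow> complex \<times> complex" where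
  "eigvec d1 a b x \<mu> = (of_real (B0 a b), \<mu> - of_real (A0 a b - d1 * x))"

lemma shifted_mode_eigvec:
  assumes "char_poly d1 d2 a b r x \<mu> = 0"
  shows "shifted_mode d1 d2 a b r x \<mu> (eigvec d1 a b x \<mu>) = 0"
  using assms unfolding char_poly_eq
  by (simp add: shifted_mode_def eigvec_def prod_eq_iff algebra_simps)

lemma vector_mode_eigenspace:
  assumes "l > 0" "b > 0" "char_poly d1 d2 a b r (wave l n) \<mu> = 0"
  shows "vector_mode l n (eigvec d1 a b (wave l n) \<mu>) \<in> eigenspace d1 d2 a b r l \<mu>"
  using assms
  by (intro eigenspaceI vector_mode_neumann) (simp_all add: cos_coeff_vector_mode shifted_mode_eigvec)

lemma eigvec_nonzero:
  assumes "b > 0" "a > 0"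
  shows "eigvec d1 a b x \<mu> \<noteq> 0"
  using B0_neg[OF assms] by (auto simp: eigvec_def prod_eq_iff)

lemma vector_mode_nonzero:
  assumes "l > 0" "v \<noteq> 0"
  shows "vector_mode l n v \<noteq> 0"
proof
  assume "vector_mode l n v = 0"
  hence "vector_mode l n v = (\<lambda>x. 0)" by (simp add: zero_fun_def)
  with cos_coeff_vector_mode[OF assms(1), of n n v] assms(2) show False by simp
qed

text \<open>The vectors are arbitrary and may belong to different eigenvalues, as needed along the two
  Turing branches; distinct cosines have disjoint coefficients.\<close>

lemma vector_mode_independent:
  assumes l: "l > 0" and K: "finite K" and v: "\<And>n. n \<in> K \<Longrightarrow> v n \<noteq> 0"
  shows "inj_on (\<lambda>n. vector_mode l n (v n)) K" "cfun.independent ((\<lambda>n. vector_mode l n (v n)) ` K)"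
proof -
  show inj: "inj_on (\<lambda>n. vector_mode l n (v n)) K"
  proof (rule inj_onI)
    fix n m assume nm: "n \<in> K" "m \<in> K" "vector_mode l n (v n) = vector_mode l m (v m)"
    hence "v n = (if n = m then v m else 0)"
      using cos_coeff_vector_mode[OF l, of n n "v n"] cos_coeff_vector_mode[OF l, of n m "v m"] by simp
    thus "n = m" using v[OF nm(1)] by argo
  qed
  show "cfun.independent ((\<lambda>n. vector_mode l n (v n)) ` K)"
  proof (rule cfun.independent_if_scalars_zero)
    fix f x assume sum: "(\<Sum>x\<in>(\<lambda>n. vector_mode l n (v n)) ` K. cscale (f x) x) = 0"
      and x: "x \<in> (\<lambda>n. vector_mode l n (v n)) ` K"
    then obtain k where k: "k \<in> K" "x = vector_mode l k (v k)" by auto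
    define g where "g n = f (vector_mode l n (v n))" for n
    have "(\<Sum>n\<in>K. cscale (g n) (vector_mode l n (v n))) = 0"
      using sum by (simp add: sum.reindex[OF inj] g_def)
    hence "(\<Sum>n\<in>K. cscale (g n) (vector_mode l n (v n)) x) = 0" for x
      using sum_fun_apply[OF K, of "\<lambda>n. cscale (g n) (vector_mode l n (v n))" x] by simp
    moreover have cs: "cscale (g n) (vector_mode l n (v n)) = vector_mode l n (g n * fst (v n), g n * snd (v n))" for n
      by (auto simp: cscale_def vector_mode_def fun_eq_iff prod_eq_iff)
    ultimately have "(\<lambda>x. \<Sum>n\<in>K. vector_mode l n (g n * fst (v n), g n * snd (v n)) x) = (\<lambda>x. 0)"
      by simp
    hence "cos_coeff l k (\<lambda>x. \<Sum>n\<in>K. vector_mode l n (g n * fst (v n), g n * snd (v n)) x) = 0" by simp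
    hence "(\<Sum>n\<in>K. if k = n then (g n * fst (v n), g n * snd (v n)) else 0) = 0"
      by (simp add: cos_coeff_sum[OF K continuous_on_vector_mode] cos_coeff_vector_mode[OF l] cong: if_cong)
    hence "(g k * fst (v k), g k * snd (v k)) = 0" using K k by (simp add: sum.delta)
    hence "g k = 0" using v[OF k(1)] by (auto simp: prod_eq_iff)
    thus "f x = 0" by (simp add: g_def k(2))
  qed (use K in simp)
qed

lemma eigenspace_subspace: 
  assumes "l > 0" "b > 0" 
  shows "cfun.subspace (eigenspace d1 d2 a b r l \<mu>)"
proof (rule cfun.subspaceI)
  have lin: "v + w \<in> neumann_domain l" "cscale c v \<in> neumann_domain l"
    "0 \<in> neumann_domain l"
    if v: "v \<in> neumann_domain l" and w: "w \<in> neumann_domain l" for v w c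
  proof -
    show "v + w \<in> neumann_domain l"
    proof (rule neumann_domainI(1)[OF assms(1), of _ "\<lambda>x. ddx l v x + ddx l w x"
          "\<lambda>x. ddx l (ddx l v) x + ddx l (ddx l w) x"])
      show "(v + w has_vector_derivative ddx l v x + ddx l w x) (at x within {0..l * pi})"
        if "x \<in> {0..l * pi}" for x
        using has_vector_derivative_add[OF neumann_domainD(1)[OF v that] neumann_domainD(1)[OF w that]]
        by (simp add: plus_fun_def)
    qed (use v w in \<open>auto simp: neumann_domain_def intro!: has_vector_derivative_add continuous_intros
        neumann_domainD[OF v] neumann_domainD[OF w] simp del: atLeastAtMost_iff\<close>)
    have bl: "bounded_linear (\<lambda>p::complex \<times> complex. (c * fst p, c * snd p))"
      unfolding linear_conv_bounded_linear[symmetric]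
      by (rule linearI) (auto simp: prod_eq_iff algebra_simps)
    show "cscale c v \<in> neumann_domain l"
    proof (rule neumann_domainI(1)[OF assms(1), of _ "cscale c (ddx l v)" "cscale c (ddx l (ddx l v))"])
      show "(cscale c v has_vector_derivative cscale c (ddx l v) x) (at x within {0..l * pi})"
        "(cscale c (ddx l v) has_vector_derivative cscale c (ddx l (ddx l v)) x) (at x within {0..l * pi})"
        if "x \<in> {0..l * pi}" for x
        using bounded_linear.has_vector_derivative[OF bl neumann_domainD(1)[OF v that]]
          bounded_linear.has_vector_derivative[OF bl neumann_domainD(2)[OF v that]]
        unfolding cscale_def .
      show "continuous_on {0..l * pi} (cscale c (ddx l (ddx l v)))"
        using bounded_linear.continuous_on[OF bl neumann_domain_continuous(2)[OF v]]
        unfolding cscale_def .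
    qed (use v in \<open>auto simp: neumann_domain_def cscale_def zero_prod_def\<close>)
    have "vector_mode l 0 0 = 0" by (auto simp: vector_mode_def fun_eq_iff)
    with vector_mode_neumann(1)[OF assms(1), of 0 0] show "0 \<in> neumann_domain l" by simp
  qed
  have dom: "w \<in> neumann_domain l" if "w \<in> eigenspace d1 d2 a b r l \<mu>" for w
    using that by (simp add: eigenspace_def)
  show "0 \<in> eigenspace d1 d2 a b r l \<mu>"
  proof (rule eigenspaceI[OF assms])
    show "0 \<in> neumann_domain l" using lin(3)[OF vector_mode_neumann(1) vector_mode_neumann(1)] assms by blast
  qed (simp add: zero_fun_def)
  fix v w assume v: "v \<in> eigenspace d1 d2 a b r l \<mu>"
  { assume w: "w \<in> eigenspace d1 d2 a b r l \<mu>"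
    have "cos_coeff l n (v + w) = cos_coeff l n v + cos_coeff l n w" for n
      using cos_coeff_add[OF neumann_domain_continuous(1)[OF dom[OF v]]
          neumann_domain_continuous(1)[OF dom[OF w]], of n] by (simp add: plus_fun_def)
    moreover have "shifted_mode d1 d2 a b r x \<mu> (p + q) =
        shifted_mode d1 d2 a b r x \<mu> p + shifted_mode d1 d2 a b r x \<mu> q" for x p q
      by (simp add: shifted_mode_def algebra_simps)
    ultimately show "v + w \<in> eigenspace d1 d2 a b r l \<mu>"
      using lin(1)[OF dom[OF v] dom[OF w]] eigenspace_coeff[OF assms v] eigenspace_coeff[OF assms w]
      by (intro eigenspaceI[OF assms]) simp_all }
  fix c
  have bl: "bounded_linear (\<lambda>p::complex \<times> complex. (c * fst p, c * snd p))"
    unfolding linear_conv_bounded_linear[symmetric]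
    by (rule linearI) (auto simp: prod_eq_iff algebra_simps)
  have "cos_coeff l n (cscale c v) = (c * fst (cos_coeff l n v), c * snd (cos_coeff l n v))" for n
    unfolding cscale_def
    by (rule cos_coeff_bounded_linear[OF neumann_domain_continuous(1)[OF dom[OF v]] bl])
  thus "cscale c v \<in> eigenspace d1 d2 a b r l \<mu>"
    using lin(2)[OF dom[OF v] dom[OF v]] eigenspace_coeff[OF assms v]
    by (intro eigenspaceI[OF assms]) (simp_all add: shifted_mode_scale zero_prod_def)
qed

lemma eigenspace_span:
  assumes l: "l > 0" and b: "b > 0" and a: "a > 0"
    and K: "finite K" "\<And>n. n \<in> K \<longleftrightarrow> char_poly d1 d2 a b r (wave l n) \<mu> = 0"
  shows "eigenspace d1 d2 a b r l \<mu> = cfun.span ((\<lambda>n. vector_mode l n (eigvec d1 a b (wave l n) \<mu>)) ` K)"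
    (is "_ = cfun.span (?m ` K)")
proof (intro equalityI subsetI)
  fix w assume w: "w \<in> eigenspace d1 d2 a b r l \<mu>"
  define t where "t n = fst (cos_coeff l n w) / of_real (B0 a b)" for n
  have B0: "complex_of_real (B0 a b) \<noteq> 0" using B0_neg[OF b a] by simp
  have cw: "cos_coeff l n w = (if n \<in> K then
      (t n * fst (eigvec d1 a b (wave l n) \<mu>), t n * snd (eigvec d1 a b (wave l n) \<mu>)) else 0)" for n
  proof (cases "n \<in> K")
    case True
    have "(of_real (A0 a b - d1 * wave l n) - \<mu>) * fst (cos_coeff l n w)
        + of_real (B0 a b) * snd (cos_coeff l n w) = 0"
      using eigenspace_coeff[OF l b w, of n] by (simp add: shifted_mode_def prod_eq_iff)
    hence "snd (cos_coeff l n w) = t n * (\<mu> - of_real (A0 a b - d1 * wave l n))"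
      using B0 unfolding t_def by (simp add: field_simps)
    with True B0 show ?thesis by (simp add: eigvec_def prod_eq_iff t_def)
  next
    case False
    thus ?thesis using eigenspace_coeff[OF l b w, of n] K(2) shifted_mode_inj by auto
  qed
  define S where "S x = (\<Sum>n\<in>K. cscale (t n) (?m n) x)" for x
  have cs: "cscale (t n) (?m n) = vector_mode l n (t n * fst (eigvec d1 a b (wave l n) \<mu>), t n * snd (eigvec d1 a b (wave l n) \<mu>))" for n
    by (auto simp: cscale_def vector_mode_def fun_eq_iff prod_eq_iff)
  have cS: "continuous_on {0..l * pi} S"
    unfolding S_def cs by (intro continuous_intros continuous_on_vector_mode)
  have cw': "continuous_on {0..l * pi} w" and off: "\<And>x. x \<notin> {0..l * pi} \<Longrightarrow> w x = 0"
    using w neumann_domain_continuous(1)[of w l] unfolding eigenspace_def neumann_domain_def by blast+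
  have "cos_coeff l n S = cos_coeff l n w" for n
    unfolding S_def cs cw
    by (simp add: cos_coeff_sum[OF K(1) continuous_on_vector_mode] cos_coeff_vector_mode[OF l] sum.delta K(1) cong: if_cong)
  hence "cos_coeff l n (\<lambda>x. w x - S x) = 0" for n
    by (simp add: cos_coeff_diff[OF cw' cS])
  hence "w x = S x" if "x \<in> {0..l * pi}" for x
    using cos_complete[OF l continuous_on_diff[OF cw' cS] _ that] by simp
  moreover have "w x = S x" if "x \<notin> {0..l * pi}" for x
    using that off by (auto simp: S_def cs vector_mode_def)
  ultimately have "w = (\<Sum>n\<in>K. cscale (t n) (?m n))"
    unfolding fun_eq_iff sum_fun_apply[OF K(1)] S_def by blast
  thus "w \<in> cfun.span (?m ` K)"
    by (simp add: cfun.span_sum cfun.span_scale cfun.span_base)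
next
  fix w assume "w \<in> cfun.span (?m ` K)"
  moreover have "?m ` K \<subseteq> eigenspace d1 d2 a b r l \<mu>"
    using K(2) vector_mode_eigenspace[OF l b] by auto
  ultimately show "w \<in> eigenspace d1 d2 a b r l \<mu>"
    using cfun.span_minimal[OF _ eigenspace_subspace[OF l b]] by blast
qed

lemma eigenspace_dim:
  assumes "l > 0" "b > 0" "a > 0"
    and "finite K" "\<And>n. n \<in> K \<longleftrightarrow> char_poly d1 d2 a b r (wave l n) \<mu> = 0"
  shows "cfun.dim (eigenspace d1 d2 a b r l \<mu>) = card K"
  unfolding eigenspace_span[OF assms]
  using vector_mode_independent[OF assms(1,4), of "\<lambda>n. eigvec d1 a b (wave l n) \<mu>"] eigvec_nonzero[OF assms(2,3)]
  by (simp add: cfun.dim_span_eq_card_independent card_image del: cfun.dim_span)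

subsection \<open>Smooth branches of critical eigenvalues\<close>

lemma has_real_derivative_imp_complex:
  assumes "(f has_real_derivative f') (at r)"
  shows "((\<lambda>s. complex_of_real (f s)) has_vector_derivative of_real f') (at r)"
  using assms by (rule has_vector_derivative_of_real)

lemma DERIV_mode_trace: "((\<lambda>s. mode_trace d1 d2 a b s x) has_real_derivative -1) (at r)"
  unfolding mode_trace_def by (auto intro!: derivative_eq_intros)

lemma DERIV_mode_det:
  "((\<lambda>s. mode_det d1 d2 a b s x) has_real_derivative (d1 * x - A0 a b - B0 a b)) (at r)"
  unfolding mode_det_def by (auto intro!: derivative_eq_intros)

text \<open>The real part of the pair is half the trace, which decreases in \<open>r\<close> with speed one.\<close>

lemma Hopf_branch:
  assumes T: "mode_trace d1 d2 a b r x = 0" and D: "mode_det d1 d2 a b r x > 0"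
  obtains \<kappa> :: "real \<Rightarrow> complex" and \<kappa>' where "\<kappa> r = \<i> * of_real (sqrt (mode_det d1 d2 a b r x))"
    "(\<kappa> has_vector_derivative \<kappa>') (at r)" "Re \<kappa>' \<noteq> 0"
    "\<forall>\<^sub>F s in nhds r. char_poly d1 d2 a b s x (\<kappa> s) = 0"
proof -
  define T where "T s = mode_trace d1 d2 a b s x" for s
  define D where "D s = mode_det d1 d2 a b s x" for s
  have dT: "(T has_real_derivative -1) (at r)" unfolding T_def by (rule DERIV_mode_trace)
  have dD: "(D has_real_derivative (d1 * x - A0 a b - B0 a b)) (at r)"
    unfolding D_def by (rule DERIV_mode_det)
  define \<kappa> where "\<kappa> s = of_real (T s / 2) + \<i> * of_real (sqrt (D s - (T s)\<^sup>2 / 4))" for s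
  have pos: "D r - (T r)\<^sup>2 / 4 > 0" using assms by (simp add: T_def D_def)
  have dg: "((\<lambda>s. D s - (T s)\<^sup>2 / 4) has_real_derivative (d1 * x - A0 a b - B0 a b) + T r / 2) (at r)"
    by (auto intro!: derivative_eq_intros dT dD)
  define g' where "g' = ((d1 * x - A0 a b - B0 a b) + T r / 2) * (inverse (sqrt (D r - (T r)\<^sup>2 / 4)) / 2)"
  have dsq: "((\<lambda>s. sqrt (D s - (T s)\<^sup>2 / 4)) has_real_derivative g') (at r)"
    unfolding g'_def by (rule DERIV_cong[OF DERIV_chain2[OF DERIV_real_sqrt[OF pos] dg]]) simp
  have dT2: "((\<lambda>s. T s / 2) has_real_derivative -1/2) (at r)"
    by (auto intro!: derivative_eq_intros dT)
  have "(\<kappa> has_vector_derivative (of_real (-1/2) + \<i> * of_real g')) (at r)"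
    unfolding \<kappa>_def
    by (intro has_vector_derivative_add has_vector_derivative_mult_right has_real_derivative_imp_complex dT2 dsq)
  moreover have "Re (of_real (-1/2) + \<i> * of_real g') \<noteq> 0" by simp
  moreover have "\<kappa> r = \<i> * of_real (sqrt (mode_det d1 d2 a b r x))"
    using assms by (simp add: \<kappa>_def T_def D_def)
  moreover have "\<forall>\<^sub>F s in nhds r. char_poly d1 d2 a b s x (\<kappa> s) = 0"
  proof -
    have "isCont (\<lambda>s. D s - (T s)\<^sup>2 / 4) r" using dg by (rule DERIV_isCont)
    hence "((\<lambda>s. D s - (T s)\<^sup>2 / 4) \<longlongrightarrow> D r - (T r)\<^sup>2 / 4) (nhds r)"
      unfolding isCont_def tendsto_at_iff_tendsto_nhds[of "\<lambda>s. D s - (T s)\<^sup>2 / 4"] .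
    hence "\<forall>\<^sub>F s in nhds r. D s - (T s)\<^sup>2 / 4 > 0" using pos by (rule order_tendstoD(1))
    thus ?thesis
    proof (rule eventually_mono)
      fix s assume s: "D s - (T s)\<^sup>2 / 4 > 0"
      define q where "q = sqrt (D s - (T s)\<^sup>2 / 4)"
      have q: "q\<^sup>2 = D s - (T s)\<^sup>2 / 4" using s by (simp add: q_def)
      show "char_poly d1 d2 a b s x (\<kappa> s) = 0"
        unfolding char_poly_def T_def[symmetric] D_def[symmetric] \<kappa>_def q_def[symmetric]
        using q by (simp add: complex_eq_iff power2_eq_square field_simps)
    qed
  qed
  ultimately show ?thesis using that by blast
qed

text \<open>The root of the characteristic equation that vanishes with the determinant moves with speed
  (derivative of the determinant) / trace.\<close>

lemma Turing_branch:
  assumes T: "mode_trace d1 d2 a b r x < 0" and D: "mode_det d1 d2 a b r x = 0"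
    and D': "d1 * x - A0 a b - B0 a b \<noteq> 0"
  obtains \<mu> :: "real \<Rightarrow> complex" and \<mu>' where "\<mu> r = 0"
    "(\<mu> has_vector_derivative \<mu>') (at r)" "Re \<mu>' \<noteq> 0"
    "\<forall>\<^sub>F s in nhds r. char_poly d1 d2 a b s x (\<mu> s) = 0"
proof -
  define T where "T s = mode_trace d1 d2 a b s x" for s
  define D where "D s = mode_det d1 d2 a b s x" for s
  have dT: "(T has_real_derivative -1) (at r)" unfolding T_def by (rule DERIV_mode_trace)
  have dD: "(D has_real_derivative (d1 * x - A0 a b - B0 a b)) (at r)"
    unfolding D_def by (rule DERIV_mode_det)
  have Tr: "T r < 0" and Dr: "D r = 0" using assms by (simp_all add: T_def D_def)
  define \<mu> where "\<mu> s = complex_of_real ((T s + sqrt ((T s)\<^sup>2 - 4 * D s)) / 2)" for s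
  have pos: "(T r)\<^sup>2 - 4 * D r > 0" using Tr Dr by simp
  have sq: "sqrt ((T r)\<^sup>2 - 4 * D r) = - T r" using Tr Dr by simp
  have dg: "((\<lambda>s. (T s)\<^sup>2 - 4 * D s) has_real_derivative - 2 * T r - 4 * (d1 * x - A0 a b - B0 a b)) (at r)"
    by (auto intro!: derivative_eq_intros dT dD)
  have "((\<lambda>s. (T s + sqrt ((T s)\<^sup>2 - 4 * D s)) / 2) has_real_derivative
      (-1 + (- 2 * T r - 4 * (d1 * x - A0 a b - B0 a b)) * (inverse (sqrt ((T r)\<^sup>2 - 4 * D r)) / 2)) / 2) (at r)"
    by (intro DERIV_cdivide DERIV_add dT
        DERIV_cong[OF DERIV_chain2[OF DERIV_real_sqrt[OF pos] dg]]) simp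
  also have "(-1 + (- 2 * T r - 4 * (d1 * x - A0 a b - B0 a b)) * (inverse (sqrt ((T r)\<^sup>2 - 4 * D r)) / 2)) / 2
      = (d1 * x - A0 a b - B0 a b) / T r"
    unfolding sq using Tr by (simp add: field_simps)
  finally have "(\<mu> has_vector_derivative of_real ((d1 * x - A0 a b - B0 a b) / T r)) (at r)"
    unfolding \<mu>_def by (rule has_real_derivative_imp_complex)
  moreover have "Re (of_real ((d1 * x - A0 a b - B0 a b) / T r)) \<noteq> 0" using Tr D' by simp
  moreover have "\<mu> r = 0" by (simp add: \<mu>_def sq)
  moreover have "\<forall>\<^sub>F s in nhds r. char_poly d1 d2 a b s x (\<mu> s) = 0"
  proof -
    have "isCont (\<lambda>s. (T s)\<^sup>2 - 4 * D s) r" using dg by (rule DERIV_isCont)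
    hence "((\<lambda>s. (T s)\<^sup>2 - 4 * D s) \<longlongrightarrow> (T r)\<^sup>2 - 4 * D r) (nhds r)"
      unfolding isCont_def tendsto_at_iff_tendsto_nhds[of "\<lambda>s. (T s)\<^sup>2 - 4 * D s"] .
    hence "\<forall>\<^sub>F s in nhds r. (T s)\<^sup>2 - 4 * D s > 0" using pos by (rule order_tendstoD(1))
    thus ?thesis
    proof (rule eventually_mono)
      fix s assume s: "(T s)\<^sup>2 - 4 * D s > 0"
      define q where "q = sqrt ((T s)\<^sup>2 - 4 * D s)"
      have q: "q\<^sup>2 = (T s)\<^sup>2 - 4 * D s" using s by (simp add: q_def)
      show "char_poly d1 d2 a b s x (\<mu> s) = 0"
        unfolding char_poly_def T_def[symmetric] D_def[symmetric] \<mu>_def q_def[symmetric]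
        using q by (simp add: complex_eq_iff power2_eq_square field_simps)
    qed
  qed
  ultimately show ?thesis using that by blast
qed

subsection \<open>The critical spectrum\<close>

lemma char_poly_imaginary:
  "char_poly d1 d2 a b r x (\<i> * of_real y) = 0 \<longleftrightarrow>
     mode_det d1 d2 a b r x = y\<^sup>2 \<and> (y = 0 \<or> mode_trace d1 d2 a b r x = 0)"
  by (auto simp: char_poly_def complex_eq_iff power_mult_distrib power2_eq_square)

lemma eigenvalue_iff:
  assumes "l > 0" "b > 0" "a > 0"
  shows "is_eigenvalue d1 d2 a b r l \<mu> \<longleftrightarrow> (\<exists>n. char_poly d1 d2 a b r (wave l n) \<mu> = 0)"
proof
  assume "is_eigenvalue d1 d2 a b r l \<mu>"
  then obtain w where w: "w \<in> eigenspace d1 d2 a b r l \<mu>" "w \<noteq> 0" by (auto simp: is_eigenvalue_def)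
  show "\<exists>n. char_poly d1 d2 a b r (wave l n) \<mu> = 0"
  proof (rule ccontr)
    assume "\<nexists>n. char_poly d1 d2 a b r (wave l n) \<mu> = 0"
    hence "eigenspace d1 d2 a b r l \<mu> = cfun.span {}"
      using eigenspace_span[OF assms, of "{}" d1 d2 r \<mu>] by simp
    with w show False by simp
  qed
next
  assume "\<exists>n. char_poly d1 d2 a b r (wave l n) \<mu> = 0"
  then obtain n where "char_poly d1 d2 a b r (wave l n) \<mu> = 0" ..
  from vector_mode_eigenspace[OF assms(1,2) this] vector_mode_nonzero[OF assms(1) eigvec_nonzero[OF assms(2,3)]]
  show "is_eigenvalue d1 d2 a b r l \<mu>" unfolding is_eigenvalue_def by blast
qed

text \<open>A quadratic polynomial with leading coefficient \<open>d1 d2\<close> is determined by two distinct roots.  So,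
  when modes \<open>j\<close> and \<open>k\<close> are critical, the determinant is negative exactly for the modes strictly
  between them.\<close>

lemma mode_det_factor:
  assumes "mode_det d1 d2 a b r x = 0" "mode_det d1 d2 a b r y = 0" "x \<noteq> y"
  shows "mode_det d1 d2 a b r z = d1 * d2 * (z - x) * (z - y)"
proof -
  have "(x - y) * (d1 * d2 * (x + y) + (r * d1 - d2 * A0 a b)) = 0"
    using assms(1,2) unfolding mode_det_def by algebra
  with assms(3) have s: "d1 * d2 * (x + y) + (r * d1 - d2 * A0 a b) = 0" by simp
  show ?thesis using assms(1) s unfolding mode_det_def by algebra
qed

text \<open>The trace decreases strictly with the mode, so it vanishes at mode \<open>i\<close> only and is negative at \<open>j\<close>
  and \<open>k\<close>; the factorized determinant vanishes at \<open>j\<close> and \<open>k\<close> only and is positive at \<open>i\<close>.  This fixes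
  the critical spectrum, makes it semisimple, and supplies the branches.\<close>

theorem Hopf_double_Turing:
  assumes d: "d1 > 0" "d2 > 0" and l: "l > 0" and b: "b > 0" and a: "a > 0"
    and ij: "i < j" and jk: "j < k"
    and T: "mode_trace d1 d2 a b r (wave l i) = 0"
    and Dj: "mode_det d1 d2 a b r (wave l j) = 0" and Dk: "mode_det d1 d2 a b r (wave l k) = 0"
  shows "Hopf_double_Turing_bifurcation d1 d2 a b r l"
proof -
  have fact: "mode_det d1 d2 a b r z = d1 * d2 * (z - wave l j) * (z - wave l k)" for z
    using mode_det_factor[OF Dj Dk] wave_eq_iff[OF l, of j k] jk by simp
  have D0: "mode_det d1 d2 a b r (wave l n) = 0 \<longleftrightarrow> n = j \<or> n = k" for n
    using fact[of "wave l n"] d wave_eq_iff[OF l] by auto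
  have Di: "mode_det d1 d2 a b r (wave l i) > 0"
    unfolding fact using d wave_less_iff[OF l, of i j] wave_less_iff[OF l, of i k] ij jk
    by (simp add: mult_neg_neg mult.assoc)
  have T0: "mode_trace d1 d2 a b r (wave l n) = 0 \<longleftrightarrow> n = i" for n
  proof -
    have "mode_trace d1 d2 a b r (wave l n) = (d1 + d2) * (wave l i - wave l n)"
      using T by (simp add: mode_trace_def algebra_simps)
    thus ?thesis using d wave_eq_iff[OF l, of i n] by auto
  qed
  have Tneg: "mode_trace d1 d2 a b r (wave l n) < 0" if "i < n" for n
  proof -
    have "mode_trace d1 d2 a b r (wave l n) = (d1 + d2) * (wave l i - wave l n)"
      using T by (simp add: mode_trace_def algebra_simps)
    thus ?thesis using d wave_less_iff[OF l, of i n] that by (simp add: mult_pos_neg)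
  qed
  define \<omega> where "\<omega> = sqrt (mode_det d1 d2 a b r (wave l i))"
  have \<omega>: "\<omega> > 0" "\<omega>\<^sup>2 = mode_det d1 d2 a b r (wave l i)" using Di by (simp_all add: \<omega>_def)
  have zero_root: "char_poly d1 d2 a b r (wave l n) 0 = 0 \<longleftrightarrow> n \<in> {j, k}" for n
    using char_poly_imaginary[of d1 d2 a b r "wave l n" 0] D0 by simp
  have im_root: "char_poly d1 d2 a b r (wave l n) (\<i> * of_real y) = 0 \<longleftrightarrow> n = i"
    if "y\<^sup>2 = \<omega>\<^sup>2" for n y
  proof -
    have "y \<noteq> 0" using that \<omega>(1) by auto
    thus ?thesis unfolding char_poly_imaginary T0 that \<omega>(2) by blast
  qed
  have mult_im: "alg_multiplicity d1 d2 a b r l (\<i> * of_real y) = 1" if y: "y\<^sup>2 = \<omega>\<^sup>2" for y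
  proof -
    have "y \<noteq> 0" using y \<omega> by auto
    hence "(\<Union>m. power_kernel d1 d2 a b r l (\<i> * of_real y) m) = eigenspace d1 d2 a b r l (\<i> * of_real y)"
      by (intro generalized_eigenspace l b) (auto simp: complex_eq_iff)
    thus ?thesis unfolding alg_multiplicity_def
      using eigenspace_dim[OF l b a, of "{i}" d1 d2 r "\<i> * of_real y"] im_root[OF y] by simp
  qed
  have dim0: "cfun.dim (eigenspace d1 d2 a b r l 0) = 2"
    using eigenspace_dim[OF l b a, of "{j, k}" d1 d2 r 0] zero_root jk by simp
  have "(\<Union>m. power_kernel d1 d2 a b r l 0 m) = eigenspace d1 d2 a b r l 0"
    using zero_root Tneg[of j] Tneg[of k] ij jk by (intro generalized_eigenspace l b) auto
  hence mult0: "alg_multiplicity d1 d2 a b r l 0 = 2"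
    unfolding alg_multiplicity_def using dim0 by simp
  have crit: "\<mu> \<in> {\<i> * of_real \<omega>, - \<i> * of_real \<omega>, 0}"
    if ev: "is_eigenvalue d1 d2 a b r l \<mu> \<and> Re \<mu> = 0" for \<mu>
  proof -
    have mu: "\<mu> = \<i> * of_real (Im \<mu>)" using that by (simp add: complex_eq_iff)
    obtain n where "char_poly d1 d2 a b r (wave l n) \<mu> = 0"
      using ev eigenvalue_iff[OF l b a] by blast
    hence n: "mode_det d1 d2 a b r (wave l n) = (Im \<mu>)\<^sup>2"
      "Im \<mu> = 0 \<or> mode_trace d1 d2 a b r (wave l n) = 0"
      using char_poly_imaginary[of d1 d2 a b r "wave l n" "Im \<mu>"] mu by simp_all
    show ?thesis
    proof (cases "Im \<mu> = 0")
      case False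
      with n T0 \<omega>(2) have "(Im \<mu>)\<^sup>2 = \<omega>\<^sup>2" by auto
      hence "Im \<mu> = \<omega> \<or> Im \<mu> = - \<omega>" by (rule power2_eq_iff[THEN iffD1])
      thus ?thesis using that by (auto simp: complex_eq_iff)
    qed (use mu in simp)
  qed
  obtain \<kappa> \<kappa>' where \<kappa>: "\<kappa> r = \<i> * of_real \<omega>" "(\<kappa> has_vector_derivative \<kappa>') (at r)" "Re \<kappa>' \<noteq> 0"
    "\<forall>\<^sub>F s in nhds r. char_poly d1 d2 a b s (wave l i) (\<kappa> s) = 0"
    using Hopf_branch[OF T Di] unfolding \<omega>_def by blast
  have \<kappa>_ev: "\<forall>\<^sub>F s in nhds r. is_eigenvalue d1 d2 a b s l (\<kappa> s)"
    using \<kappa>(4) by (rule eventually_mono) (use eigenvalue_iff[OF l b a] in blast)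
  have pos: "d1 * wave l n - A0 a b - B0 a b \<noteq> 0" for n
    using det_coeff_pos[OF b d(1) wave_nonneg[of l n], of a] by simp
  obtain \<mu>1 \<mu>1' where \<mu>1: "\<mu>1 r = 0" "(\<mu>1 has_vector_derivative \<mu>1') (at r)" "Re \<mu>1' \<noteq> 0"
    "\<forall>\<^sub>F s in nhds r. char_poly d1 d2 a b s (wave l j) (\<mu>1 s) = 0"
    using Turing_branch[OF Tneg[OF ij] Dj pos] by blast
  obtain \<mu>2 \<mu>2' where \<mu>2: "\<mu>2 r = 0" "(\<mu>2 has_vector_derivative \<mu>2') (at r)" "Re \<mu>2' \<noteq> 0"
    "\<forall>\<^sub>F s in nhds r. char_poly d1 d2 a b s (wave l k) (\<mu>2 s) = 0"
    using Turing_branch[OF Tneg[OF less_trans[OF ij jk]] Dk pos] by blast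
  define w1 where "w1 s = vector_mode l j (eigvec d1 a b (wave l j) (\<mu>1 s))" for s
  define w2 where "w2 s = vector_mode l k (eigvec d1 a b (wave l k) (\<mu>2 s))" for s
  have indep: "w1 s \<noteq> w2 s \<and> cfun.independent {w1 s, w2 s}" for s
    using vector_mode_independent[OF l, of "{j, k}" "\<lambda>n. eigvec d1 a b (wave l n) (if n = j then \<mu>1 s else \<mu>2 s)"]
      eigvec_nonzero[OF b a] jk by (simp add: w1_def w2_def)
  have ev12: "\<forall>\<^sub>F s in nhds r. w1 s \<in> eigenspace d1 d2 a b s l (\<mu>1 s) \<and>
      w2 s \<in> eigenspace d1 d2 a b s l (\<mu>2 s) \<and> w1 s \<noteq> w2 s \<and> cfun.independent {w1 s, w2 s}"
    using eventually_conj[OF \<mu>1(4) \<mu>2(4)]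
  proof (rule eventually_mono)
    fix s assume "char_poly d1 d2 a b s (wave l j) (\<mu>1 s) = 0 \<and> char_poly d1 d2 a b s (wave l k) (\<mu>2 s) = 0"
    thus "w1 s \<in> eigenspace d1 d2 a b s l (\<mu>1 s) \<and>
      w2 s \<in> eigenspace d1 d2 a b s l (\<mu>2 s) \<and> w1 s \<noteq> w2 s \<and> cfun.independent {w1 s, w2 s}"
      using indep vector_mode_eigenspace[OF l b] unfolding w1_def w2_def by simp
  qed
  have Hopf: "Hopf_double_zero_bifurcation d1 d2 a b r l"
    unfolding Hopf_double_zero_bifurcation_def
  proof (intro conjI exI[of _ \<omega>])
    show "alg_multiplicity d1 d2 a b r l (- \<i> * of_real \<omega>) = 1"
      using mult_im[of "- \<omega>"] by simp
    show "\<exists>\<kappa> \<kappa>'. \<kappa> r = \<i> * of_real \<omega> \<and> (\<kappa> has_vector_derivative \<kappa>') (at r) \<and> Re \<kappa>' \<noteq> 0 \<and>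
        (\<forall>\<^sub>F s in nhds r. is_eigenvalue d1 d2 a b s l (\<kappa> s))"
      using \<kappa> \<kappa>_ev by blast
    show "\<exists>\<mu>1 \<mu>1' \<mu>2 \<mu>2' w1 w2.
        \<mu>1 r = 0 \<and> (\<mu>1 has_vector_derivative \<mu>1') (at r) \<and> Re \<mu>1' \<noteq> 0 \<and>
        \<mu>2 r = 0 \<and> (\<mu>2 has_vector_derivative \<mu>2') (at r) \<and> Re \<mu>2' \<noteq> 0 \<and>
        (\<forall>\<^sub>F s in nhds r. w1 s \<in> eigenspace d1 d2 a b s l (\<mu>1 s) \<and>
           w2 s \<in> eigenspace d1 d2 a b s l (\<mu>2 s) \<and> w1 s \<noteq> w2 s \<and> cfun.independent {w1 s, w2 s})"
      using \<mu>1(1-3) \<mu>2(1-3) ev12 by blast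
  qed (use \<omega>(1) mult_im[of \<omega>] mult0 crit in auto)
  have "\<not> (\<exists>c. \<forall>x\<in>{0..l * pi}. w x = c)" if w: "w \<in> eigenspace d1 d2 a b r l 0" "w \<noteq> 0" for w
  proof
    assume "\<exists>c. \<forall>x\<in>{0..l * pi}. w x = c"
    then obtain c where c: "\<And>x. x \<in> {0..l * pi} \<Longrightarrow> w x = c" by blast
    have "l * pi > 0" using l by simp
    hence "w x = cos_mode l 0 x *\<^sub>R (sqrt (l * pi) *\<^sub>R c)" if "x \<in> {0..l * pi}" for x
      using c[OF that] l by (simp add: cos_mode_def)
    moreover have "w x = 0" if "x \<notin> {0..l * pi}" for x
      using w that by (auto simp: eigenspace_def neumann_domain_def)
    ultimately have weq: "w = vector_mode l 0 (sqrt (l * pi) *\<^sub>R c)"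
      by (auto simp: fun_eq_iff vector_mode_def simp del: scaleR_scaleR)
    have "char_poly d1 d2 a b r (wave l 0) 0 \<noteq> 0" using zero_root[of 0] ij jk by auto
    hence "cos_coeff l 0 w = 0"
      using shifted_mode_inj eigenspace_coeff[OF l b w(1)] by blast
    with cos_coeff_vector_mode[OF l, of 0 0 "sqrt (l * pi) *\<^sub>R c"] have "sqrt (l * pi) *\<^sub>R c = 0"
      by (simp add: weq)
    with weq have "w = 0" by (auto simp: vector_mode_def fun_eq_iff)
    with w show False by simp
  qed
  with Hopf dim0 show ?thesis unfolding Hopf_double_Turing_bifurcation_def by blast
qed

section \<open>Linear instability destroys nearby stable solutions\<close>

text \<open>The part of \<open>f\<close> orthogonal to the first \<open>N\<close> cosines satisfies the Poincare inequality with constant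
  \<open>wave l N\<close>.  Written with the second derivative it follows from Parseval's identity for the product
  of \<open>f\<close> and \<open>f''\<close>.\<close>

lemma neumann_energy:
  fixes f f' f'' :: "real \<Rightarrow> real"
  assumes l: "l > 0"
    and f: "\<And>x. x \<in> {0..l * pi} \<Longrightarrow> (f has_real_derivative f' x) (at x within {0..l * pi})"
    and f': "\<And>x. x \<in> {0..l * pi} \<Longrightarrow> (f' has_real_derivative f'' x) (at x within {0..l * pi})"
    and f'': "continuous_on {0..l * pi} f''"
    and bc: "f' 0 = 0" "f' (l * pi) = 0"
  shows "integral {0..l * pi} (\<lambda>x. f x * f'' x) + (\<Sum>n<N. wave l n * (cos_coeff l n f)\<^sup>2)
    \<le> - wave l N * (integral {0..l * pi} (\<lambda>x. (f x)\<^sup>2) - (\<Sum>n<N. (cos_coeff l n f)\<^sup>2))"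
proof -
  have cf: "continuous_on {0..l * pi} f"
    using f by (meson DERIV_continuous_on)
  have coeff: "cos_coeff l n f'' = - wave l n * cos_coeff l n f" for n
    using cos_coeff_second_derivative[OF l _ _ f'' bc, of f n] f f'
    by (simp add: has_real_derivative_iff_has_vector_derivative wave_def)
  have s1: "(\<lambda>n. cos_coeff l n f * cos_coeff l n f'') sums integral {0..l * pi} (\<lambda>x. f x * f'' x)"
    by (rule cos_parseval_product[OF l cf f''])
  have s2: "(\<lambda>n. - wave l N * (cos_coeff l n f)\<^sup>2) sums (- wave l N * integral {0..l * pi} (\<lambda>x. (f x)\<^sup>2))"
    by (intro sums_mult cos_parseval l cf)
  have "integral {0..l * pi} (\<lambda>x. f x * f'' x) - (\<Sum>n<N. cos_coeff l n f * cos_coeff l n f'')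
     \<le> (- wave l N * integral {0..l * pi} (\<lambda>x. (f x)\<^sup>2)) - (\<Sum>n<N. - wave l N * (cos_coeff l n f)\<^sup>2)"
  proof (rule sums_le)
    show "(\<lambda>n. cos_coeff l (n + N) f * cos_coeff l (n + N) f'') sums
        (integral {0..l * pi} (\<lambda>x. f x * f'' x) - (\<Sum>n<N. cos_coeff l n f * cos_coeff l n f''))"
      by (rule sums_split_initial_segment[OF s1])
    show "(\<lambda>n. - wave l N * (cos_coeff l (n + N) f)\<^sup>2) sums
        ((- wave l N * integral {0..l * pi} (\<lambda>x. (f x)\<^sup>2)) - (\<Sum>n<N. - wave l N * (cos_coeff l n f)\<^sup>2))"
      by (rule sums_split_initial_segment[OF s2])
    fix n
    have "wave l N \<le> wave l (n + N)"
      using wave_less_iff[OF l, of "n + N" N] by (simp add: not_less[symmetric])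
    hence "wave l N * (cos_coeff l (n + N) f)\<^sup>2 \<le> wave l (n + N) * (cos_coeff l (n + N) f)\<^sup>2"
      by (rule mult_right_mono) simp
    thus "cos_coeff l (n + N) f * cos_coeff l (n + N) f'' \<le> - wave l N * (cos_coeff l (n + N) f)\<^sup>2"
      unfolding coeff by (simp add: power2_eq_square mult_ac)
  qed
  moreover have "(\<Sum>n<N. cos_coeff l n f * cos_coeff l n f'') = - (\<Sum>n<N. wave l n * (cos_coeff l n f)\<^sup>2)"
    unfolding coeff sum_negf[symmetric] by (intro sum.cong) (auto simp: power2_eq_square)
  moreover have "(\<Sum>n<N. - wave l N * (cos_coeff l n f)\<^sup>2) = - wave l N * (\<Sum>n<N. (cos_coeff l n f)\<^sup>2)"
    by (simp add: sum_distrib_left)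
  ultimately show ?thesis by (simp add: algebra_simps)
qed

text \<open>Bessel's inequality for \<open>f + g\<close> and \<open>f - g\<close>: the tails of the mixed products are controlled by those
  of the squares.\<close>

lemma cos_bessel_product:
  fixes f g :: "real \<Rightarrow> real"
  assumes l: "l > 0" and f: "continuous_on {0..l * pi} f" and g: "continuous_on {0..l * pi} g"
  shows "\<bar>2 * (integral {0..l * pi} (\<lambda>x. f x * g x) - (\<Sum>n<N. cos_coeff l n f * cos_coeff l n g))\<bar> \<le>
    (integral {0..l * pi} (\<lambda>x. (f x)\<^sup>2) - (\<Sum>n<N. (cos_coeff l n f)\<^sup>2)) +
    (integral {0..l * pi} (\<lambda>x. (g x)\<^sup>2) - (\<Sum>n<N. (cos_coeff l n g)\<^sup>2))"
proof -
  have bessel: "(\<Sum>n<N. (cos_coeff l n f)\<^sup>2) + 2 * s * (\<Sum>n<N. cos_coeff l n f * cos_coeff l n g)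
       + (\<Sum>n<N. (cos_coeff l n g)\<^sup>2)
     \<le> integral {0..l * pi} (\<lambda>x. (f x)\<^sup>2) + 2 * s * integral {0..l * pi} (\<lambda>x. f x * g x)
       + integral {0..l * pi} (\<lambda>x. (g x)\<^sup>2)" if s: "s\<^sup>2 = 1" for s :: real
  proof -
    have sg: "continuous_on {0..l * pi} (\<lambda>x. s * g x)" by (intro continuous_intros g)
    have "(\<Sum>n<N. (cos_coeff l n (\<lambda>x. f x + s * g x))\<^sup>2) \<le> integral {0..l * pi} (\<lambda>x. (f x + s * g x)\<^sup>2)"
      by (intro cos_bessel l continuous_intros f sg)
    also have "(\<lambda>x. (f x + s * g x)\<^sup>2) = (\<lambda>x. (f x)\<^sup>2 + 2 * s * (f x * g x) + (g x)\<^sup>2)"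
      using s by (auto simp: power2_sum power_mult_distrib fun_eq_iff)
    also have "integral {0..l * pi} (\<lambda>x. (f x)\<^sup>2 + 2 * s * (f x * g x) + (g x)\<^sup>2)
       = integral {0..l * pi} (\<lambda>x. (f x)\<^sup>2) + 2 * s * integral {0..l * pi} (\<lambda>x. f x * g x)
       + integral {0..l * pi} (\<lambda>x. (g x)\<^sup>2)"
    proof -
      have i: "(\<lambda>x. (f x)\<^sup>2) integrable_on {0..l * pi}" "(\<lambda>x. 2 * s * (f x * g x)) integrable_on {0..l * pi}"
        "(\<lambda>x. (g x)\<^sup>2) integrable_on {0..l * pi}"
        by (auto intro!: integrable_continuous_real continuous_intros f g)
      show ?thesis
        unfolding integral_add[OF integrable_add[OF i(1,2)] i(3)] integral_add[OF i(1,2)] by simp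
    qed
    also have "(\<Sum>n<N. (cos_coeff l n (\<lambda>x. f x + s * g x))\<^sup>2) =
      (\<Sum>n<N. (cos_coeff l n f)\<^sup>2) + 2 * s * (\<Sum>n<N. cos_coeff l n f * cos_coeff l n g)
       + (\<Sum>n<N. (cos_coeff l n g)\<^sup>2)"
      unfolding cos_coeff_add[OF f sg] cos_coeff_mult[OF g] sum_distrib_left sum.distrib[symmetric]
      using s by (intro sum.cong) (auto simp: power2_sum power_mult_distrib)
    finally show ?thesis .
  qed
  from bessel[of 1] bessel[of "-1"] show ?thesis by (simp add: algebra_simps)
qed

lemma sum_nonlinear_error_le:
  fixes p q e1 e2 :: real
  assumes \<eta>: "\<eta> > 0" and h: "\<bar>h1\<bar> \<le> \<kappa>" "\<bar>h2\<bar> \<le> \<kappa>" "\<bar>h3\<bar> \<le> \<kappa>"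
  shows "- (2 * (\<kappa> + 1) * (\<eta> * (p\<^sup>2 + q\<^sup>2) + (e1\<^sup>2 + e2\<^sup>2) / \<eta>))
    \<le> 2 * (h1 * p * e1 + h2 * (p * e2 + q * e1) + h3 * q * e2) + 2 * (p * e1 + q * e2)"
proof -
  have \<kappa>: "\<kappa> \<ge> 0" using h(1) by linarith
  have young: "2 * \<bar>x * y\<bar> \<le> \<eta> * x\<^sup>2 + y\<^sup>2 / \<eta>" for x y :: real
  proof -
    have "0 \<le> (\<eta> * \<bar>x\<bar> - \<bar>y\<bar>)\<^sup>2 / \<eta>" using \<eta> by simp
    also have "\<dots> = \<eta> * x\<^sup>2 + y\<^sup>2 / \<eta> - 2 * \<bar>x * y\<bar>"
      using \<eta> by (simp add: power2_eq_square abs_mult field_simps)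
    finally show ?thesis by simp
  qed
  have m: "- (\<kappa> * \<bar>x\<bar>) \<le> h * x" if "\<bar>h\<bar> \<le> \<kappa>" for h x
  proof -
    have "\<bar>h * x\<bar> \<le> \<kappa> * \<bar>x\<bar>" unfolding abs_mult using that by (intro mult_right_mono) auto
    thus ?thesis by linarith
  qed
  define Y where "Y = \<eta> * (p\<^sup>2 + q\<^sup>2) + (e1\<^sup>2 + e2\<^sup>2) / \<eta>"
  have lower: "2 * (h1 * p * e1 + h2 * (p * e2 + q * e1) + h3 * q * e2) + 2 * (p * e1 + q * e2)
     \<ge> - (\<kappa> * (2 * \<bar>p * e1\<bar>)) - \<kappa> * (2 * \<bar>p * e2\<bar>) - \<kappa> * (2 * \<bar>q * e1\<bar>) - \<kappa> * (2 * \<bar>q * e2\<bar>)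
      - 2 * \<bar>p * e1\<bar> - 2 * \<bar>q * e2\<bar>"
  proof -
    have "2 * (h1 * p * e1 + h2 * (p * e2 + q * e1) + h3 * q * e2) + 2 * (p * e1 + q * e2)
      = 2 * (h1 * (p * e1)) + 2 * (h2 * (p * e2)) + 2 * (h2 * (q * e1)) + 2 * (h3 * (q * e2))
      + 2 * (p * e1) + 2 * (q * e2)"
      by (simp add: algebra_simps)
    thus ?thesis
      using m[OF h(1), of "p * e1"] m[OF h(2), of "p * e2"] m[OF h(2), of "q * e1"] m[OF h(3), of "q * e2"]
      by linarith
  qed
  have "\<kappa> * (2 * \<bar>x * y\<bar>) \<le> \<kappa> * (\<eta> * x\<^sup>2 + y\<^sup>2 / \<eta>)" for x y
    by (intro mult_left_mono young \<kappa>)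
  from this[of p e1] this[of p e2] this[of q e1] this[of q e2]
  have "\<kappa> * (2 * \<bar>p * e1\<bar>) + \<kappa> * (2 * \<bar>p * e2\<bar>) + \<kappa> * (2 * \<bar>q * e1\<bar>) + \<kappa> * (2 * \<bar>q * e2\<bar>)
    \<le> \<kappa> * (\<eta> * p\<^sup>2 + e1\<^sup>2 / \<eta>) + \<kappa> * (\<eta> * p\<^sup>2 + e2\<^sup>2 / \<eta>)
      + \<kappa> * (\<eta> * q\<^sup>2 + e1\<^sup>2 / \<eta>) + \<kappa> * (\<eta> * q\<^sup>2 + e2\<^sup>2 / \<eta>)"
    by linarith
  also have "\<dots> = \<kappa> * (2 * Y)"
    by (simp add: Y_def distrib_left add_divide_distrib mult.left_commute)
  finally have k1: "\<kappa> * (2 * \<bar>p * e1\<bar>) + \<kappa> * (2 * \<bar>p * e2\<bar>) + \<kappa> * (2 * \<bar>q * e1\<bar>) + \<kappa> * (2 * \<bar>q * e2\<bar>)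
    \<le> \<kappa> * (2 * Y)" .
  have k2: "2 * \<bar>p * e1\<bar> + 2 * \<bar>q * e2\<bar> \<le> Y"
    using young[of p e1] young[of q e2] by (simp add: Y_def distrib_left add_divide_distrib)
  have k3: "0 \<le> Y" using \<eta> by (simp add: Y_def)
  have k4: "2 * (\<kappa> + 1) * Y = \<kappa> * (2 * Y) + 2 * Y" by (simp add: algebra_simps)
  show ?thesis
    unfolding Y_def[symmetric] using lower k1 k2 k3 k4 by linarith
qed

definition quad_form :: "real \<Rightarrow> real \<Rightarrow> real \<Rightarrow> real \<Rightarrow> real \<Rightarrow> real" where
  "quad_form h1 h2 h3 p q = h1 * p\<^sup>2 + 2 * h2 * (p * q) + h3 * q\<^sup>2"

text \<open>The derivative of \<open>quad_form\<close> in the direction \<open>(P, Q)\<close>.\<close>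

definition quad_rate :: "real \<Rightarrow> real \<Rightarrow> real \<Rightarrow> real \<Rightarrow> real \<Rightarrow> real \<Rightarrow> real \<Rightarrow> real" where
  "quad_rate h1 h2 h3 p q P Q = 2 * (h1 * p * P + h2 * (p * Q + q * P) + h3 * q * Q)"

text \<open>The linear arithmetic closing the next proof, stated for opaque quantities: \<open>W\<close> and \<open>S\<close> stand for
  squared norms and their low-mode parts, \<open>E\<close> for bounds of the nonlinear error.\<close>

lemma functional_growth_arithmetic:
  fixes HL ER P1 P2 Q1 Q2 Q3 Q4 W1 W2 S1 S2 M1 M2 CU CV AU AV RU RV BUV sQ K E10 E2 E4 :: real
  assumes "M1 \<le> - P1" "M2 \<le> - P2" "CU \<le> M1" "CV \<le> M2" "Q3 \<le> BUV" "Q1 \<le> AU" "- Q2 \<le> RV" "0 \<le> AV" "0 \<le> RU"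
    and "CU + CV - AU - RV - AV - RU - BUV = (W1 - S1) + (W2 - S2)"
    and "sQ + (S1 + S2) / 2 \<le> HL" "- E10 \<le> ER" "Q4 \<le> E2" "2 * E2 \<le> E4" "E10 + E4 \<le> (W1 + W2) / 2"
    and "S1 \<le> W1" "S2 \<le> W2" "0 \<le> K"
  shows "sQ - K \<le> HL + ER - P1 - P2 - Q1 + Q2 - Q3 - 2 * Q4"
  using assms by argo

text \<open>The differential inequality \<open>J' \<ge> 2 \<sigma> J\<close> at a fixed time, for the functional \<open>J\<close> that is a Lyapunov
  form \<open>quad_form\<close> on each of the first \<open>N\<close> modes and minus the squared norm on the remaining ones.  Here
  \<open>F\<close> and \<open>G\<close> are the time derivatives of \<open>f\<close> and \<open>g\<close>.  On the low modes the Lyapunov inequality leaves a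
  surplus of half the squared norm; on the high modes diffusion beats all other linear terms, by
  the tail condition; the two surpluses absorb the nonlinear error if \<open>\<eta>\<close> is small.\<close>

lemma functional_growth:
  fixes f f' f'' g g' g'' F G :: "real \<Rightarrow> real" and h1 h2 h3 :: "nat \<Rightarrow> real"
  assumes l: "l > 0" and d: "d1 > 0" "d2 > 0" and \<sigma>: "\<sigma> \<ge> 0"
    and f: "\<And>x. x \<in> {0..l * pi} \<Longrightarrow> (f has_real_derivative f' x) (at x within {0..l * pi})"
    and f': "\<And>x. x \<in> {0..l * pi} \<Longrightarrow> (f' has_real_derivative f'' x) (at x within {0..l * pi})"
    and f'': "continuous_on {0..l * pi} f''" and bcf: "f' 0 = 0" "f' (l * pi) = 0"
    and g: "\<And>x. x \<in> {0..l * pi} \<Longrightarrow> (g has_real_derivative g' x) (at x within {0..l * pi})"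
    and g': "\<And>x. x \<in> {0..l * pi} \<Longrightarrow> (g' has_real_derivative g'' x) (at x within {0..l * pi})"
    and g'': "continuous_on {0..l * pi} g''" and bcg: "g' 0 = 0" "g' (l * pi) = 0"
    and F: "continuous_on {0..l * pi} F" and G: "continuous_on {0..l * pi} G"
    and E1: "\<And>x. x \<in> {0..l * pi} \<Longrightarrow> \<bar>F x - d1 * f'' x - A * f x - B * g x\<bar> \<le> \<eta> * (\<bar>f x\<bar> + \<bar>g x\<bar>)"
    and E2: "\<And>x. x \<in> {0..l * pi} \<Longrightarrow> \<bar>G x - d2 * g'' x - R * f x + R * g x\<bar> \<le> \<eta> * (\<bar>f x\<bar> + \<bar>g x\<bar>)"
    and lyap: "\<And>n p q. n < N \<Longrightarrow>
       quad_rate (h1 n) (h2 n) (h3 n) p q ((A - d1 * wave l n) * p + B * q) (R * p + (- R - d2 * wave l n) * q)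
       \<ge> 2 * \<sigma> * quad_form (h1 n) (h2 n) (h3 n) p q + (p\<^sup>2 + q\<^sup>2) / 2"
    and h: "\<And>n. n < N \<Longrightarrow> \<bar>h1 n\<bar> \<le> \<kappa> \<and> \<bar>h2 n\<bar> \<le> \<kappa> \<and> \<bar>h3 n\<bar> \<le> \<kappa>"
    and tail: "2 * \<bar>A\<bar> + \<bar>B + R\<bar> + 2 * \<bar>R\<bar> + 1 \<le> 2 * d1 * wave l N"
       "2 * \<bar>A\<bar> + \<bar>B + R\<bar> + 2 * \<bar>R\<bar> + 1 \<le> 2 * d2 * wave l N"
    and \<eta>: "\<eta> > 0" "28 * (\<kappa> + 1) * \<eta> \<le> 1" and \<kappa>: "\<kappa> \<ge> 0"
  shows "2 * \<sigma> * ((\<Sum>n<N. quad_form (h1 n) (h2 n) (h3 n) (cos_coeff l n f) (cos_coeff l n g))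
       + (\<Sum>n<N. (cos_coeff l n f)\<^sup>2 + (cos_coeff l n g)\<^sup>2)
       - integral {0..l * pi} (\<lambda>x. (f x)\<^sup>2) - integral {0..l * pi} (\<lambda>x. (g x)\<^sup>2))
    \<le> (\<Sum>n<N. quad_rate (h1 n) (h2 n) (h3 n) (cos_coeff l n f) (cos_coeff l n g) (cos_coeff l n F) (cos_coeff l n G))
       + (\<Sum>n<N. 2 * cos_coeff l n f * cos_coeff l n F + 2 * cos_coeff l n g * cos_coeff l n G)
       - 2 * integral {0..l * pi} (\<lambda>x. f x * F x) - 2 * integral {0..l * pi} (\<lambda>x. g x * G x)"
proof -
  define p where "p n = cos_coeff l n f" for n
  define q where "q n = cos_coeff l n g" for n
  have cf: "continuous_on {0..l * pi} f" using f by (meson DERIV_continuous_on)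
  have cg: "continuous_on {0..l * pi} g" using g by (meson DERIV_continuous_on)
  define e1 where "e1 x = F x - d1 * f'' x - A * f x - B * g x" for x
  define e2 where "e2 x = G x - d2 * g'' x - R * f x + R * g x" for x
  have ce1: "continuous_on {0..l * pi} e1" unfolding e1_def by (intro continuous_intros F f'' cf cg)
  have ce2: "continuous_on {0..l * pi} e2" unfolding e2_def by (intro continuous_intros G g'' cf cg)
  define a1 where "a1 n = cos_coeff l n e1" for n
  define a2 where "a2 n = cos_coeff l n e2" for n
  let ?I = "integral {0..l * pi}"
  define W1 where "W1 = ?I (\<lambda>x. (f x)\<^sup>2)"
  define W2 where "W2 = ?I (\<lambda>x. (g x)\<^sup>2)"
  define W12 where "W12 = ?I (\<lambda>x. f x * g x)"
  have int: "(\<lambda>x. (f x)\<^sup>2) integrable_on {0..l * pi}" "(\<lambda>x. (g x)\<^sup>2) integrable_on {0..l * pi}"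
    "(\<lambda>x. f x * g x) integrable_on {0..l * pi}" "(\<lambda>x. f x * f'' x) integrable_on {0..l * pi}"
    "(\<lambda>x. g x * g'' x) integrable_on {0..l * pi}" "(\<lambda>x. f x * e1 x) integrable_on {0..l * pi}"
    "(\<lambda>x. g x * e2 x) integrable_on {0..l * pi}" "(\<lambda>x. (e1 x)\<^sup>2) integrable_on {0..l * pi}"
    "(\<lambda>x. (e2 x)\<^sup>2) integrable_on {0..l * pi}"
    by (auto intro!: integrable_continuous_real continuous_intros cf cg f'' g'' ce1 ce2)
  have coF: "cos_coeff l n F = (A - d1 * wave l n) * p n + B * q n + a1 n" for n
  proof -
    have cc: "cos_coeff l n f'' = - wave l n * p n"
      using cos_coeff_second_derivative[OF l _ _ f'' bcf, of f n] f f'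
      by (simp add: has_real_derivative_iff_has_vector_derivative wave_def p_def)
    have "cos_coeff l n F = cos_coeff l n (\<lambda>x. d1 * f'' x + A * f x + B * g x + e1 x)"
      by (rule cos_coeff_cong) (simp add: e1_def)
    also have "\<dots> = d1 * cos_coeff l n f'' + A * p n + B * q n + a1 n"
      by (simp add: cos_coeff_add cos_coeff_mult continuous_intros cf cg f'' ce1 p_def q_def a1_def)
    finally show ?thesis by (simp add: cc algebra_simps)
  qed
  have coG: "cos_coeff l n G = R * p n + (- R - d2 * wave l n) * q n + a2 n" for n
  proof -
    have cc: "cos_coeff l n g'' = - wave l n * q n"
      using cos_coeff_second_derivative[OF l _ _ g'' bcg, of g n] g g'
      by (simp add: has_real_derivative_iff_has_vector_derivative wave_def q_def)
    have "cos_coeff l n G = cos_coeff l n (\<lambda>x. d2 * g'' x + R * f x + (- R) * g x + e2 x)"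
      by (rule cos_coeff_cong) (simp add: e2_def)
    also have "\<dots> = d2 * cos_coeff l n g'' + R * p n + (- R) * q n + a2 n"
      unfolding p_def q_def a2_def
      by (subst cos_coeff_add cos_coeff_mult; (intro continuous_intros cf cg g'' ce2)?)+ simp
    finally show ?thesis by (simp add: cc algebra_simps)
  qed
  have IF: "?I (\<lambda>x. f x * F x) = d1 * ?I (\<lambda>x. f x * f'' x) + A * W1 + B * W12 + ?I (\<lambda>x. f x * e1 x)"
  proof -
    have "?I (\<lambda>x. f x * F x) = ?I (\<lambda>x. d1 * (f x * f'' x) + A * (f x)\<^sup>2 + B * (f x * g x) + f x * e1 x)"
      by (rule integral_cong) (simp add: e1_def power2_eq_square algebra_simps)
    also have "\<dots> = ?I (\<lambda>x. d1 * (f x * f'' x)) + ?I (\<lambda>x. A * (f x)\<^sup>2) + ?I (\<lambda>x. B * (f x * g x)) + ?I (\<lambda>x. f x * e1 x)"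
      by (subst integral_add; (intro integrable_add integrable_on_mult_right int)?)+ simp
    finally show ?thesis by (simp add: W1_def W12_def)
  qed
  have IG: "?I (\<lambda>x. g x * G x) = d2 * ?I (\<lambda>x. g x * g'' x) + R * W12 + (- R) * W2 + ?I (\<lambda>x. g x * e2 x)"
  proof -
    have "?I (\<lambda>x. g x * G x) = ?I (\<lambda>x. d2 * (g x * g'' x) + R * (f x * g x) + (- R) * (g x)\<^sup>2 + g x * e2 x)"
      by (rule integral_cong) (simp add: e2_def power2_eq_square algebra_simps)
    also have "\<dots> = ?I (\<lambda>x. d2 * (g x * g'' x)) + ?I (\<lambda>x. R * (f x * g x)) + ?I (\<lambda>x. (- R) * (g x)\<^sup>2) + ?I (\<lambda>x. g x * e2 x)"
      by (subst integral_add; (intro integrable_add integrable_on_mult_right int)?)+ simp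
    finally show ?thesis by (simp add: W2_def W12_def)
  qed
  have e_sq: "(\<bar>f x\<bar> + \<bar>g x\<bar>)\<^sup>2 \<le> 2 * (f x)\<^sup>2 + 2 * (g x)\<^sup>2" for x
    using sum_squares_ge_zero[of "\<bar>f x\<bar> - \<bar>g x\<bar>" 0]
    by (simp add: power2_eq_square algebra_simps)
  have ei: "?I (\<lambda>x. \<eta>\<^sup>2 * (2 * (f x)\<^sup>2 + 2 * (g x)\<^sup>2)) = 2 * \<eta>\<^sup>2 * (W1 + W2)"
  proof -
    have "?I (\<lambda>x. 2 * (f x)\<^sup>2 + 2 * (g x)\<^sup>2) = ?I (\<lambda>x. 2 * (f x)\<^sup>2) + ?I (\<lambda>x. 2 * (g x)\<^sup>2)"
      by (intro integral_add integrable_on_mult_right int)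
    thus ?thesis by (simp add: W1_def W2_def)
  qed
  have sq_le: "?I (\<lambda>x. (e x)\<^sup>2) \<le> 2 * \<eta>\<^sup>2 * (W1 + W2)"
    if "(\<lambda>x. (e x)\<^sup>2) integrable_on {0..l * pi}"
      and e: "\<And>x. x \<in> {0..l * pi} \<Longrightarrow> \<bar>e x\<bar> \<le> \<eta> * (\<bar>f x\<bar> + \<bar>g x\<bar>)" for e
    unfolding ei[symmetric]
  proof (rule integral_le[OF that(1)])
    show "(\<lambda>x. \<eta>\<^sup>2 * (2 * (f x)\<^sup>2 + 2 * (g x)\<^sup>2)) integrable_on {0..l * pi}"
      by (intro integrable_on_mult_right integrable_add int)
    fix x assume "x \<in> {0..l * pi}"
    hence "\<bar>e x\<bar>\<^sup>2 \<le> (\<eta> * (\<bar>f x\<bar> + \<bar>g x\<bar>))\<^sup>2" by (intro power_mono e) auto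
    also have "\<dots> \<le> \<eta>\<^sup>2 * (2 * (f x)\<^sup>2 + 2 * (g x)\<^sup>2)"
      unfolding power_mult_distrib by (intro mult_left_mono e_sq) auto
    finally show "(e x)\<^sup>2 \<le> \<eta>\<^sup>2 * (2 * (f x)\<^sup>2 + 2 * (g x)\<^sup>2)" by simp
  qed
  have sqe: "(\<Sum>n<N. (a1 n)\<^sup>2) + (\<Sum>n<N. (a2 n)\<^sup>2) \<le> 4 * \<eta>\<^sup>2 * (W1 + W2)"
    using cos_bessel[OF l ce1, of N] cos_bessel[OF l ce2, of N]
      sq_le[OF int(8)] sq_le[OF int(9)] E1 E2
    unfolding a1_def a2_def e1_def[abs_def, symmetric] e2_def[abs_def, symmetric]
    by (fastforce simp: e1_def e2_def)
  have prod_le: "?I (\<lambda>x. f x * e1 x) + ?I (\<lambda>x. g x * e2 x) \<le> 2 * \<eta> * (W1 + W2)"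
  proof -
    have "?I (\<lambda>x. f x * e1 x) + ?I (\<lambda>x. g x * e2 x) = ?I (\<lambda>x. f x * e1 x + g x * e2 x)"
      by (intro integral_add[symmetric] int)
    also have "\<dots> \<le> ?I (\<lambda>x. \<eta> * (2 * (f x)\<^sup>2 + 2 * (g x)\<^sup>2))"
    proof (intro integral_le integrable_add integrable_on_mult_right int)
      fix x assume x: "x \<in> {0..l * pi}"
      have "f x * e1 x + g x * e2 x \<le> \<bar>f x\<bar> * \<bar>e1 x\<bar> + \<bar>g x\<bar> * \<bar>e2 x\<bar>"
        unfolding abs_mult[symmetric] by linarith
      also have "\<dots> \<le> \<bar>f x\<bar> * (\<eta> * (\<bar>f x\<bar> + \<bar>g x\<bar>)) + \<bar>g x\<bar> * (\<eta> * (\<bar>f x\<bar> + \<bar>g x\<bar>))"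
        using E1[OF x] E2[OF x] unfolding e1_def e2_def by (intro add_mono mult_left_mono) auto
      also have "\<dots> = \<eta> * (\<bar>f x\<bar> + \<bar>g x\<bar>)\<^sup>2" by (simp add: power2_eq_square algebra_simps)
      also have "\<dots> \<le> \<eta> * (2 * (f x)\<^sup>2 + 2 * (g x)\<^sup>2)"
        using \<eta> by (intro mult_left_mono e_sq) auto
      finally show "f x * e1 x + g x * e2 x \<le> \<eta> * (2 * (f x)\<^sup>2 + 2 * (g x)\<^sup>2)" .
    qed
    also have "\<dots> = \<eta> * (2 * W1 + 2 * W2)"
    proof -
      have "?I (\<lambda>x. 2 * (f x)\<^sup>2 + 2 * (g x)\<^sup>2) = ?I (\<lambda>x. 2 * (f x)\<^sup>2) + ?I (\<lambda>x. 2 * (g x)\<^sup>2)"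
        by (intro integral_add integrable_on_mult_right int)
      thus ?thesis by (simp add: W1_def W2_def)
    qed
    finally show ?thesis by (simp add: algebra_simps)
  qed
  define S1 where "S1 = (\<Sum>n<N. (p n)\<^sup>2)"
  define S2 where "S2 = (\<Sum>n<N. (q n)\<^sup>2)"
  define S12 where "S12 = (\<Sum>n<N. p n * q n)"
  define X1 where "X1 = (\<Sum>n<N. wave l n * (p n)\<^sup>2)"
  define X2 where "X2 = (\<Sum>n<N. wave l n * (q n)\<^sup>2)"
  define HQ where "HQ = (\<Sum>n<N. quad_form (h1 n) (h2 n) (h3 n) (p n) (q n))"
  define HL where "HL = (\<Sum>n<N. quad_rate (h1 n) (h2 n) (h3 n) (p n) (q n)
    ((A - d1 * wave l n) * p n + B * q n) (R * p n + (- R - d2 * wave l n) * q n))"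
  define ER where "ER = (\<Sum>n<N. 2 * (h1 n * p n * a1 n + h2 n * (p n * a2 n + q n * a1 n) + h3 n * q n * a2 n)
      + 2 * (p n * a1 n + q n * a2 n))"
  have S1_le: "S1 \<le> W1" and S2_le: "S2 \<le> W2"
    unfolding S1_def S2_def W1_def W2_def p_def q_def by (intro cos_bessel l cf cg)+
  have en1: "?I (\<lambda>x. f x * f'' x) + X1 \<le> - wave l N * (W1 - S1)"
    unfolding X1_def W1_def S1_def p_def by (rule neumann_energy[OF l f f' f'' bcf])
  have en2: "?I (\<lambda>x. g x * g'' x) + X2 \<le> - wave l N * (W2 - S2)"
    unfolding X2_def W2_def S2_def q_def by (rule neumann_energy[OF l g g' g'' bcg])
  have cross: "\<bar>2 * (W12 - S12)\<bar> \<le> (W1 - S1) + (W2 - S2)"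
    unfolding W12_def S12_def W1_def W2_def S1_def S2_def p_def q_def
    by (rule cos_bessel_product[OF l cf cg])
  have HL: "HL \<ge> 2 * \<sigma> * HQ + (S1 + S2) / 2"
  proof -
    have "2 * \<sigma> * HQ + (S1 + S2) / 2 = (\<Sum>n<N. 2 * \<sigma> * quad_form (h1 n) (h2 n) (h3 n) (p n) (q n) + ((p n)\<^sup>2 + (q n)\<^sup>2) / 2)"
      unfolding HQ_def S1_def S2_def sum.distrib sum_divide_distrib[symmetric] sum_distrib_left ..
    also have "\<dots> \<le> HL" unfolding HL_def by (intro sum_mono lyap) auto
    finally show ?thesis .
  qed
  have ER: "ER \<ge> - (10 * (\<kappa> + 1) * \<eta> * (W1 + W2))"
  proof -
    have "- (2 * (\<kappa> + 1) * (\<eta> * (S1 + S2) + ((\<Sum>n<N. (a1 n)\<^sup>2) + (\<Sum>n<N. (a2 n)\<^sup>2)) / \<eta>))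
      = (\<Sum>n<N. - (2 * (\<kappa> + 1) * (\<eta> * ((p n)\<^sup>2 + (q n)\<^sup>2) + ((a1 n)\<^sup>2 + (a2 n)\<^sup>2) / \<eta>)))"
      unfolding S1_def S2_def
      by (simp add: sum_negf sum.distrib[symmetric] sum_distrib_left sum_divide_distrib)
    also have "\<dots> \<le> ER"
      unfolding ER_def using h by (intro sum_mono sum_nonlinear_error_le \<eta>) auto
    finally have ERl: "- (2 * (\<kappa> + 1) * (\<eta> * (S1 + S2) + ((\<Sum>n<N. (a1 n)\<^sup>2) + (\<Sum>n<N. (a2 n)\<^sup>2)) / \<eta>)) \<le> ER" .
    have "\<eta> * (S1 + S2) + ((\<Sum>n<N. (a1 n)\<^sup>2) + (\<Sum>n<N. (a2 n)\<^sup>2)) / \<eta>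
        \<le> \<eta> * (W1 + W2) + 4 * \<eta>\<^sup>2 * (W1 + W2) / \<eta>"
      using \<eta>(1) S1_le S2_le sqe by (intro add_mono mult_left_mono divide_right_mono) auto
    moreover have "4 * \<eta>\<^sup>2 * (W1 + W2) / \<eta> = 4 * \<eta> * (W1 + W2)"
      using \<eta>(1) by (simp add: power2_eq_square)
    ultimately have "2 * (\<kappa> + 1) * (\<eta> * (S1 + S2) + ((\<Sum>n<N. (a1 n)\<^sup>2) + (\<Sum>n<N. (a2 n)\<^sup>2)) / \<eta>)
      \<le> 2 * (\<kappa> + 1) * (\<eta> * (W1 + W2) + 4 * \<eta> * (W1 + W2))"
      using \<kappa> by (intro mult_left_mono) auto
    with ERl show ?thesis by (simp add: algebra_simps)
  qed
  have rate: "(\<Sum>n<N. quad_rate (h1 n) (h2 n) (h3 n) (p n) (q n) (cos_coeff l n F) (cos_coeff l n G))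
       + (\<Sum>n<N. 2 * p n * cos_coeff l n F + 2 * q n * cos_coeff l n G)
     = HL + ER + 2 * (A * S1 - d1 * X1 + (B + R) * S12 - R * S2 - d2 * X2)"
    unfolding coF coG HL_def ER_def S1_def S2_def S12_def X1_def X2_def quad_rate_def
      sum_distrib_left sum_subtractf[symmetric] sum.distrib[symmetric]
    by (intro sum.cong) (auto simp: power2_eq_square algebra_simps)
  have forms: "(\<Sum>n<N. (p n)\<^sup>2 + (q n)\<^sup>2) = S1 + S2"
    by (simp add: S1_def S2_def sum.distrib)
  have aux: "- (c * z) \<ge> c * w * v" if "z \<le> - w * v" "c > 0" for c z w v :: real
  proof -
    have "c * z \<le> c * (- w * v)" using that by (intro mult_left_mono) auto
    also have "\<dots> = - (c * w * v)" by simp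
    finally show ?thesis by simp
  qed
  have t1: "- (2 * d1 * (?I (\<lambda>x. f x * f'' x) + X1)) \<ge> 2 * d1 * wave l N * (W1 - S1)"
    by (rule aux[OF en1]) (use d in simp)
  have t2: "- (2 * d2 * (?I (\<lambda>x. g x * g'' x) + X2)) \<ge> 2 * d2 * wave l N * (W2 - S2)"
    by (rule aux[OF en2]) (use d in simp)
  define C where "C = 2 * \<bar>A\<bar> + \<bar>B + R\<bar> + 2 * \<bar>R\<bar>"
  have t3: "2 * d1 * wave l N * (W1 - S1) \<ge> (C + 1) * (W1 - S1)"
    using tail(1) S1_le unfolding C_def by (intro mult_right_mono) auto
  have t4: "2 * d2 * wave l N * (W2 - S2) \<ge> (C + 1) * (W2 - S2)"
    using tail(2) S2_le unfolding C_def by (intro mult_right_mono) auto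
  have t5: "(B + R) * (2 * (W12 - S12)) \<le> \<bar>B + R\<bar> * ((W1 - S1) + (W2 - S2))"
    using mult_left_mono[OF cross, of "\<bar>B + R\<bar>"] unfolding abs_mult[symmetric] by linarith
  have t6: "2 * A * (W1 - S1) \<le> 2 * \<bar>A\<bar> * (W1 - S1)" "- (2 * R * (W2 - S2)) \<le> 2 * \<bar>R\<bar> * (W2 - S2)"
    "0 \<le> 2 * \<bar>A\<bar> * (W2 - S2)" "0 \<le> 2 * \<bar>R\<bar> * (W1 - S1)"
  proof -
    show "2 * A * (W1 - S1) \<le> 2 * \<bar>A\<bar> * (W1 - S1)" using S1_le by (intro mult_right_mono) auto
    have "- (2 * R) * (W2 - S2) \<le> 2 * \<bar>R\<bar> * (W2 - S2)" using S2_le by (intro mult_right_mono) auto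
    thus "- (2 * R * (W2 - S2)) \<le> 2 * \<bar>R\<bar> * (W2 - S2)" by simp
  qed (use S1_le S2_le in auto)
  have W: "0 \<le> W1 + W2" unfolding W1_def W2_def by (intro add_nonneg_nonneg integral_nonneg int) auto
  have t7: "10 * (\<kappa> + 1) * \<eta> * (W1 + W2) + 4 * (\<kappa> + 1) * \<eta> * (W1 + W2) \<le> (W1 + W2) / 2"
    using mult_right_mono[OF \<eta>(2) W] by (simp add: algebra_simps)
  have t8: "2 * (2 * \<eta> * (W1 + W2)) \<le> 4 * (\<kappa> + 1) * \<eta> * (W1 + W2)"
  proof -
    have "0 \<le> \<kappa> * (\<eta> * (W1 + W2))" using \<kappa> \<eta> W by (intro mult_nonneg_nonneg) auto
    thus ?thesis by (simp add: algebra_simps)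
  qed
  have t9: "0 \<le> 2 * \<sigma> * ((W1 - S1) + (W2 - S2))"
    using \<sigma> S1_le S2_le by simp
  have t10: "(C + 1) * (W1 - S1) + (C + 1) * (W2 - S2) - 2 * \<bar>A\<bar> * (W1 - S1) - 2 * \<bar>R\<bar> * (W2 - S2)
      - 2 * \<bar>A\<bar> * (W2 - S2) - 2 * \<bar>R\<bar> * (W1 - S1) - \<bar>B + R\<bar> * ((W1 - S1) + (W2 - S2)) = (W1 - S1) + (W2 - S2)"
    unfolding C_def by (simp add: algebra_simps)
  have "HL + ER + 2 * (A * S1 - d1 * X1 + (B + R) * S12 - R * S2 - d2 * X2)
       - 2 * ?I (\<lambda>x. f x * F x) - 2 * ?I (\<lambda>x. g x * G x)
     = HL + ER - 2 * d1 * (?I (\<lambda>x. f x * f'' x) + X1) - 2 * d2 * (?I (\<lambda>x. g x * g'' x) + X2)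
       - 2 * A * (W1 - S1) + 2 * R * (W2 - S2) - (B + R) * (2 * (W12 - S12))
       - 2 * (?I (\<lambda>x. f x * e1 x) + ?I (\<lambda>x. g x * e2 x))"
    unfolding IF IG by (simp add: algebra_simps)
  also have "\<dots> \<ge> 2 * \<sigma> * HQ - 2 * \<sigma> * ((W1 - S1) + (W2 - S2))"
    by (rule functional_growth_arithmetic[OF t1 t2 t3 t4 t5 t6(1,2,3,4) t10 HL ER prod_le t8 t7 S1_le S2_le t9])
  finally show ?thesis
    unfolding p_def[symmetric] q_def[symmetric] rate forms W1_def[symmetric] W2_def[symmetric] HQ_def[symmetric]
    by (simp add: algebra_simps)
qed

subsection \<open>The quadratic functional along solutions\<close>

lemma integral_time_derivative:
  fixes z zt :: "real \<Rightarrow> real \<Rightarrow> real"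
  assumes l: "l > 0"
    and c: "continuous_on ({0..l * pi} \<times> {0..}) (\<lambda>(x, t). z x t)"
    and ct: "continuous_on ({0..l * pi} \<times> {0<..}) (\<lambda>(x, t). zt x t)"
    and d: "\<And>x t. x \<in> {0..l * pi} \<Longrightarrow> t > 0 \<Longrightarrow> ((\<lambda>s. z x s) has_real_derivative zt x t) (at t)"
  shows "continuous_on {0..} (\<lambda>t. integral {0..l * pi} (\<lambda>x. z x t))"
    and "t > 0 \<Longrightarrow> ((\<lambda>t. integral {0..l * pi} (\<lambda>x. z x t)) has_real_derivative
       integral {0..l * pi} (\<lambda>x. zt x t)) (at t)"
proof -
  have swap: "continuous_on (T \<times> {0..l * pi}) (\<lambda>(t, x). w x t)"
    if "continuous_on ({0..l * pi} \<times> T) (\<lambda>(x, t). w x t)" for T and w :: "real \<Rightarrow> real \<Rightarrow> real"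
  proof -
    have "continuous_on (T \<times> {0..l * pi}) (\<lambda>p. (\<lambda>(x, t). w x t) (snd p, fst p))"
      by (rule continuous_on_compose2[OF that]) (auto intro!: continuous_intros)
    thus ?thesis by (simp add: case_prod_unfold)
  qed
  show "continuous_on {0..} (\<lambda>t. integral {0..l * pi} (\<lambda>x. z x t))"
    using integral_continuous_on_param[of "{0..}" 0 "l * pi" "\<lambda>t x. z x t"] swap[OF c] by simp
  assume t: "t > 0"
  have "((\<lambda>t. integral (cbox 0 (l * pi)) (\<lambda>x. z x t)) has_field_derivative
       integral (cbox 0 (l * pi)) (\<lambda>x. zt x t)) (at t within {0<..})"
  proof (rule leibniz_rule_field_derivative)
    show "((\<lambda>t. z x t) has_field_derivative zt x s) (at s within {0<..})"
      if "s \<in> {0<..}" "x \<in> cbox 0 (l * pi)" for s x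
      using d[of x s] that by (auto intro: has_field_derivative_at_within)
    show "(\<lambda>x. z x s) integrable_on cbox 0 (l * pi)" if "s \<in> {0<..}" for s
    proof -
      have "continuous_on {0..l * pi} (\<lambda>x. z x s)"
      proof -
        have "continuous_on {0..l * pi} (\<lambda>x. (\<lambda>(x, t). z x t) (x, s))"
          by (rule continuous_on_compose2[OF c]) (use that in \<open>auto intro!: continuous_intros\<close>)
        thus ?thesis by simp
      qed
      thus ?thesis by (simp add: integrable_continuous_real)
    qed
    show "continuous_on ({0<..} \<times> cbox 0 (l * pi)) (\<lambda>(t, x). zt x t)"
      using swap[OF ct] by simp
  qed (use t in auto)
  moreover have "at t within {0<..} = at t" using t by (intro at_within_open) auto
  ultimately show "((\<lambda>t. integral {0..l * pi} (\<lambda>x. z x t)) has_real_derivative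
       integral {0..l * pi} (\<lambda>x. zt x t)) (at t)" by simp
qed

lemma classical_neumann_coeff:
  assumes l: "l > 0" and z: "classical_neumann l z zt zx zxx"
  shows "continuous_on {0..} (\<lambda>t. cos_coeff l n (\<lambda>x. z x t))"
    and "t > 0 \<Longrightarrow> ((\<lambda>t. cos_coeff l n (\<lambda>x. z x t)) has_real_derivative cos_coeff l n (\<lambda>x. zt x t)) (at t)"
proof -
  have c: "continuous_on ({0..l * pi} \<times> {0..}) (\<lambda>p. z (fst p) (snd p))"
    and ct: "continuous_on ({0..l * pi} \<times> {0<..}) (\<lambda>p. zt (fst p) (snd p))"
    and d: "\<And>x t. x \<in> {0..l * pi} \<Longrightarrow> t > 0 \<Longrightarrow> ((\<lambda>s. z x s) has_real_derivative zt x t) (at t)"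
    using z unfolding classical_neumann_def by (auto simp: case_prod_unfold)
  have cp: "continuous_on S (\<lambda>p::real \<times> real. cos_mode l n (fst p))" for S
    unfolding cos_mode_def divide_inverse
    by (intro continuous_on_mult continuous_on_cos continuous_on_const continuous_on_fst continuous_on_id)
  have 1: "continuous_on ({0..l * pi} \<times> {0..}) (\<lambda>(x, t). cos_mode l n x * z x t)"
    unfolding case_prod_unfold by (intro continuous_intros c cp)
  have 2: "continuous_on ({0..l * pi} \<times> {0<..}) (\<lambda>(x, t). cos_mode l n x * zt x t)"
    unfolding case_prod_unfold by (intro continuous_intros ct cp)
  have 3: "((\<lambda>s. cos_mode l n x * z x s) has_real_derivative cos_mode l n x * zt x t) (at t)"
    if "x \<in> {0..l * pi}" "t > 0" for x t by (rule DERIV_cmult[OF d[OF that]])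
  show "continuous_on {0..} (\<lambda>t. cos_coeff l n (\<lambda>x. z x t))"
    using integral_time_derivative(1)[OF l 1 2 3] unfolding cos_coeff_def by simp
  show "((\<lambda>t. cos_coeff l n (\<lambda>x. z x t)) has_real_derivative cos_coeff l n (\<lambda>x. zt x t)) (at t)" if "t > 0"
    using integral_time_derivative(2)[OF l 1 2 3 that] unfolding cos_coeff_def by simp
qed

lemma classical_neumann_square:
  assumes l: "l > 0" and z: "classical_neumann l z zt zx zxx"
  shows "continuous_on {0..} (\<lambda>t. integral {0..l * pi} (\<lambda>x. (z x t)\<^sup>2))"
    and "t > 0 \<Longrightarrow> ((\<lambda>t. integral {0..l * pi} (\<lambda>x. (z x t)\<^sup>2)) has_real_derivative
       2 * integral {0..l * pi} (\<lambda>x. z x t * zt x t)) (at t)"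
proof -
  have c: "continuous_on ({0..l * pi} \<times> {0..}) (\<lambda>p. z (fst p) (snd p))"
    and ct: "continuous_on ({0..l * pi} \<times> {0<..}) (\<lambda>p. zt (fst p) (snd p))"
    and d: "\<And>x t. x \<in> {0..l * pi} \<Longrightarrow> t > 0 \<Longrightarrow> ((\<lambda>s. z x s) has_real_derivative zt x t) (at t)"
    using z unfolding classical_neumann_def by (auto simp: case_prod_unfold)
  have c': "continuous_on ({0..l * pi} \<times> {0<..}) (\<lambda>p. z (fst p) (snd p))"
    by (rule continuous_on_subset[OF c]) auto
  have 1: "continuous_on ({0..l * pi} \<times> {0..}) (\<lambda>(x, t). (z x t)\<^sup>2)"
    unfolding case_prod_unfold by (intro continuous_intros c)
  have 2: "continuous_on ({0..l * pi} \<times> {0<..}) (\<lambda>(x, t). 2 * (z x t * zt x t))"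
    unfolding case_prod_unfold by (intro continuous_intros c' ct)
  have 3: "((\<lambda>s. (z x s)\<^sup>2) has_real_derivative 2 * (z x t * zt x t)) (at t)"
    if "x \<in> {0..l * pi}" "t > 0" for x t
    by (auto intro!: derivative_eq_intros d that)
  show "continuous_on {0..} (\<lambda>t. integral {0..l * pi} (\<lambda>x. (z x t)\<^sup>2))"
    by (rule integral_time_derivative(1)[OF l 1 2 3])
  show "((\<lambda>t. integral {0..l * pi} (\<lambda>x. (z x t)\<^sup>2)) has_real_derivative
       2 * integral {0..l * pi} (\<lambda>x. z x t * zt x t)) (at t)" if "t > 0"
    using integral_time_derivative(2)[OF l 1 2 3 that] by simp
qed

lemma classical_neumann_diff:
  assumes "classical_neumann l u ut ux uxx" "classical_neumann l v vt vx vxx"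
  shows "classical_neumann l (\<lambda>x t. u x t - v x t) (\<lambda>x t. ut x t - vt x t)
    (\<lambda>x t. ux x t - vx x t) (\<lambda>x t. uxx x t - vxx x t)"
  using assms unfolding classical_neumann_def case_prod_unfold
  by (auto intro!: continuous_intros DERIV_diff simp del: atLeastAtMost_iff)

lemma classical_neumann_section:
  assumes "classical_neumann l z zt zx zxx" "t > 0"
  shows "\<And>x. x \<in> {0..l * pi} \<Longrightarrow> ((\<lambda>x. z x t) has_real_derivative zx x t) (at x within {0..l * pi})"
    and "\<And>x. x \<in> {0..l * pi} \<Longrightarrow> ((\<lambda>x. zx x t) has_real_derivative zxx x t) (at x within {0..l * pi})"
    and "continuous_on {0..l * pi} (\<lambda>x. zxx x t)" "continuous_on {0..l * pi} (\<lambda>x. zt x t)"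
    and "zx 0 t = 0" "zx (l * pi) t = 0"
proof -
  have "continuous_on {0..l * pi} (\<lambda>x. w x t)"
    if "continuous_on ({0..l * pi} \<times> {0<..}) (\<lambda>(x, t). w x t)" for w :: "real \<Rightarrow> real \<Rightarrow> real"
  proof -
    have "continuous_on {0..l * pi} (\<lambda>x. (\<lambda>(x, t). w x t) (x, t))"
      by (rule continuous_on_compose2[OF that]) (use assms(2) in \<open>auto intro!: continuous_intros\<close>)
    thus ?thesis by simp
  qed
  thus "continuous_on {0..l * pi} (\<lambda>x. zxx x t)" "continuous_on {0..l * pi} (\<lambda>x. zt x t)"
    using assms unfolding classical_neumann_def by blast+
qed (use assms in \<open>auto simp: classical_neumann_def\<close>)

lemma exponential_growth:
  fixes J J' :: "real \<Rightarrow> real"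
  assumes c: "continuous_on {0..} J" and d: "\<And>t. t > 0 \<Longrightarrow> (J has_real_derivative J' t) (at t)"
    and ge: "\<And>t. t > 0 \<Longrightarrow> J' t \<ge> s * J t" and t: "t \<ge> 0"
  shows "J t \<ge> J 0 * exp (s * t)"
proof -
  have "exp (- (s * 0)) * J 0 \<le> exp (- (s * t)) * J t"
  proof (rule DERIV_nonneg_imp_increasing_open[OF t])
    fix u assume u: "0 < u" "u < t"
    have "((\<lambda>t. exp (- (s * t)) * J t) has_real_derivative exp (- (s * u)) * (J' u - s * J u)) (at u)"
      by (auto intro!: derivative_eq_intros d u simp: algebra_simps)
    thus "\<exists>y. ((\<lambda>t. exp (- (s * t)) * J t) has_real_derivative y) (at u) \<and> 0 \<le> y"
      using ge[OF u(1)] by (intro exI conjI) auto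
  next
    show "continuous_on {0..t} (\<lambda>t. exp (- (s * t)) * J t)"
      by (intro continuous_intros continuous_on_subset[OF c]) auto
  qed
  thus ?thesis by (simp add: exp_minus field_simps)
qed

text \<open>The inequality \<open>J' \<ge> s J\<close> forces \<open>J t \<ge> J 0 exp (s t)\<close>, which exceeds every bound.\<close>

lemma no_bounded_growth:
  fixes J J' :: "real \<Rightarrow> real"
  assumes "continuous_on {0..} J" "\<And>t. t > 0 \<Longrightarrow> (J has_real_derivative J' t) (at t)"
    and "\<And>t. t > 0 \<Longrightarrow> J' t \<ge> s * J t" and s: "s > 0" and J0: "J 0 > 0"
    and bd: "\<And>t. t > 0 \<Longrightarrow> J t \<le> M"
  shows False
proof -
  define t where "t = \<bar>M\<bar> / (s * J 0) + 1"
  have t: "t > 0" using s J0 by (simp add: t_def add_nonneg_pos)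
  have "J 0 * (s * t) < J 0 * exp (s * t)"
    using J0 exp_ge_add_one_self[of "s * t"] by (intro mult_strict_left_mono) linarith+
  also have "\<dots> \<le> M"
    using exponential_growth[OF assms(1,2,3), of t] bd[OF t] t by linarith
  finally have "J 0 * (s * t) < M" .
  moreover have "J 0 * (s * t) = \<bar>M\<bar> + J 0 * s"
    using s J0 by (simp add: t_def field_simps)
  ultimately show False using s J0 by (smt (verit) mult_pos_pos)
qed

subsection \<open>Lyapunov matrices\<close>

text \<open>For a matrix \<open>M\<close> with nonzero trace and determinant, \<open>H = (det M + adj M\<^sup>T adj M) / (2 tr M det M)\<close>
  solves the Lyapunov equation \<open>M\<^sup>T H + H M = 1\<close>: since \<open>adj M M = det M\<close>, the left-hand side is
  \<open>(M + M\<^sup>T + adj M + adj M\<^sup>T) / (2 tr M)\<close>, and \<open>M + adj M = tr M\<close>.  Each of the two alternatives gives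
  \<open>M\<close> an eigenvalue with positive real part, and then the form takes a positive value.\<close>

lemma lyapunov_2x2:
  fixes \<alpha> \<beta> \<gamma> \<delta> :: real
  assumes tau: "\<alpha> + \<delta> \<noteq> 0" and det: "\<alpha> * \<delta> - \<beta> * \<gamma> \<noteq> 0"
  obtains h1 h2 h3 where
    "\<And>p q. quad_rate h1 h2 h3 p q (\<alpha> * p + \<beta> * q) (\<gamma> * p + \<delta> * q) = p\<^sup>2 + q\<^sup>2"
    "(\<alpha> * \<delta> - \<beta> * \<gamma> < 0 \<and> \<beta> \<noteq> 0) \<or> (\<alpha> + \<delta> > 0 \<and> \<alpha> * \<delta> - \<beta> * \<gamma> > 0) \<Longrightarrow> \<exists>p q. quad_form h1 h2 h3 p q > 0"
proof -
  define D where "D = \<alpha> * \<delta> - \<beta> * \<gamma>"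
  define k where "k = 2 * (\<alpha> + \<delta>) * D"
  have k: "k \<noteq> 0" using assms by (simp add: k_def D_def)
  define h1 where "h1 = (D + \<delta>\<^sup>2 + \<gamma>\<^sup>2) / k"
  define h2 where "h2 = - (\<beta> * \<delta> + \<alpha> * \<gamma>) / k"
  define h3 where "h3 = (D + \<alpha>\<^sup>2 + \<beta>\<^sup>2) / k"
  have h: "h1 * k = D + \<delta>\<^sup>2 + \<gamma>\<^sup>2" "h2 * k = - (\<beta> * \<delta> + \<alpha> * \<gamma>)" "h3 * k = D + \<alpha>\<^sup>2 + \<beta>\<^sup>2"
    using k by (simp_all add: h1_def h2_def h3_def)
  have lyap: "quad_rate h1 h2 h3 p q (\<alpha> * p + \<beta> * q) (\<gamma> * p + \<delta> * q) = p\<^sup>2 + q\<^sup>2" for p q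
  proof -
    have "k * quad_rate h1 h2 h3 p q (\<alpha> * p + \<beta> * q) (\<gamma> * p + \<delta> * q) = 2 *
        ((h1 * k) * p * (\<alpha> * p + \<beta> * q) + (h2 * k) * (p * (\<gamma> * p + \<delta> * q) + q * (\<alpha> * p + \<beta> * q))
          + (h3 * k) * q * (\<gamma> * p + \<delta> * q))"
      by (simp add: quad_rate_def algebra_simps)
    also have "\<dots> = k * (p\<^sup>2 + q\<^sup>2)"
      unfolding h by (simp add: k_def D_def power2_eq_square algebra_simps)
    finally show ?thesis using k by simp
  qed
  moreover have "\<exists>p q. quad_form h1 h2 h3 p q > 0"
    if "(D < 0 \<and> \<beta> \<noteq> 0) \<or> (\<alpha> + \<delta> > 0 \<and> D > 0)"
    using that
  proof
    assume pos: "\<alpha> + \<delta> > 0 \<and> D > 0"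
    hence "k > 0" by (simp add: k_def)
    moreover have "D + \<delta>\<^sup>2 + \<gamma>\<^sup>2 > 0" using pos by (simp add: add_pos_nonneg)
    ultimately have "quad_form h1 h2 h3 1 0 > 0" by (simp add: quad_form_def h1_def)
    thus ?thesis by blast
  next
    assume neg: "D < 0 \<and> \<beta> \<noteq> 0"
    \<comment> \<open>On an eigenvector of a positive eigenvalue \<open>lam\<close> the identity reads \<open>2 lam Q = p\<^sup>2 + q\<^sup>2\<close>.\<close>
    define t where "t = \<alpha> + \<delta>"
    define lam where "lam = (t + sqrt (t\<^sup>2 - 4 * D)) / 2"
    have sq: "(sqrt (t\<^sup>2 - 4 * D))\<^sup>2 = t\<^sup>2 - 4 * D"
      using neg zero_le_power2[of t] by (intro real_sqrt_pow2) linarith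
    have "\<bar>t\<bar> < sqrt (t\<^sup>2 - 4 * D)" using neg by (intro real_less_rsqrt) simp
    hence pos: "lam > 0" by (simp add: lam_def)
    have root: "lam\<^sup>2 = t * lam - D"
      using sq unfolding lam_def by (simp add: power2_eq_square field_simps)
    define p where "p = \<beta>"
    define q where "q = lam - \<alpha>"
    have e1: "\<alpha> * p + \<beta> * q = lam * p" by (simp add: p_def q_def algebra_simps)
    have e2: "\<gamma> * p + \<delta> * q = lam * q"
      using root by (simp add: p_def q_def t_def D_def power2_eq_square algebra_simps)
    have "2 * lam * quad_form h1 h2 h3 p q = p\<^sup>2 + q\<^sup>2"
      using lyap[of p q] unfolding e1 e2
      by (simp add: quad_rate_def quad_form_def power2_eq_square algebra_simps)
    moreover have "p\<^sup>2 + q\<^sup>2 > 0" using neg by (simp add: p_def add_pos_nonneg)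
    ultimately have "quad_form h1 h2 h3 p q > 0" using pos by (metis mult_pos_pos zero_less_mult_pos zero_less_numeral)
    thus ?thesis by blast
  qed
  ultimately show ?thesis using that unfolding D_def by blast
qed

subsection \<open>Linear approximation of the reaction terms\<close>

text \<open>Strict differentiability of a function with continuous partial derivatives, by the mean value
  inequality in each variable.  A bound on differences, and not merely on the distance to the
  steady state, is needed because two nonconstant solutions will be compared.\<close>

lemma strict_linear_approximation:
  fixes h hu hv :: "real \<Rightarrow> real \<Rightarrow> real"
  assumes r0: "r0 > 0"
    and du: "\<And>u v. \<bar>u - e\<bar> < r0 \<Longrightarrow> ((\<lambda>u. h u v) has_real_derivative hu u v) (at u)"
    and dv: "\<And>u v. \<bar>u - e\<bar> < r0 \<Longrightarrow> ((\<lambda>v. h u v) has_real_derivative hv u v) (at v)"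
    and cu: "isCont (\<lambda>p. hu (fst p) (snd p)) (e, e)" and cv: "isCont (\<lambda>p. hv (fst p) (snd p)) (e, e)"
    and \<eta>: "\<eta> > 0"
  shows "\<exists>\<rho>>0. \<forall>u v u' v'. \<bar>u - e\<bar> < \<rho> \<and> \<bar>v - e\<bar> < \<rho> \<and> \<bar>u' - e\<bar> < \<rho> \<and> \<bar>v' - e\<bar> < \<rho> \<longrightarrow>
     \<bar>h u v - h u' v' - hu e e * (u - u') - hv e e * (v - v')\<bar> \<le> \<eta> * (\<bar>u - u'\<bar> + \<bar>v - v'\<bar>)"
proof -
  obtain r1 where r1: "r1 > 0" "\<And>p. dist p (e, e) < r1 \<Longrightarrow> dist (hu (fst p) (snd p)) (hu e e) < \<eta>"
    using cu \<eta> unfolding continuous_at_eps_delta by fastforce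
  obtain r2 where r2: "r2 > 0" "\<And>p. dist p (e, e) < r2 \<Longrightarrow> dist (hv (fst p) (snd p)) (hv e e) < \<eta>"
    using cv \<eta> unfolding continuous_at_eps_delta by fastforce
  define \<rho> where "\<rho> = min r0 (min (r1 / 2) (r2 / 2))"
  have \<rho>: "\<rho> > 0" "\<rho> \<le> r0" "2 * \<rho> \<le> r1" "2 * \<rho> \<le> r2" using r0 r1 r2 by (auto simp: \<rho>_def)
  have near: "dist (u, v) (e, e) < 2 * \<rho>" if "\<bar>u - e\<bar> < \<rho>" "\<bar>v - e\<bar> < \<rho>" for u v
  proof -
    have "dist (u, v) (e, e) \<le> \<bar>u - e\<bar> + \<bar>v - e\<bar>"
      by (simp add: dist_Pair_Pair dist_real_def sqrt_sum_squares_le_sum_abs)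
    with that show ?thesis by linarith
  qed
  show ?thesis
  proof (intro exI[of _ \<rho>] conjI allI impI \<rho>(1))
    fix u v u' v' assume a: "\<bar>u - e\<bar> < \<rho> \<and> \<bar>v - e\<bar> < \<rho> \<and> \<bar>u' - e\<bar> < \<rho> \<and> \<bar>v' - e\<bar> < \<rho>"
    have conv: "convex {x. \<bar>x - e\<bar> < \<rho>}"
    proof -
      have "{x. \<bar>x - e\<bar> < \<rho>} = ball e \<rho>" by (auto simp: dist_real_def)
      thus ?thesis by simp
    qed
    have "norm ((h u v - hu e e * u) - (h u' v - hu e e * u')) \<le> \<eta> * norm (u - u')"
    proof (rule field_differentiable_bound[OF conv, of "\<lambda>u. h u v - hu e e * u" "\<lambda>u. hu u v - hu e e"])
      fix x assume "x \<in> {x. \<bar>x - e\<bar> < \<rho>}"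
      hence x: "\<bar>x - e\<bar> < \<rho>" by simp
      show "((\<lambda>u. h u v - hu e e * u) has_field_derivative hu x v - hu e e) (at x within {x. \<bar>x - e\<bar> < \<rho>})"
        by (rule has_field_derivative_at_within[OF DERIV_diff[OF du DERIV_cmult_Id]]) (use x \<rho> in auto)
      show "norm (hu x v - hu e e) \<le> \<eta>"
        using r1(2)[of "(x, v)"] near[of x v] a x \<rho> by (simp add: dist_real_def)
    qed (use a in auto)
    moreover have "norm ((h u' v - hv e e * v) - (h u' v' - hv e e * v')) \<le> \<eta> * norm (v - v')"
    proof (rule field_differentiable_bound[OF conv, of "\<lambda>v. h u' v - hv e e * v" "\<lambda>v. hv u' v - hv e e"])
      fix x assume "x \<in> {x. \<bar>x - e\<bar> < \<rho>}"
      hence x: "\<bar>x - e\<bar> < \<rho>" by simp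
      show "((\<lambda>v. h u' v - hv e e * v) has_field_derivative hv u' x - hv e e) (at x within {x. \<bar>x - e\<bar> < \<rho>})"
        by (rule has_field_derivative_at_within[OF DERIV_diff[OF dv DERIV_cmult_Id]]) (use a \<rho> in auto)
      show "norm (hv u' x - hv e e) \<le> \<eta>"
        using r2(2)[of "(u', x)"] near[of u' x] a x \<rho> by (simp add: dist_real_def)
    qed (use a in auto)
    ultimately show "\<bar>h u v - h u' v' - hu e e * (u - u') - hv e e * (v - v')\<bar> \<le> \<eta> * (\<bar>u - u'\<bar> + \<bar>v - v'\<bar>)"
      unfolding real_norm_def by (simp add: algebra_simps)
  qed
qed

text \<open>The radius \<open>\<rho>\<close> is uniform for bounded parameters of the second reaction term, which depends linearly on
  its parameter.\<close>

lemma reaction_approximation: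
  assumes b: "b > 0" and R: "Rmax > 0" and \<eta>: "\<eta> > 0"
  obtains \<rho> where "\<rho> > 0"
    "\<And>u v u' v'. \<bar>u - u_star a b\<bar> < \<rho> \<Longrightarrow> \<bar>v - u_star a b\<bar> < \<rho> \<Longrightarrow> \<bar>u' - u_star a b\<bar> < \<rho> \<Longrightarrow> \<bar>v' - u_star a b\<bar> < \<rho> \<Longrightarrow>
       \<bar>react_u a b u v - react_u a b u' v' - A0 a b * (u - u') - B0 a b * (v - v')\<bar> \<le> \<eta> * (\<bar>u - u'\<bar> + \<bar>v - v'\<bar>)"
    "\<And>R u v u' v'. 0 < R \<Longrightarrow> R \<le> Rmax \<Longrightarrow>
       \<bar>u - u_star a b\<bar> < \<rho> \<Longrightarrow> \<bar>v - u_star a b\<bar> < \<rho> \<Longrightarrow> \<bar>u' - u_star a b\<bar> < \<rho> \<Longrightarrow> \<bar>v' - u_star a b\<bar> < \<rho> \<Longrightarrow>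
       \<bar>react_v R u v - react_v R u' v' - R * (u - u') + R * (v - v')\<bar> \<le> \<eta> * (\<bar>u - u'\<bar> + \<bar>v - v'\<bar>)"
proof -
  define e where "e = u_star a b"
  have e: "e > 0" using u_star_pos[OF b] by (simp add: e_def)
  have du: "((\<lambda>u. react_u a b u v) has_real_derivative (1 - 2 * u - a * v * b / (u + b)\<^sup>2)) (at u)"
    if "\<bar>u - e\<bar> < e" for u v
    unfolding react_u_def using that b
    by (auto intro!: derivative_eq_intros simp: power2_eq_square algebra_simps)
  have dv: "((\<lambda>v. react_u a b u v) has_real_derivative (- (a * u / (u + b)))) (at v)" for u v
    unfolding react_u_def divide_inverse by (auto intro!: derivative_eq_intros)
  have du': "((\<lambda>u. react_v 1 u v) has_real_derivative (v\<^sup>2 / u\<^sup>2)) (at u)" if "\<bar>u - e\<bar> < e" for u v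
    unfolding react_v_def using that
    by (auto intro!: derivative_eq_intros simp: power2_eq_square)
  have dv': "((\<lambda>v. react_v 1 u v) has_real_derivative (1 - 2 * v / u)) (at v)" for u v
    unfolding react_v_def divide_inverse by (auto intro!: derivative_eq_intros simp: algebra_simps)
  have val: "1 - 2 * e - a * e * b / (e + b)\<^sup>2 = A0 a b" "- (a * e / (e + b)) = B0 a b"
    using DERIV_imp_deriv[OF du[of e e]] deriv_react_u_u[OF b, of a] e
      DERIV_imp_deriv[OF dv[of e e]] deriv_react_u_v[of a b] by (simp_all add: e_def)
  have eb: "e + b \<noteq> 0" using e b by simp
  obtain \<rho>1 where \<rho>1: "\<rho>1 > 0" "\<forall>u v u' v'. \<bar>u - e\<bar> < \<rho>1 \<and> \<bar>v - e\<bar> < \<rho>1 \<and> \<bar>u' - e\<bar> < \<rho>1 \<and> \<bar>v' - e\<bar> < \<rho>1 \<longrightarrow>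
     \<bar>react_u a b u v - react_u a b u' v' - (1 - 2 * e - a * e * b / (e + b)\<^sup>2) * (u - u')
       - (- (a * e / (e + b))) * (v - v')\<bar> \<le> \<eta> * (\<bar>u - u'\<bar> + \<bar>v - v'\<bar>)"
  proof -
    have "isCont (\<lambda>p. 1 - 2 * fst p - a * snd p * b / (fst p + b)\<^sup>2) (e, e)"
      by (intro continuous_intros) (simp add: eb)
    moreover have "isCont (\<lambda>p. - (a * fst p / (fst p + b))) (e, e)"
      by (intro continuous_intros) (simp add: eb)
    ultimately show ?thesis
      using strict_linear_approximation[of e e "react_u a b" "\<lambda>u v. 1 - 2 * u - a * v * b / (u + b)\<^sup>2"
          "\<lambda>u v. - (a * u / (u + b))", OF e du dv _ _ \<eta>] that by blast
  qed
  have \<eta>R: "\<eta> / Rmax > 0" using \<eta> R by simp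
  obtain \<rho>2 where \<rho>2: "\<rho>2 > 0" "\<forall>u v u' v'. \<bar>u - e\<bar> < \<rho>2 \<and> \<bar>v - e\<bar> < \<rho>2 \<and> \<bar>u' - e\<bar> < \<rho>2 \<and> \<bar>v' - e\<bar> < \<rho>2 \<longrightarrow>
     \<bar>react_v 1 u v - react_v 1 u' v' - (e\<^sup>2 / e\<^sup>2) * (u - u') - (1 - 2 * e / e) * (v - v')\<bar>
       \<le> \<eta> / Rmax * (\<bar>u - u'\<bar> + \<bar>v - v'\<bar>)"
  proof -
    have "isCont (\<lambda>p. (snd p)\<^sup>2 / (fst p)\<^sup>2) (e, e)"
      by (intro continuous_intros) (use e in simp)
    moreover have "isCont (\<lambda>p. 1 - 2 * snd p / fst p) (e, e)"
      by (intro continuous_intros) (use e in simp)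
    ultimately show ?thesis
      using strict_linear_approximation[of e e "react_v 1" "\<lambda>u v. v\<^sup>2 / u\<^sup>2"
          "\<lambda>u v. 1 - 2 * v / u", OF e du' dv' _ _ \<eta>R] that by blast
  qed
  show ?thesis
  proof (rule that[of "min \<rho>1 \<rho>2"])
    show "min \<rho>1 \<rho>2 > 0" using \<rho>1 \<rho>2 by simp
    show "\<bar>react_u a b u v - react_u a b u' v' - A0 a b * (u - u') - B0 a b * (v - v')\<bar> \<le> \<eta> * (\<bar>u - u'\<bar> + \<bar>v - v'\<bar>)"
      if "\<bar>u - u_star a b\<bar> < min \<rho>1 \<rho>2" "\<bar>v - u_star a b\<bar> < min \<rho>1 \<rho>2"
        "\<bar>u' - u_star a b\<bar> < min \<rho>1 \<rho>2" "\<bar>v' - u_star a b\<bar> < min \<rho>1 \<rho>2" for u v u' v'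
      using \<rho>1(2)[unfolded val] that unfolding e_def by simp
    show "\<bar>react_v R u v - react_v R u' v' - R * (u - u') + R * (v - v')\<bar> \<le> \<eta> * (\<bar>u - u'\<bar> + \<bar>v - v'\<bar>)"
      if R': "0 < R" "R \<le> Rmax" and n: "\<bar>u - u_star a b\<bar> < min \<rho>1 \<rho>2" "\<bar>v - u_star a b\<bar> < min \<rho>1 \<rho>2"
        "\<bar>u' - u_star a b\<bar> < min \<rho>1 \<rho>2" "\<bar>v' - u_star a b\<bar> < min \<rho>1 \<rho>2" for R u v u' v'
    proof -
      have "\<bar>react_v 1 u v - react_v 1 u' v' - (u - u') + (v - v')\<bar> \<le> \<eta> / Rmax * (\<bar>u - u'\<bar> + \<bar>v - v'\<bar>)"
        using \<rho>2(2)[rule_format, of u v u' v'] n e by (simp add: e_def)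
      hence "R * \<bar>react_v 1 u v - react_v 1 u' v' - (u - u') + (v - v')\<bar> \<le> R * (\<eta> / Rmax * (\<bar>u - u'\<bar> + \<bar>v - v'\<bar>))"
        using R' by (intro mult_left_mono) auto
      also have "\<dots> = (R / Rmax) * (\<eta> * (\<bar>u - u'\<bar> + \<bar>v - v'\<bar>))" by simp
      also have "\<dots> \<le> 1 * (\<eta> * (\<bar>u - u'\<bar> + \<bar>v - v'\<bar>))"
        using R' \<eta> by (intro mult_right_mono) auto
      also have "R * \<bar>react_v 1 u v - react_v 1 u' v' - (u - u') + (v - v')\<bar>
        = \<bar>react_v R u v - react_v R u' v' - R * (u - u') + R * (v - v')\<bar>"
      proof -
        have "react_v R u v - react_v R u' v' - R * (u - u') + R * (v - v') =
          R * (react_v 1 u v - react_v 1 u' v' - (u - u') + (v - v'))"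
          by (simp add: react_v_def algebra_simps)
        thus ?thesis using R' by (simp add: abs_mult)
      qed
      finally show ?thesis by simp
    qed
  qed
qed

subsection \<open>Two nearby solutions separate\<close>

lemma quad_form_le:
  assumes "\<bar>h1\<bar> \<le> \<kappa>" "\<bar>h2\<bar> \<le> \<kappa>" "\<bar>h3\<bar> \<le> \<kappa>"
  shows "quad_form h1 h2 h3 p q \<le> 2 * \<kappa> * (p\<^sup>2 + q\<^sup>2)"
proof -
  have \<kappa>: "\<kappa> \<ge> 0" using assms(1) by linarith
  have "h1 * p\<^sup>2 \<le> \<kappa> * p\<^sup>2" "h3 * q\<^sup>2 \<le> \<kappa> * q\<^sup>2"
    using assms by (auto intro!: mult_right_mono)
  moreover have "h2 * (2 * (p * q)) \<le> \<kappa> * (p\<^sup>2 + q\<^sup>2)"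
  proof -
    have "0 \<le> (\<bar>p\<bar> - \<bar>q\<bar>)\<^sup>2" by simp
    hence "\<bar>2 * (p * q)\<bar> \<le> p\<^sup>2 + q\<^sup>2" by (simp add: power2_diff abs_mult)
    hence "\<bar>h2\<bar> * \<bar>2 * (p * q)\<bar> \<le> \<kappa> * (p\<^sup>2 + q\<^sup>2)"
      using assms \<kappa> by (intro mult_mono) auto
    thus ?thesis unfolding abs_mult[symmetric] by linarith
  qed
  ultimately show ?thesis by (simp add: quad_form_def algebra_simps)
qed

text \<open>Two solutions that stay in a small neighbourhood of the steady state and initially differ in a
  direction of positive \<open>quad_form\<close> cannot exist: by \<open>functional_growth\<close> the functional \<open>J\<close> of their difference
  grows exponentially, while the neighbourhood bounds it.\<close>

lemma no_confined_pair:
  fixes h1 h2 h3 :: "nat \<Rightarrow> real"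
  assumes l: "l > 0" and d: "d1 > 0" "d2 > 0" and \<sigma>: "\<sigma> > 0"
    and lyap: "\<And>n p q. n < N \<Longrightarrow>
       quad_rate (h1 n) (h2 n) (h3 n) p q ((A0 a b - d1 * wave l n) * p + B0 a b * q) (r * p + (- r - d2 * wave l n) * q)
       \<ge> 2 * \<sigma> * quad_form (h1 n) (h2 n) (h3 n) p q + (p\<^sup>2 + q\<^sup>2) / 2"
    and h: "\<And>n. n < N \<Longrightarrow> \<bar>h1 n\<bar> \<le> \<kappa> \<and> \<bar>h2 n\<bar> \<le> \<kappa> \<and> \<bar>h3 n\<bar> \<le> \<kappa>"
    and tail: "2 * \<bar>A0 a b\<bar> + \<bar>B0 a b + r\<bar> + 2 * \<bar>r\<bar> + 1 \<le> 2 * d1 * wave l N"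
       "2 * \<bar>A0 a b\<bar> + \<bar>B0 a b + r\<bar> + 2 * \<bar>r\<bar> + 1 \<le> 2 * d2 * wave l N"
    and \<eta>: "\<eta> > 0" "28 * (\<kappa> + 1) * \<eta> \<le> 1" and \<kappa>: "\<kappa> \<ge> 0"
    and approx_u: "\<And>u v u' v'. \<bar>u - e\<bar> < \<rho> \<Longrightarrow> \<bar>v - e\<bar> < \<rho> \<Longrightarrow> \<bar>u' - e\<bar> < \<rho> \<Longrightarrow> \<bar>v' - e\<bar> < \<rho> \<Longrightarrow>
       \<bar>react_u a b u v - react_u a b u' v' - A0 a b * (u - u') - B0 a b * (v - v')\<bar> \<le> \<eta> * (\<bar>u - u'\<bar> + \<bar>v - v'\<bar>)"
    and approx_v: "\<And>u v u' v'. \<bar>u - e\<bar> < \<rho> \<Longrightarrow> \<bar>v - e\<bar> < \<rho> \<Longrightarrow> \<bar>u' - e\<bar> < \<rho> \<Longrightarrow> \<bar>v' - e\<bar> < \<rho> \<Longrightarrow>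
       \<bar>react_v r u v - react_v r u' v' - r * (u - u') + r * (v - v')\<bar> \<le> \<eta> * (\<bar>u - u'\<bar> + \<bar>v - v'\<bar>)"
    and sol: "HT_solution d1 d2 a b r l u v" and sol': "HT_solution d1 d2 a b r l u' v'"
    and near: "\<And>x t. x \<in> {0..l * pi} \<Longrightarrow> t \<ge> 0 \<Longrightarrow> \<bar>u x t - e\<bar> < \<rho> \<and> \<bar>v x t - e\<bar> < \<rho>"
    and near': "\<And>x t. x \<in> {0..l * pi} \<Longrightarrow> t \<ge> 0 \<Longrightarrow> \<bar>u' x t - e\<bar> < \<rho> \<and> \<bar>v' x t - e\<bar> < \<rho>"
    and init: "\<And>x. x \<in> {0..l * pi} \<Longrightarrow> u' x 0 - u x 0 = p0 * cos_mode l k x"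
       "\<And>x. x \<in> {0..l * pi} \<Longrightarrow> v' x 0 - v x 0 = q0 * cos_mode l k x"
    and k: "k < N" "quad_form (h1 k) (h2 k) (h3 k) p0 q0 > 0"
  shows False
proof -
  obtain ut ux uxx vt vx vxx where
    u: "classical_neumann l u ut ux uxx" and v: "classical_neumann l v vt vx vxx" and
    pde: "\<And>x t. x\<in>{0<..<l * pi} \<Longrightarrow> t>0 \<Longrightarrow> ut x t - d1 * uxx x t = react_u a b (u x t) (v x t)"
      "\<And>x t. x\<in>{0<..<l * pi} \<Longrightarrow> t>0 \<Longrightarrow> vt x t - d2 * vxx x t = react_v r (u x t) (v x t)"
    using sol unfolding HT_solution_def by blast
  obtain ut' ux' uxx' vt' vx' vxx' where
    u': "classical_neumann l u' ut' ux' uxx'" and v': "classical_neumann l v' vt' vx' vxx'" and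
    pde': "\<And>x t. x\<in>{0<..<l * pi} \<Longrightarrow> t>0 \<Longrightarrow> ut' x t - d1 * uxx' x t = react_u a b (u' x t) (v' x t)"
      "\<And>x t. x\<in>{0<..<l * pi} \<Longrightarrow> t>0 \<Longrightarrow> vt' x t - d2 * vxx' x t = react_v r (u' x t) (v' x t)"
    using sol' unfolding HT_solution_def by blast
  define f where "f x t = u' x t - u x t" for x t
  define g where "g x t = v' x t - v x t" for x t
  define ft where "ft x t = ut' x t - ut x t" for x t
  define gt where "gt x t = vt' x t - vt x t" for x t
  define fx where "fx x t = ux' x t - ux x t" for x t
  define gx where "gx x t = vx' x t - vx x t" for x t
  define fxx where "fxx x t = uxx' x t - uxx x t" for x t
  define gxx where "gxx x t = vxx' x t - vxx x t" for x t
  have f: "classical_neumann l f ft fx fxx" and g: "classical_neumann l g gt gx gxx"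
    unfolding f_def[abs_def] ft_def[abs_def] fx_def[abs_def] fxx_def[abs_def]
      g_def[abs_def] gt_def[abs_def] gx_def[abs_def] gxx_def[abs_def]
    by (rule classical_neumann_diff[OF u' u], rule classical_neumann_diff[OF v' v])
  have cont: "continuous_on {0..l * pi} (\<lambda>x. z x t)"
    if "classical_neumann l z zt zx zxx" "t \<ge> 0" for z zt zx zxx t
  proof -
    have "continuous_on ({0..l * pi} \<times> {0..}) (\<lambda>(x, t). z x t)"
      using that by (simp add: classical_neumann_def)
    hence "continuous_on {0..l * pi} (\<lambda>x. (\<lambda>(x, t). z x t) (x, t))"
      by (rule continuous_on_compose2) (use that in \<open>auto intro!: continuous_intros\<close>)
    thus ?thesis by simp
  qed
  have lp: "l * pi > 0" using l by simp
  have bound_closure: "\<bar>F x\<bar> \<le> G x"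
    if "continuous_on {0..l * pi} F" "continuous_on {0..l * pi} G"
      "\<And>x. x \<in> {0<..<l * pi} \<Longrightarrow> \<bar>F x\<bar> \<le> G x" "x \<in> {0..l * pi}" for F G :: "real \<Rightarrow> real" and x
  proof -
    have cl: "closure {0<..<l * pi} = {0..l * pi}" using lp by simp
    have "G x - \<bar>F x\<bar> \<ge> 0"
      by (rule continuous_ge_on_closure[of "{0<..<l * pi}" "\<lambda>x. G x - \<bar>F x\<bar>"])
        (use that in \<open>auto simp: cl intro!: continuous_intros\<close>)
    thus ?thesis by simp
  qed
  have E1: "\<bar>ft x t - d1 * fxx x t - A0 a b * f x t - B0 a b * g x t\<bar> \<le> \<eta> * (\<bar>f x t\<bar> + \<bar>g x t\<bar>)"
    if t: "t > 0" and x: "x \<in> {0..l * pi}" for x t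
  proof (rule bound_closure[OF _ _ _ x])
    show "continuous_on {0..l * pi} (\<lambda>x. ft x t - d1 * fxx x t - A0 a b * f x t - B0 a b * g x t)"
      "continuous_on {0..l * pi} (\<lambda>x. \<eta> * (\<bar>f x t\<bar> + \<bar>g x t\<bar>))"
      using t by (auto intro!: continuous_intros cont[OF f] cont[OF g] classical_neumann_section(3,4)[OF f t])
    fix x assume x: "x \<in> {0<..<l * pi}"
    have "ft x t - d1 * fxx x t = react_u a b (u' x t) (v' x t) - react_u a b (u x t) (v x t)"
      using pde(1)[OF x t] pde'(1)[OF x t] by (simp add: ft_def fxx_def algebra_simps)
    thus "\<bar>ft x t - d1 * fxx x t - A0 a b * f x t - B0 a b * g x t\<bar> \<le> \<eta> * (\<bar>f x t\<bar> + \<bar>g x t\<bar>)"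
      using approx_u[of "u' x t" "v' x t" "u x t" "v x t"] near[of x t] near'[of x t] x t
      by (simp add: f_def g_def)
  qed
  have E2: "\<bar>gt x t - d2 * gxx x t - r * f x t + r * g x t\<bar> \<le> \<eta> * (\<bar>f x t\<bar> + \<bar>g x t\<bar>)"
    if t: "t > 0" and x: "x \<in> {0..l * pi}" for x t
  proof (rule bound_closure[OF _ _ _ x])
    show "continuous_on {0..l * pi} (\<lambda>x. gt x t - d2 * gxx x t - r * f x t + r * g x t)"
      "continuous_on {0..l * pi} (\<lambda>x. \<eta> * (\<bar>f x t\<bar> + \<bar>g x t\<bar>))"
      using t by (auto intro!: continuous_intros cont[OF f] cont[OF g] classical_neumann_section(3,4)[OF g t])
    fix x assume x: "x \<in> {0<..<l * pi}"
    have "gt x t - d2 * gxx x t = react_v r (u' x t) (v' x t) - react_v r (u x t) (v x t)"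
      using pde(2)[OF x t] pde'(2)[OF x t] by (simp add: gt_def gxx_def algebra_simps)
    thus "\<bar>gt x t - d2 * gxx x t - r * f x t + r * g x t\<bar> \<le> \<eta> * (\<bar>f x t\<bar> + \<bar>g x t\<bar>)"
      using approx_v[of "u' x t" "v' x t" "u x t" "v x t"] near[of x t] near'[of x t] x t
      by (simp add: f_def g_def)
  qed
  define p where "p n t = cos_coeff l n (\<lambda>x. f x t)" for n t
  define q where "q n t = cos_coeff l n (\<lambda>x. g x t)" for n t
  define p' where "p' n t = cos_coeff l n (\<lambda>x. ft x t)" for n t
  define q' where "q' n t = cos_coeff l n (\<lambda>x. gt x t)" for n t
  define W1 where "W1 t = integral {0..l * pi} (\<lambda>x. (f x t)\<^sup>2)" for t
  define W2 where "W2 t = integral {0..l * pi} (\<lambda>x. (g x t)\<^sup>2)" for t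
  define J where "J t = (\<Sum>n<N. quad_form (h1 n) (h2 n) (h3 n) (p n t) (q n t))
     + (\<Sum>n<N. (p n t)\<^sup>2 + (q n t)\<^sup>2) - W1 t - W2 t" for t
  define J' where "J' t = (\<Sum>n<N. quad_rate (h1 n) (h2 n) (h3 n) (p n t) (q n t) (p' n t) (q' n t))
     + (\<Sum>n<N. 2 * p n t * p' n t + 2 * q n t * q' n t)
     - 2 * integral {0..l * pi} (\<lambda>x. f x t * ft x t) - 2 * integral {0..l * pi} (\<lambda>x. g x t * gt x t)" for t
  have dp: "(p n has_real_derivative p' n t) (at t)" and dq: "(q n has_real_derivative q' n t) (at t)"
    if "t > 0" for n t
    unfolding p_def[abs_def] q_def[abs_def] p'_def q'_def
    by (rule classical_neumann_coeff(2)[OF l f that], rule classical_neumann_coeff(2)[OF l g that])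
  have cp: "continuous_on {0..} (p n)" "continuous_on {0..} (q n)" for n
    unfolding p_def[abs_def] q_def[abs_def]
    by (rule classical_neumann_coeff(1)[OF l f], rule classical_neumann_coeff(1)[OF l g])
  have cW: "continuous_on {0..} W1" "continuous_on {0..} W2"
    unfolding W1_def[abs_def] W2_def[abs_def]
    by (rule classical_neumann_square(1)[OF l f], rule classical_neumann_square(1)[OF l g])
  have dW1: "(W1 has_real_derivative 2 * integral {0..l * pi} (\<lambda>x. f x t * ft x t)) (at t)"
    and dW2: "(W2 has_real_derivative 2 * integral {0..l * pi} (\<lambda>x. g x t * gt x t)) (at t)"
    if "t > 0" for t
    unfolding W1_def[abs_def] W2_def[abs_def]
    by (rule classical_neumann_square(2)[OF l f that], rule classical_neumann_square(2)[OF l g that])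
  have "continuous_on {0..} J"
    unfolding J_def quad_form_def by (intro continuous_intros cp cW)
  moreover have "(J has_real_derivative J' t) (at t)" if t: "t > 0" for t
  proof -
    have 1: "((\<lambda>t. quad_form (h1 n) (h2 n) (h3 n) (p n t) (q n t)) has_real_derivative
        quad_rate (h1 n) (h2 n) (h3 n) (p n t) (q n t) (p' n t) (q' n t)) (at t)" for n
      unfolding quad_form_def quad_rate_def
      by (auto intro!: derivative_eq_intros dp[OF t] dq[OF t] simp: algebra_simps)
    have 2: "((\<lambda>t. (p n t)\<^sup>2 + (q n t)\<^sup>2) has_real_derivative 2 * p n t * p' n t + 2 * q n t * q' n t) (at t)" for n
      by (auto intro!: derivative_eq_intros dp[OF t] dq[OF t])
    show ?thesis unfolding J_def[abs_def] J'_def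
      by (intro DERIV_diff DERIV_add DERIV_sum 1 2 dW1 dW2 t)
  qed
  moreover have "J' t \<ge> (2 * \<sigma>) * J t" if t: "t > 0" for t
    unfolding J_def J'_def p_def q_def p'_def q'_def W1_def W2_def
    using classical_neumann_section[OF f t] classical_neumann_section[OF g t] E1[OF t] E2[OF t]
    by (intro functional_growth[OF l d, where \<eta> = \<eta> and \<kappa> = \<kappa> and R = r and A = "A0 a b" and B = "B0 a b"
        and f' = "\<lambda>x. fx x t" and f'' = "\<lambda>x. fxx x t" and g' = "\<lambda>x. gx x t" and g'' = "\<lambda>x. gxx x t"]
        lyap h tail \<eta> \<kappa>) (use \<sigma> in auto)
  moreover have "2 * \<sigma> > 0" using \<sigma> by simp
  moreover have "J 0 > 0"
  proof -
    have pn: "p n 0 = (if n = k then p0 else 0)" and qn: "q n 0 = (if n = k then q0 else 0)" for n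
    proof -
      have "p n 0 = cos_coeff l n (\<lambda>x. p0 * cos_mode l k x)"
        unfolding p_def f_def by (rule cos_coeff_cong) (rule init(1))
      thus "p n 0 = (if n = k then p0 else 0)"
        by (simp add: cos_coeff_mult continuous_intros cos_coeff_cos_mode[OF l])
      have "q n 0 = cos_coeff l n (\<lambda>x. q0 * cos_mode l k x)"
        unfolding q_def g_def by (rule cos_coeff_cong) (rule init(2))
      thus "q n 0 = (if n = k then q0 else 0)"
        by (simp add: cos_coeff_mult continuous_intros cos_coeff_cos_mode[OF l])
    qed
    have sq: "integral {0..l * pi} (\<lambda>x. (c * cos_mode l k x)\<^sup>2) = c\<^sup>2" for c
    proof -
      have "(\<lambda>x. (c * cos_mode l k x)\<^sup>2) = (\<lambda>x. c\<^sup>2 * (cos_mode l k x * cos_mode l k x))"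
        by (simp add: fun_eq_iff power2_eq_square)
      thus ?thesis using cos_coeff_cos_mode[OF l, of k k] by (simp add: cos_coeff_def)
    qed
    have "W1 0 = integral {0..l * pi} (\<lambda>x. (p0 * cos_mode l k x)\<^sup>2)"
      "W2 0 = integral {0..l * pi} (\<lambda>x. (q0 * cos_mode l k x)\<^sup>2)"
      unfolding W1_def W2_def f_def g_def by (auto intro!: integral_cong simp: init)
    hence "W1 0 = p0\<^sup>2" "W2 0 = q0\<^sup>2" by (simp_all only: sq)
    moreover have "(\<Sum>n<N. (p n 0)\<^sup>2 + (q n 0)\<^sup>2) = p0\<^sup>2 + q0\<^sup>2"
    proof -
      have "(\<Sum>n<N. (p n 0)\<^sup>2 + (q n 0)\<^sup>2) = (\<Sum>n<N. if n = k then p0\<^sup>2 + q0\<^sup>2 else 0)"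
        by (intro sum.cong) (auto simp: pn qn)
      thus ?thesis using k by simp
    qed
    moreover have "(\<Sum>n<N. quad_form (h1 n) (h2 n) (h3 n) (p n 0) (q n 0)) = quad_form (h1 k) (h2 k) (h3 k) p0 q0"
    proof -
      have "(\<Sum>n<N. quad_form (h1 n) (h2 n) (h3 n) (p n 0) (q n 0)) =
          (\<Sum>n<N. if n = k then quad_form (h1 k) (h2 k) (h3 k) p0 q0 else 0)"
        by (intro sum.cong) (auto simp: pn qn quad_form_def)
      thus ?thesis using k by simp
    qed
    ultimately show ?thesis using k(2) by (simp add: J_def)
  qed
  moreover have "J t \<le> 2 * \<kappa> * (8 * \<rho>\<^sup>2 * (l * pi))" if t: "t > 0" for t
  proof -
    have W: "integral {0..l * pi} (\<lambda>x. (z x)\<^sup>2) \<le> 4 * \<rho>\<^sup>2 * (l * pi)"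
      if "continuous_on {0..l * pi} z" "\<And>x. x \<in> {0..l * pi} \<Longrightarrow> \<bar>z x\<bar> \<le> 2 * \<rho>" for z :: "real \<Rightarrow> real"
    proof -
      have "integral {0..l * pi} (\<lambda>x. (z x)\<^sup>2) \<le> integral {0..l * pi} (\<lambda>x. 4 * \<rho>\<^sup>2)"
      proof (intro integral_le integrable_continuous_real continuous_intros that(1))
        fix x assume "x \<in> {0..l * pi}"
        from power_mono[OF that(2)[OF this], of 2] show "(z x)\<^sup>2 \<le> 4 * \<rho>\<^sup>2" by (simp add: power_mult_distrib)
      qed
      thus ?thesis using lp by (simp add: mult_ac)
    qed
    have "W1 t \<le> 4 * \<rho>\<^sup>2 * (l * pi)" unfolding W1_def
    proof (rule W)
      show "\<bar>f x t\<bar> \<le> 2 * \<rho>" if "x \<in> {0..l * pi}" for x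
        using near[OF that, of t] near'[OF that, of t] t unfolding f_def by linarith
    qed (use t in \<open>intro cont[OF f], simp\<close>)
    moreover have "W2 t \<le> 4 * \<rho>\<^sup>2 * (l * pi)" unfolding W2_def
    proof (rule W)
      show "\<bar>g x t\<bar> \<le> 2 * \<rho>" if "x \<in> {0..l * pi}" for x
        using near[OF that, of t] near'[OF that, of t] t unfolding g_def by linarith
    qed (use t in \<open>intro cont[OF g], simp\<close>)
    moreover have S: "(\<Sum>n<N. (p n t)\<^sup>2 + (q n t)\<^sup>2) \<le> W1 t + W2 t"
    proof -
      have "(\<Sum>n<N. (p n t)\<^sup>2) \<le> W1 t" "(\<Sum>n<N. (q n t)\<^sup>2) \<le> W2 t"
        unfolding p_def q_def W1_def W2_def using t by (auto intro!: cos_bessel l cont[OF f] cont[OF g])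
      thus ?thesis by (simp add: sum.distrib)
    qed
    ultimately have "(\<Sum>n<N. (p n t)\<^sup>2 + (q n t)\<^sup>2) \<le> 8 * \<rho>\<^sup>2 * (l * pi)" by linarith
    hence "2 * \<kappa> * (\<Sum>n<N. (p n t)\<^sup>2 + (q n t)\<^sup>2) \<le> 2 * \<kappa> * (8 * \<rho>\<^sup>2 * (l * pi))"
      using \<kappa> by (intro mult_left_mono) auto
    moreover have "(\<Sum>n<N. quad_form (h1 n) (h2 n) (h3 n) (p n t) (q n t)) \<le> (\<Sum>n<N. 2 * \<kappa> * ((p n t)\<^sup>2 + (q n t)\<^sup>2))"
      using h by (intro sum_mono quad_form_le) auto
    ultimately show ?thesis using S unfolding J_def by (simp add: sum_distrib_left)
  qed
  ultimately show False by (rule no_bounded_growth)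
qed

subsection \<open>Instability of all small solutions\<close>

text \<open>\<open>T n - 2 \<sigma>\<close> and \<open>\<sigma>\<^sup>2 - T n \<sigma> + D n\<close> are trace and determinant of the mode matrix minus \<open>\<sigma>\<close>.  For each mode
  they vanish for finitely many \<open>\<sigma>\<close> only, so a small \<open>\<sigma>\<close> avoids these values for the first \<open>N\<close> modes and
  keeps mode \<open>k\<close> unstable.\<close>

lemma exists_nonresonant_rate:
  fixes T D :: "nat \<Rightarrow> real"
  assumes "D k < 0 \<or> (T k > 0 \<and> D k > 0)"
  obtains \<sigma> where "\<sigma> > 0" "\<And>n. n < N \<Longrightarrow> T n - 2 * \<sigma> \<noteq> 0 \<and> \<sigma>\<^sup>2 - T n * \<sigma> + D n \<noteq> 0"
    "\<sigma>\<^sup>2 - T k * \<sigma> + D k < 0 \<or> (T k - 2 * \<sigma> > 0 \<and> \<sigma>\<^sup>2 - T k * \<sigma> + D k > 0)"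
proof -
  have lim: "((\<lambda>\<sigma>. \<sigma>\<^sup>2 - T n * \<sigma> + D n) \<longlongrightarrow> D n) (at_right 0)" for n
    by (auto intro!: tendsto_eq_intros)
  have limT: "((\<lambda>\<sigma>. T n - 2 * \<sigma>) \<longlongrightarrow> T n) (at_right 0)" for n
    by (auto intro!: tendsto_eq_intros)
  have pos: "\<forall>\<^sub>F \<sigma> in at_right (0::real). \<sigma> > 0" by (rule eventually_at_right_less)
  have ne: "\<forall>\<^sub>F \<sigma> in at_right 0. T n - 2 * \<sigma> \<noteq> 0 \<and> \<sigma>\<^sup>2 - T n * \<sigma> + D n \<noteq> 0" for n
  proof -
    have "\<forall>\<^sub>F \<sigma> in at_right 0. \<sigma> \<noteq> T n / 2" by (rule eventually_neq_at_within)
    moreover have "\<forall>\<^sub>F \<sigma> in at_right 0. \<sigma>\<^sup>2 - T n * \<sigma> + D n \<noteq> 0"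
    proof (cases "D n = 0")
      case False
      thus ?thesis by (intro tendsto_imp_eventually_ne[OF lim])
    next
      case True
      have "\<forall>\<^sub>F \<sigma> in at_right 0. \<sigma> \<noteq> T n" by (rule eventually_neq_at_within)
      with pos show ?thesis
      proof eventually_elim
        case (elim \<sigma>)
        have "\<sigma>\<^sup>2 - T n * \<sigma> + D n = \<sigma> * (\<sigma> - T n)" by (simp add: True power2_eq_square algebra_simps)
        with elim show ?case by simp
      qed
    qed
    ultimately show ?thesis by eventually_elim auto
  qed
  have "\<forall>\<^sub>F \<sigma> in at_right 0. \<forall>n\<in>{..<N}. T n - 2 * \<sigma> \<noteq> 0 \<and> \<sigma>\<^sup>2 - T n * \<sigma> + D n \<noteq> 0"
    by (intro eventually_ball_finite ballI ne) simp
  moreover have "\<forall>\<^sub>F \<sigma> in at_right 0. \<sigma>\<^sup>2 - T k * \<sigma> + D k < 0 \<or> (T k - 2 * \<sigma> > 0 \<and> \<sigma>\<^sup>2 - T k * \<sigma> + D k > 0)"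
    using assms
  proof
    assume "D k < 0"
    from order_tendstoD(2)[OF lim this] show ?thesis by eventually_elim simp
  next
    assume "T k > 0 \<and> D k > 0"
    hence "\<forall>\<^sub>F \<sigma> in at_right 0. T k - 2 * \<sigma> > 0" "\<forall>\<^sub>F \<sigma> in at_right 0. \<sigma>\<^sup>2 - T k * \<sigma> + D k > 0"
      using order_tendstoD(1)[OF limT] order_tendstoD(1)[OF lim] by blast+
    thus ?thesis by eventually_elim simp
  qed
  ultimately have "\<forall>\<^sub>F \<sigma> in at_right 0. \<sigma> > 0 \<and> (\<forall>n\<in>{..<N}. T n - 2 * \<sigma> \<noteq> 0 \<and> \<sigma>\<^sup>2 - T n * \<sigma> + D n \<noteq> 0) \<and>
      (\<sigma>\<^sup>2 - T k * \<sigma> + D k < 0 \<or> (T k - 2 * \<sigma> > 0 \<and> \<sigma>\<^sup>2 - T k * \<sigma> + D k > 0))"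
    using pos by eventually_elim blast
  from eventually_happens'[OF _ this] show ?thesis using that by (auto simp: trivial_limit_at_right_real)
qed

text \<open>Controls the effect of moving the parameters \<open>(r, l)\<close> on the Lyapunov inequality.\<close>

lemma quad_rate_bound:
  assumes h: "\<bar>h1\<bar> \<le> \<kappa>" "\<bar>h2\<bar> \<le> \<kappa>" "\<bar>h3\<bar> \<le> \<kappa>"
    and PQ: "\<bar>P\<bar> + \<bar>Q\<bar> \<le> s * (\<bar>p\<bar> + \<bar>q\<bar>)" and s: "8 * \<kappa> * s \<le> 1"
  shows "quad_rate h1 h2 h3 p q P Q \<ge> - ((p\<^sup>2 + q\<^sup>2) / 2)"
proof -
  have \<kappa>: "\<kappa> \<ge> 0" using h(1) by linarith
  have m: "\<bar>h * x * y\<bar> \<le> \<kappa> * (\<bar>x\<bar> * \<bar>y\<bar>)" if "\<bar>h\<bar> \<le> \<kappa>" for h x y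
    using that by (simp add: abs_mult mult.assoc mult_right_mono)
  have "\<bar>h1 * p * P + h2 * p * Q + h2 * q * P + h3 * q * Q\<bar>
      \<le> \<kappa> * (\<bar>p\<bar> * \<bar>P\<bar>) + \<kappa> * (\<bar>p\<bar> * \<bar>Q\<bar>) + \<kappa> * (\<bar>q\<bar> * \<bar>P\<bar>) + \<kappa> * (\<bar>q\<bar> * \<bar>Q\<bar>)"
    by (intro order_trans[OF abs_triangle_ineq] add_mono m h)
  also have "\<dots> = \<kappa> * ((\<bar>p\<bar> + \<bar>q\<bar>) * (\<bar>P\<bar> + \<bar>Q\<bar>))" by (simp add: algebra_simps)
  also have "\<dots> \<le> \<kappa> * ((\<bar>p\<bar> + \<bar>q\<bar>) * (s * (\<bar>p\<bar> + \<bar>q\<bar>)))"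
    using \<kappa> PQ by (intro mult_left_mono) auto
  also have "\<dots> = (8 * \<kappa> * s) * ((\<bar>p\<bar> + \<bar>q\<bar>)\<^sup>2 / 8)" by (simp add: power2_eq_square)
  also have "\<dots> \<le> 1 * ((\<bar>p\<bar> + \<bar>q\<bar>)\<^sup>2 / 8)" using s by (intro mult_right_mono) auto
  also have "(\<bar>p\<bar> + \<bar>q\<bar>)\<^sup>2 \<le> 2 * (p\<^sup>2 + q\<^sup>2)"
  proof -
    have "0 \<le> (\<bar>p\<bar> - \<bar>q\<bar>)\<^sup>2" by simp
    thus ?thesis by (simp add: power2_diff power2_sum)
  qed
  finally have le: "\<bar>h1 * p * P + h2 * p * Q + h2 * q * P + h3 * q * Q\<bar> \<le> (p\<^sup>2 + q\<^sup>2) / 4" by simp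
  have eq: "quad_rate h1 h2 h3 p q P Q = 2 * (h1 * p * P + h2 * p * Q + h2 * q * P + h3 * q * Q)"
    by (simp add: quad_rate_def algebra_simps)
  have half: "- (W / 2) \<le> 2 * Z" if "\<bar>Z\<bar> \<le> W / 4" for W Z :: real
    using that by linarith
  show ?thesis unfolding eq by (rule half[OF le])
qed

text \<open>The Lyapunov forms, the number \<open>N\<close> of low modes and the growth rate are chosen at the critical
  parameters; all inequalities are strict there and persist for the nearby parameters of the
  bifurcating solutions.  If one such solution were stable, a perturbation of its initial data
  along the unstable mode would yield a second solution near the steady state for all times,
  which \<open>no_confined_pair\<close> excludes.\<close>

theorem no_stable_bifurcation:
  assumes d: "d1 > 0" "d2 > 0" and l: "l > 0" and r: "r > 0" and b: "b > 0" and a: "a > 0"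
    and unst: "mode_det d1 d2 a b r (wave l k) < 0 \<or>
       (mode_trace d1 d2 a b r (wave l k) > 0 \<and> mode_det d1 d2 a b r (wave l k) > 0)"
    and bif: "bifurcation_solutions d1 d2 a b r l R \<Lambda> U V"
    and stable: "\<And>m. HT_stable d1 d2 a b (R m) (\<Lambda> m) (U m) (V m)"
  shows False
proof -
  define A where "A = A0 a b"
  define B where "B = B0 a b"
  \<comment> \<open>Dominates the tail condition of \<open>no_confined_pair\<close> for all parameters in \<open>(0, 2 r)\<close>.\<close>
  define C where "C = 2 * \<bar>A\<bar> + \<bar>B\<bar> + 6 * r + 1"
  obtain N where N: "k < N" "C < 2 * d1 * wave l N" "C < 2 * d2 * wave l N"
  proof -
    define K where "K = C / (2 * d1) + C / (2 * d2)"
    have C: "C > 0" using r by (simp add: C_def add_nonneg_pos)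
    obtain n :: nat where n: "real n > K * l\<^sup>2" using reals_Archimedean2 by blast
    define M where "M = n + k + 1"
    have "real M \<le> real M ^ 2" by (simp add: M_def power2_eq_square)
    moreover have "real n \<le> real M" by (simp add: M_def)
    ultimately have "K * l\<^sup>2 < real M ^ 2" using n by linarith
    hence K: "K < wave l M" using l by (simp add: wave_def pos_less_divide_eq)
    have "C / (2 * d1) < wave l M" "C / (2 * d2) < wave l M"
      using K C d unfolding K_def by (smt (verit) divide_pos_pos)+
    hence "C < 2 * d1 * wave l M" "C < 2 * d2 * wave l M"
      using d by (simp_all add: pos_divide_less_eq mult.commute)
    moreover have "k < M" by (simp add: M_def)
    ultimately show ?thesis using that by blast
  qed
  define T where "T n = mode_trace d1 d2 a b r (wave l n)" for n
  define D where "D n = mode_det d1 d2 a b r (wave l n)" for n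
  \<comment> \<open>The shift excludes that a low mode has a trace or determinant for which \<open>lyapunov_2x2\<close> fails.\<close>
  have "D k < 0 \<or> (T k > 0 \<and> D k > 0)" using unst by (simp add: T_def D_def)
  then obtain \<sigma> where \<sigma>: "\<sigma> > 0" "\<And>n. n < N \<Longrightarrow> T n - 2 * \<sigma> \<noteq> 0 \<and> \<sigma>\<^sup>2 - T n * \<sigma> + D n \<noteq> 0"
    "\<sigma>\<^sup>2 - T k * \<sigma> + D k < 0 \<or> (T k - 2 * \<sigma> > 0 \<and> \<sigma>\<^sup>2 - T k * \<sigma> + D k > 0)"
    using exists_nonresonant_rate[of D k T N] by blast
  define \<alpha> where "\<alpha> n = A - d1 * wave l n - \<sigma>" for n
  define \<delta> where "\<delta> n = - r - d2 * wave l n - \<sigma>" for n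
  have tau: "\<alpha> n + \<delta> n = T n - 2 * \<sigma>" for n
    by (simp add: \<alpha>_def \<delta>_def T_def mode_trace_def A_def algebra_simps)
  have det: "\<alpha> n * \<delta> n - B * r = \<sigma>\<^sup>2 - T n * \<sigma> + D n" for n
    by (simp add: \<alpha>_def \<delta>_def T_def D_def mode_trace_def mode_det_def A_def B_def power2_eq_square algebra_simps)
  have B: "B \<noteq> 0" using B0_neg[OF b a] by (simp add: B_def)
  have "\<exists>h. n < N \<longrightarrow>
     (\<forall>p q. quad_rate (fst h) (fst (snd h)) (snd (snd h)) p q (\<alpha> n * p + B * q) (r * p + \<delta> n * q) = p\<^sup>2 + q\<^sup>2) \<and>
     (n = k \<longrightarrow> (\<exists>p q. quad_form (fst h) (fst (snd h)) (snd (snd h)) p q > 0))" for n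
  proof (cases "n < N")
    case True
    obtain h1 h2 h3 where h:
      "\<And>p q. quad_rate h1 h2 h3 p q (\<alpha> n * p + B * q) (r * p + \<delta> n * q) = p\<^sup>2 + q\<^sup>2"
      "(\<alpha> n * \<delta> n - B * r < 0 \<and> B \<noteq> 0) \<or> (\<alpha> n + \<delta> n > 0 \<and> \<alpha> n * \<delta> n - B * r > 0) \<Longrightarrow> \<exists>p q. quad_form h1 h2 h3 p q > 0"
      using lyapunov_2x2[of "\<alpha> n" "\<delta> n" B r] \<sigma>(2)[OF True] unfolding tau det by blast
    have "n = k \<longrightarrow> (\<exists>p q. quad_form h1 h2 h3 p q > 0)"
      using h(2) \<sigma>(3) B unfolding tau det by blast
    with h(1) show ?thesis by (intro exI[of _ "(h1, h2, h3)"]) simp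
  qed simp
  then obtain H where H: "\<And>n. n < N \<longrightarrow>
     (\<forall>p q. quad_rate (fst (H n)) (fst (snd (H n))) (snd (snd (H n))) p q (\<alpha> n * p + B * q) (r * p + \<delta> n * q) = p\<^sup>2 + q\<^sup>2) \<and>
     (n = k \<longrightarrow> (\<exists>p q. quad_form (fst (H n)) (fst (snd (H n))) (snd (snd (H n))) p q > 0))"
    by metis
  define h1 where "h1 n = fst (H n)" for n
  define h2 where "h2 n = fst (snd (H n))" for n
  define h3 where "h3 n = snd (snd (H n))" for n
  have rate: "quad_rate (h1 n) (h2 n) (h3 n) p q (\<alpha> n * p + B * q) (r * p + \<delta> n * q) = p\<^sup>2 + q\<^sup>2"
    if "n < N" for n p q
    using H[of n] that by (simp add: h1_def h2_def h3_def)
  obtain p0 q0 where pq0: "quad_form (h1 k) (h2 k) (h3 k) p0 q0 > 0"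
    using H[of k] N(1) by (auto simp: h1_def h2_def h3_def)
  define \<kappa> where "\<kappa> = (\<Sum>n<N. \<bar>h1 n\<bar> + \<bar>h2 n\<bar> + \<bar>h3 n\<bar>)"
  have \<kappa>: "\<kappa> \<ge> 0" unfolding \<kappa>_def by (intro sum_nonneg) auto
  have h: "\<bar>h1 n\<bar> \<le> \<kappa> \<and> \<bar>h2 n\<bar> \<le> \<kappa> \<and> \<bar>h3 n\<bar> \<le> \<kappa>" if "n < N" for n
  proof -
    have "\<bar>h1 n\<bar> + \<bar>h2 n\<bar> + \<bar>h3 n\<bar> \<le> \<kappa>"
      unfolding \<kappa>_def using that by (intro member_le_sum) auto
    thus ?thesis by linarith
  qed
  define \<eta> where "\<eta> = 1 / (28 * (\<kappa> + 1))"
  have \<eta>: "\<eta> > 0" "28 * (\<kappa> + 1) * \<eta> \<le> 1" using \<kappa> by (simp_all add: \<eta>_def)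
  define e where "e = u_star a b"
  have r2: "2 * r > 0" using r by simp
  obtain \<rho> where \<rho>: "\<rho> > 0"
    "\<And>u v u' v'. \<bar>u - e\<bar> < \<rho> \<Longrightarrow> \<bar>v - e\<bar> < \<rho> \<Longrightarrow> \<bar>u' - e\<bar> < \<rho> \<Longrightarrow> \<bar>v' - e\<bar> < \<rho> \<Longrightarrow>
       \<bar>react_u a b u v - react_u a b u' v' - A0 a b * (u - u') - B0 a b * (v - v')\<bar> \<le> \<eta> * (\<bar>u - u'\<bar> + \<bar>v - v'\<bar>)"
    "\<And>R u v u' v'. 0 < R \<Longrightarrow> R \<le> 2 * r \<Longrightarrow>
       \<bar>u - e\<bar> < \<rho> \<Longrightarrow> \<bar>v - e\<bar> < \<rho> \<Longrightarrow> \<bar>u' - e\<bar> < \<rho> \<Longrightarrow> \<bar>v' - e\<bar> < \<rho> \<Longrightarrow>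
       \<bar>react_v R u v - react_v R u' v' - R * (u - u') + R * (v - v')\<bar> \<le> \<eta> * (\<bar>u - u'\<bar> + \<bar>v - v'\<bar>)"
    using reaction_approximation[OF b r2 \<eta>(1), of a] unfolding e_def by blast
  have pos: "\<And>m. R m > 0" "\<And>m. \<Lambda> m > 0" and R: "R \<longlonglongrightarrow> r" and \<Lambda>: "\<Lambda> \<longlonglongrightarrow> l"
    and entire: "\<And>m. HT_entire_solution d1 d2 a b (R m) (\<Lambda> m) (U m) (V m)"
    and small: "\<And>\<epsilon>. \<epsilon> > 0 \<Longrightarrow> \<forall>\<^sub>F m in sequentially. \<forall>x\<in>{0..\<Lambda> m * pi}. \<forall>t.
        \<bar>U m x t - e\<bar> < \<epsilon> \<and> \<bar>V m x t - e\<bar> < \<epsilon>"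
    using bif unfolding bifurcation_solutions_def e_def by blast+
  have wl: "(\<lambda>m. wave (\<Lambda> m) n) \<longlonglongrightarrow> wave l n" for n
    unfolding wave_def using l by (intro tendsto_intros \<Lambda>) auto
  define s where "s m n = (d1 + d2) * \<bar>wave (\<Lambda> m) n - wave l n\<bar> + 2 * \<bar>R m - r\<bar>" for m n
  have ev1: "\<forall>\<^sub>F m in sequentially. \<forall>n\<in>{..<N}. 8 * \<kappa> * s m n < 1"
  proof (intro eventually_ball_finite ballI)
    fix n
    have "(\<lambda>m. 8 * \<kappa> * s m n) \<longlonglongrightarrow> 8 * \<kappa> * ((d1 + d2) * \<bar>wave l n - wave l n\<bar> + 2 * \<bar>r - r\<bar>)"
      unfolding s_def by (intro tendsto_intros wl R)
    thus "\<forall>\<^sub>F m in sequentially. 8 * \<kappa> * s m n < 1" by (rule order_tendstoD(2)) simp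
  qed simp
  have ev2: "\<forall>\<^sub>F m in sequentially. R m < 2 * r" using R r by (intro order_tendstoD(2)) auto
  have ev3: "\<forall>\<^sub>F m in sequentially. C < 2 * d1 * wave (\<Lambda> m) N"
    "\<forall>\<^sub>F m in sequentially. C < 2 * d2 * wave (\<Lambda> m) N"
    by (rule order_tendstoD(1)[OF tendsto_mult[OF tendsto_const wl]], rule N)+
  have \<rho>2: "\<rho> / 2 > 0" using \<rho>(1) by simp
  have ev: "\<forall>\<^sub>F m in sequentially. (\<forall>n\<in>{..<N}. 8 * \<kappa> * s m n < 1) \<and> R m < 2 * r \<and> C < 2 * d1 * wave (\<Lambda> m) N \<and>
      C < 2 * d2 * wave (\<Lambda> m) N \<and> (\<forall>x\<in>{0..\<Lambda> m * pi}. \<forall>t. \<bar>U m x t - e\<bar> < \<rho> / 2 \<and> \<bar>V m x t - e\<bar> < \<rho> / 2)"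
    using ev1 ev2 ev3 small[OF \<rho>2] by eventually_elim blast
  from eventually_happens'[OF sequentially_bot ev] obtain m where
    mm: "(\<forall>n\<in>{..<N}. 8 * \<kappa> * s m n < 1) \<and> R m < 2 * r \<and> C < 2 * d1 * wave (\<Lambda> m) N \<and>
      C < 2 * d2 * wave (\<Lambda> m) N \<and> (\<forall>x\<in>{0..\<Lambda> m * pi}. \<forall>t. \<bar>U m x t - e\<bar> < \<rho> / 2 \<and> \<bar>V m x t - e\<bar> < \<rho> / 2)" ..
  have m: "\<And>n. n < N \<Longrightarrow> 8 * \<kappa> * s m n < 1" "R m < 2 * r" "C < 2 * d1 * wave (\<Lambda> m) N"
      "C < 2 * d2 * wave (\<Lambda> m) N"
      "\<And>x t. x\<in>{0..\<Lambda> m * pi} \<Longrightarrow> \<bar>U m x t - e\<bar> < \<rho> / 2 \<and> \<bar>V m x t - e\<bar> < \<rho> / 2"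
    using mm by blast+
  define L where "L = \<Lambda> m"
  have L: "L > 0" using pos by (simp add: L_def)
  have lyap: "quad_rate (h1 n) (h2 n) (h3 n) p q ((A0 a b - d1 * wave L n) * p + B0 a b * q) (R m * p + (- R m - d2 * wave L n) * q)
       \<ge> 2 * \<sigma> * quad_form (h1 n) (h2 n) (h3 n) p q + (p\<^sup>2 + q\<^sup>2) / 2" if n: "n < N" for n p q
  proof -
    define y where "y = wave L n - wave l n"
    define c where "c = R m - r"
    define P where "P = - d1 * y * p"
    define Q where "Q = c * p + (- c - d2 * y) * q"
    have "quad_rate (h1 n) (h2 n) (h3 n) p q ((A0 a b - d1 * wave L n) * p + B0 a b * q) (R m * p + (- R m - d2 * wave L n) * q)
      = quad_rate (h1 n) (h2 n) (h3 n) p q (\<alpha> n * p + B * q) (r * p + \<delta> n * q)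
        + 2 * \<sigma> * quad_form (h1 n) (h2 n) (h3 n) p q + quad_rate (h1 n) (h2 n) (h3 n) p q P Q"
      by (simp add: quad_rate_def quad_form_def P_def Q_def y_def c_def \<alpha>_def \<delta>_def A_def B_def
          power2_eq_square algebra_simps)
    moreover have "quad_rate (h1 n) (h2 n) (h3 n) p q P Q \<ge> - ((p\<^sup>2 + q\<^sup>2) / 2)"
    proof (rule quad_rate_bound)
      show "8 * \<kappa> * s m n \<le> 1" using m(1)[OF n] by simp
      have "\<bar>P\<bar> = d1 * \<bar>y\<bar> * \<bar>p\<bar>" using d by (simp add: P_def abs_mult)
      moreover have "\<bar>Q\<bar> \<le> \<bar>c\<bar> * \<bar>p\<bar> + (\<bar>c\<bar> + d2 * \<bar>y\<bar>) * \<bar>q\<bar>"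
      proof -
        have "\<bar>Q\<bar> \<le> \<bar>c * p\<bar> + \<bar>(- c - d2 * y) * q\<bar>" unfolding Q_def by (rule abs_triangle_ineq)
        also have "\<dots> \<le> \<bar>c\<bar> * \<bar>p\<bar> + (\<bar>c\<bar> + d2 * \<bar>y\<bar>) * \<bar>q\<bar>"
        proof -
          have "\<bar>- c - d2 * y\<bar> \<le> \<bar>c\<bar> + d2 * \<bar>y\<bar>"
            using abs_triangle_ineq4[of "- c" "d2 * y"] d by (simp add: abs_mult)
          thus ?thesis unfolding abs_mult by (intro add_mono mult_right_mono) auto
        qed
        finally show ?thesis .
      qed
      moreover have "0 \<le> d1 * \<bar>y\<bar> * \<bar>q\<bar>" "0 \<le> d2 * \<bar>y\<bar> * \<bar>p\<bar>" "0 \<le> \<bar>c\<bar> * \<bar>p\<bar>" "0 \<le> \<bar>c\<bar> * \<bar>q\<bar>"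
        using d by auto
      moreover have "s m n * (\<bar>p\<bar> + \<bar>q\<bar>) = d1 * \<bar>y\<bar> * \<bar>p\<bar> + d1 * \<bar>y\<bar> * \<bar>q\<bar> + d2 * \<bar>y\<bar> * \<bar>p\<bar>
          + d2 * \<bar>y\<bar> * \<bar>q\<bar> + 2 * (\<bar>c\<bar> * \<bar>p\<bar>) + 2 * (\<bar>c\<bar> * \<bar>q\<bar>)"
        unfolding s_def L_def[symmetric] y_def[symmetric] c_def[symmetric] by (simp add: algebra_simps)
      moreover have "(\<bar>c\<bar> + d2 * \<bar>y\<bar>) * \<bar>q\<bar> = \<bar>c\<bar> * \<bar>q\<bar> + d2 * \<bar>y\<bar> * \<bar>q\<bar>"
        by (simp add: algebra_simps)
      ultimately show "\<bar>P\<bar> + \<bar>Q\<bar> \<le> s m n * (\<bar>p\<bar> + \<bar>q\<bar>)" by linarith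
    qed (use h[OF n] in auto)
    moreover define W where "W = p\<^sup>2 + q\<^sup>2"
    ultimately show ?thesis using rate[OF n, of p q] unfolding W_def[symmetric] by linarith
  qed
  have tail: "2 * \<bar>A0 a b\<bar> + \<bar>B0 a b + R m\<bar> + 2 * \<bar>R m\<bar> + 1 \<le> C"
    using pos(1)[of m] m(2) unfolding C_def A_def B_def by linarith
  have solU: "HT_solution d1 d2 a b (R m) L (U m) (V m)"
  proof -
    have "HT_solution d1 d2 a b (R m) (\<Lambda> m) (\<lambda>x t. U m x (t + 0)) (\<lambda>x t. V m x (t + 0))"
      using entire[of m] unfolding HT_entire_solution_def by blast
    thus ?thesis by (simp add: L_def)
  qed
  have init_cont: "continuous_on {0..L * pi} (\<lambda>x. z x 0)"
    if "classical_neumann L z zt zx zxx" for z zt zx zxx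
  proof -
    have "continuous_on ({0..L * pi} \<times> {0..}) (\<lambda>(x, t). z x t)"
      using that by (simp add: classical_neumann_def)
    hence "continuous_on {0..L * pi} (\<lambda>x. (\<lambda>(x, t). z x t) (x, 0))"
      by (rule continuous_on_compose2) (auto intro!: continuous_intros)
    thus ?thesis by simp
  qed
  have cU: "continuous_on {0..L * pi} (\<lambda>x. U m x 0)" "continuous_on {0..L * pi} (\<lambda>x. V m x 0)"
    using solU init_cont unfolding HT_solution_def by blast+
  from stable[of m, unfolded HT_stable_def, folded L_def, THEN spec, THEN mp, OF \<rho>2]
  obtain \<delta>' where \<delta>': "\<delta>' > 0 \<and> (\<forall>p q.
        continuous_on {0..L * pi} p \<and> continuous_on {0..L * pi} q \<and>
        (\<forall>x\<in>{0..L * pi}. \<bar>p x - U m x 0\<bar> < \<delta>' \<and> \<bar>q x - V m x 0\<bar> < \<delta>') \<longrightarrow>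
        (\<exists>U' V'. HT_solution d1 d2 a b (R m) L U' V' \<and>
           (\<forall>x\<in>{0..L * pi}. U' x 0 = p x \<and> V' x 0 = q x) \<and>
           (\<forall>t\<ge>0. \<exists>s. \<forall>x\<in>{0..L * pi}.
              \<bar>U' x t - U m x s\<bar> < \<rho> / 2 \<and> \<bar>V' x t - V m x s\<bar> < \<rho> / 2)))" ..
  define K where "K = 1 / sqrt (if k = 0 then L * pi else L * pi / 2)"
  have K: "\<bar>cos_mode L k x\<bar> \<le> K" "K \<ge> 0" for x
    using L unfolding K_def cos_mode_def by (auto simp: divide_right_mono)
  define c where "c = \<delta>' / ((\<bar>p0\<bar> + \<bar>q0\<bar> + 1) * (K + 1))"
  have den: "(\<bar>p0\<bar> + \<bar>q0\<bar> + 1) * (K + 1) > 0" using K(2) by (intro mult_pos_pos) auto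
  have c: "c > 0" unfolding c_def using \<delta>'[THEN conjunct1] den by (rule divide_pos_pos)
  have pert: "\<bar>c * z * cos_mode L k x\<bar> < \<delta>'" if "\<bar>z\<bar> \<le> \<bar>p0\<bar> + \<bar>q0\<bar>" for z x
  proof -
    have "\<bar>z\<bar> * \<bar>cos_mode L k x\<bar> \<le> (\<bar>p0\<bar> + \<bar>q0\<bar>) * K" using that K by (intro mult_mono) auto
    also have "\<dots> < (\<bar>p0\<bar> + \<bar>q0\<bar> + 1) * (K + 1)" using K(2) by (simp add: algebra_simps add_nonneg_pos)
    finally have "c * (\<bar>z\<bar> * \<bar>cos_mode L k x\<bar>) < c * ((\<bar>p0\<bar> + \<bar>q0\<bar> + 1) * (K + 1))"
      using c by (rule mult_strict_left_mono)
    also have "\<dots> = \<delta>'" unfolding c_def by (rule nonzero_divide_eq_eq[THEN iffD1, OF _ refl, symmetric]) (rule less_imp_neq[OF den, symmetric])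
    finally show ?thesis using c by (simp add: abs_mult mult.assoc)
  qed
  have "\<exists>U' V'. HT_solution d1 d2 a b (R m) L U' V' \<and>
           (\<forall>x\<in>{0..L * pi}. U' x 0 = U m x 0 + c * p0 * cos_mode L k x \<and> V' x 0 = V m x 0 + c * q0 * cos_mode L k x) \<and>
           (\<forall>t\<ge>0. \<exists>s. \<forall>x\<in>{0..L * pi}. \<bar>U' x t - U m x s\<bar> < \<rho> / 2 \<and> \<bar>V' x t - V m x s\<bar> < \<rho> / 2)"
    by (rule \<delta>'[THEN conjunct2, THEN spec, THEN spec, THEN mp]) (auto intro!: continuous_intros cU pert)
  then obtain U' V' where U': "HT_solution d1 d2 a b (R m) L U' V'"
    "\<And>x. x\<in>{0..L * pi} \<Longrightarrow> U' x 0 = U m x 0 + c * p0 * cos_mode L k x \<and> V' x 0 = V m x 0 + c * q0 * cos_mode L k x"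
    "\<And>t. t \<ge> 0 \<Longrightarrow> \<exists>s. \<forall>x\<in>{0..L * pi}. \<bar>U' x t - U m x s\<bar> < \<rho> / 2 \<and> \<bar>V' x t - V m x s\<bar> < \<rho> / 2"
    by blast
  have near: "\<bar>U m x t - e\<bar> < \<rho> \<and> \<bar>V m x t - e\<bar> < \<rho>" if "x \<in> {0..L * pi}" "t \<ge> 0" for x t
    using m(5)[of x t] that \<rho>(1) unfolding L_def by (smt (verit) field_sum_of_halves)
  have near': "\<bar>U' x t - e\<bar> < \<rho> \<and> \<bar>V' x t - e\<bar> < \<rho>" if x: "x \<in> {0..L * pi}" and t: "t \<ge> 0" for x t
  proof -
    obtain s where "\<bar>U' x t - U m x s\<bar> < \<rho> / 2 \<and> \<bar>V' x t - V m x s\<bar> < \<rho> / 2" using U'(3)[OF t] x by blast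
    with m(5)[of x s] x show ?thesis unfolding L_def by (smt (verit) field_sum_of_halves)
  qed
  have "quad_form (h1 k) (h2 k) (h3 k) (c * p0) (c * q0) = c\<^sup>2 * quad_form (h1 k) (h2 k) (h3 k) p0 q0"
    by (simp add: quad_form_def power2_eq_square algebra_simps)
  hence quad: "quad_form (h1 k) (h2 k) (h3 k) (c * p0) (c * q0) > 0" using pq0 c by simp
  show False
  proof (rule no_confined_pair[OF L d \<sigma>(1) lyap h _ _ \<eta> \<kappa> \<rho>(2) \<rho>(3)[OF pos(1)] solU U'(1) near near' _ _ N(1) quad])
    show "2 * \<bar>A0 a b\<bar> + \<bar>B0 a b + R m\<bar> + 2 * \<bar>R m\<bar> + 1 \<le> 2 * d1 * wave L N"
      "2 * \<bar>A0 a b\<bar> + \<bar>B0 a b + R m\<bar> + 2 * \<bar>R m\<bar> + 1 \<le> 2 * d2 * wave L N"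
      using tail m(3,4) unfolding L_def by linarith+
    show "R m \<le> 2 * r" using m(2) by simp
  qed (use U'(2) in auto)
qed

section \<open>The marginally stable case\<close>

text \<open>At \<open>r = A0\<close> the two critical wave numbers are the roots \<open>x_minus\<close> and \<open>x_plus\<close> of the determinant.  Both are
  positive and distinct: their sum \<open>(d2 - d1) A0 / (d1 d2)\<close> yields \<open>d1 < d2\<close>, and the positive discriminant
  places \<open>a\<close> strictly between \<open>a_minus\<close> and \<open>a_plus\<close>, which are real and distinct only if \<open>b\<close> is below its critical value.
  Consecutive critical modes \<open>j\<close> and \<open>j + 1\<close> amount to \<open>M1 = j + 1\<close> and \<open>M2 = j\<close>.\<close>

lemma marginal_A6':
  assumes d: "d1 > 0" "d2 > 0" and l: "l > 0" and b: "0 < b" "b < 1" and a: "a > 0"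
    and A: "A0 a b > 0" and j: "j \<ge> 1"
    and Dj: "mode_det d1 d2 a b (A0 a b) (wave l j) = 0"
    and Dk: "mode_det d1 d2 a b (A0 a b) (wave l (j + 1)) = 0"
  shows "cond_A6' d1 d2 a b l"
proof -
  define A B where "A = A0 a b" and "B = B0 a b"
  define x y where "x = wave l j" and "y = wave l (j + 1)"
  have A': "A > 0" using A by (simp add: A_def)
  have xy: "0 < x" "x < y"
    using wave_less_iff[OF l, of 0 j] wave_less_iff[OF l, of j "j + 1"] j by (simp_all add: x_def y_def)
  have fact: "mode_det d1 d2 a b A z = d1 * d2 * (z - x) * (z - y)" for z
    unfolding x_def y_def A_def by (rule mode_det_factor[OF Dj Dk]) (use xy in \<open>simp add: x_def y_def\<close>)
  have prod: "d1 * d2 * (x * y) = - (A * (A + B))"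
    using fact[of 0] by (simp add: mode_det_def A_def B_def algebra_simps)
  have sum: "d1 * d2 * (x + y) = (d2 - d1) * A"
    using fact[of 1] prod by (simp add: mode_det_def A_def B_def algebra_simps)
  have d12: "d1 < d2"
  proof -
    have "0 < (d2 - d1) * A" unfolding sum[symmetric] using d xy by simp
    thus ?thesis using A' by (simp add: zero_less_mult_iff)
  qed
  have disc: "(d1 + d2)\<^sup>2 * A\<^sup>2 + 4 * d1 * d2 * A * B = (d1 * d2 * (y - x))\<^sup>2"
  proof -
    have "(d1 * d2 * (y - x))\<^sup>2 = (d1 * d2 * (x + y))\<^sup>2 - 4 * (d1 * d2) * (d1 * d2 * (x * y))"
      by (simp add: power2_eq_square algebra_simps)
    also have "\<dots> = (d1 + d2)\<^sup>2 * A\<^sup>2 + 4 * d1 * d2 * A * B"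
      unfolding sum prod by (simp add: power2_eq_square algebra_simps)
    finally show ?thesis by simp
  qed
  have rt: "sqrt ((d1 + d2)\<^sup>2 * A\<^sup>2 + 4 * d1 * d2 * A * B) = d1 * d2 * (y - x)"
    unfolding disc using d xy by (simp add: abs_of_pos)
  have xm: "x_minus d1 d2 a b = x" and xp: "x_plus d1 d2 a b = y"
    unfolding x_minus_def x_plus_def A_def[symmetric] B_def[symmetric] rt sum[symmetric]
    using d by (simp_all add: field_simps)
  have sx: "sqrt x = real j / l" and sy: "sqrt y = real (j + 1) / l"
    using l by (simp_all add: x_def y_def wave_def real_sqrt_divide)
  have lm: "l_minus d1 d2 a b n = real n * l / real j" and lp: "l_plus d1 d2 a b n = real n * l / real (j + 1)" for n
    unfolding l_minus_def l_plus_def xm xp sx sy by simp_all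
  have ex1: "\<exists>M1 M2. l_minus d1 d2 a b (M1 - 1) \<le> l \<and> l < l_minus d1 d2 a b M1 \<and>
        l_plus d1 d2 a b M2 < l \<and> l \<le> l_plus d1 d2 a b (M2 + 1) \<and> M1 > M2"
    unfolding lm lp using l j by (intro exI[of _ "j + 1"] exI[of _ j]) (simp add: field_simps)
  have ex2: "\<exists>n::nat. l = real n * sqrt (1 / x_minus d1 d2 a b) \<or> l = real n * sqrt (1 / x_plus d1 d2 a b)"
    unfolding xm using l j by (intro exI[of _ j]) (simp add: real_sqrt_divide sx)
  \<comment> \<open>With \<open>A0 = e (a - S) / (b + e)\<close> and \<open>B0 = - a e / (b + e)\<close> the positive discriminant becomes
    \<open>s S < t a\<close>; squaring gives a quadratic inequality in \<open>a\<close>, whose roots are \<open>a_minus\<close> and \<open>a_plus\<close>.\<close>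
  define s where "s = (d1 + d2)\<^sup>2"
  define t where "t = (d1 - d2)\<^sup>2"
  have st: "s - t = 4 * d1 * d2" by (simp add: s_def t_def power2_eq_square algebra_simps)
  have t: "t > 0" using d12 by (simp add: t_def)
  have ts: "t < s" using st d by (metis diff_gt_0_iff_gt mult_pos_pos zero_less_numeral)
  have p4: "(d1 + d2) ^ 4 = s\<^sup>2" "(d1 - d2) ^ 4 = t\<^sup>2" by (simp_all add: s_def t_def flip: power_mult)
  define S where "S = sqrt ((a + b - 1)\<^sup>2 + 4 * b)"
  have S: "S \<ge> 0" "S\<^sup>2 = (a + b - 1)\<^sup>2 + 4 * b" using b by (simp_all add: S_def)
  define e where "e = u_star a b"
  have e: "e > 0" "1 - b - 2 * e = a - S"
    using u_star_pos[OF b(1)] by (simp_all add: e_def u_star_def S_def field_simps)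
  have "0 < A * (s * A + 4 * d1 * d2 * B)"
  proof -
    have "A * (s * A + 4 * d1 * d2 * B) = (d1 * d2 * (y - x))\<^sup>2"
      unfolding disc[symmetric] s_def by (simp add: power2_eq_square algebra_simps)
    thus ?thesis using d xy by simp
  qed
  hence "0 < s * A + 4 * d1 * d2 * B" using A' by (simp add: zero_less_mult_iff)
  also have "s * A + 4 * d1 * d2 * B = (e / (b + e)) * (s * (a - S) - (s - t) * a)"
    unfolding st A_def B_def A0_def B0_def e_def[symmetric] e(2)
    by (simp add: algebra_simps diff_divide_distrib)
  finally have "0 < s * (a - S) - (s - t) * a"
    by (rule zero_less_mult_pos) (use e b in simp)
  hence "s * S < t * a" by (simp add: algebra_simps)
  hence "(s * S)\<^sup>2 < (t * a)\<^sup>2" using S(1) ts t by (intro power_strict_mono) auto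
  hence ineq: "s\<^sup>2 * ((a + b - 1)\<^sup>2 + 4 * b) < t\<^sup>2 * a\<^sup>2" by (simp add: power_mult_distrib S(2))
  \<comment> \<open>\<open>P\<close> and \<open>E\<close> are the denominator and the radicand in the formulas for \<open>a_minus\<close> and \<open>a_plus\<close>.\<close>
  define P where "P = s\<^sup>2 - t\<^sup>2"
  have P: "P > 0" unfolding P_def using ts t by (simp add: power_strict_mono)
  define E where "E = (b + 1)\<^sup>2 * t\<^sup>2 - 4 * b * s\<^sup>2"
  have sqr: "(P * a - (1 - b) * s\<^sup>2)\<^sup>2 < s\<^sup>2 * E"
  proof -
    have "s\<^sup>2 * E - (P * a - (1 - b) * s\<^sup>2)\<^sup>2 = P * (t\<^sup>2 * a\<^sup>2 - s\<^sup>2 * ((a + b - 1)\<^sup>2 + 4 * b))"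
      unfolding P_def E_def by (simp add: power2_eq_square algebra_simps)
    also have "\<dots> > 0" using P ineq by simp
    finally show ?thesis by simp
  qed
  have E: "E > 0"
  proof -
    have "0 < s\<^sup>2 * E" using sqr zero_le_power2[of "P * a - (1 - b) * s\<^sup>2"] by linarith
    thus ?thesis by (simp add: zero_less_mult_iff)
  qed
  have "\<bar>P * a - (1 - b) * s\<^sup>2\<bar> < s * sqrt E"
  proof (rule power2_less_imp_less)
    show "\<bar>P * a - (1 - b) * s\<^sup>2\<bar>\<^sup>2 < (s * sqrt E)\<^sup>2" using sqr E by (simp add: power_mult_distrib)
    show "0 \<le> s * sqrt E" using ts t E by simp
  qed
  hence am: "a_minus d1 d2 b < a" and ap: "a < a_plus d1 d2 b"
    unfolding a_minus_def a_plus_def p4 s_def[symmetric] P_def[symmetric] E_def[symmetric]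
    using P by (simp_all add: pos_divide_less_eq pos_less_divide_eq abs_less_iff algebra_simps)
  \<comment> \<open>For \<open>z = sqrt b\<close>, \<open>E > 0\<close> reads \<open>t z\<^sup>2 - 2 s z + t > 0\<close>; as \<open>z < 1\<close>, it lies below the smaller root,
    whose square is \<open>b_crit\<close>.\<close>
  have bc: "b < b_crit d1 d2"
  proof -
    define z where "z = sqrt b"
    have z: "0 \<le> z" "z < 1" "z\<^sup>2 = b" using b by (simp_all add: z_def)
    have "(2 * z * s)\<^sup>2 < ((1 + b) * t)\<^sup>2"
      using E by (simp add: E_def power_mult_distrib z(3) add.commute mult_ac)
    hence "2 * z * s < (1 + b) * t" by (rule power2_less_imp_less) (use b t in auto)
    hence "2 * z * s < (1 + z\<^sup>2) * t" by (simp add: z(3))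
    hence "0 < t * ((1 + z\<^sup>2) * t - 2 * z * s)" using t by simp
    hence "s\<^sup>2 - t\<^sup>2 < (s - t * z)\<^sup>2" by (simp add: power2_eq_square algebra_simps)
    moreover have "t * z < s" using mult_strict_left_mono[OF z(2) t] ts by simp
    ultimately have "sqrt P < s - t * z"
      unfolding P_def[symmetric] by (intro real_less_lsqrt) (use P in auto)
    hence "z < (s - sqrt P) / t" using t by (simp add: pos_less_divide_eq algebra_simps)
    hence "z\<^sup>2 < ((s - sqrt P) / t)\<^sup>2" using z(1) by (intro power_strict_mono) auto
    thus ?thesis unfolding b_crit_def p4 s_def[symmetric] P_def[symmetric]
      by (simp add: z(3) power_divide)
  qed
  show ?thesis unfolding cond_A6'_def using d12 b bc am ap ex1 ex2 by blast
qed

text \<open>If \<open>i\<close> were positive, the homogeneous mode would be unstable, having positive trace and determinant;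
  if a mode lay strictly between \<open>j\<close> and \<open>k\<close>, its determinant would be negative.  Stability of the
  bifurcating solutions therefore forces \<open>i = 0\<close> and \<open>k = j + 1\<close>.\<close>

theorem theorem2p8:
  fixes d1 d2 a b r l :: real and N1 N2 :: nat
  assumes "d1 > 0" "d2 > 0" "r > 0" "l > 0" "0 < b" "b < 1"
    and "a > (b + 1)^2 / (2 * (1 - b))"
    and "N2 \<ge> 1"
    and "l \<in> L_TTH d1 d2 a b N1 N2"
  shows "\<forall>i j k. i \<le> N1 \<and> N1 < j \<and> j < k \<and> k \<le> N2 \<and>
           r = r_H d1 d2 a b i l \<and> r = r_T d1 d2 a b j l \<and> r = r_T d1 d2 a b k l \<longrightarrow>
           Hopf_double_Turing_bifurcation d1 d2 a b r l \<and>
           (\<forall>R \<Lambda> U V.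
              bifurcation_solutions d1 d2 a b r l R \<Lambda> U V \<and>
              (\<forall>m. HT_stable d1 d2 a b (R m) (\<Lambda> m) (U m) (V m)) \<longrightarrow>
              (cond_A5' d1 d2 a b l \<or> cond_A6' d1 d2 a b l) \<and>
              r = r_H d1 d2 a b 0 l \<and> r = r_T d1 d2 a b j l \<and> r = r_T d1 d2 a b k l \<and>
              r = A0 a b)"
proof (intro allI impI)
  fix i j k
  assume ijk: "i \<le> N1 \<and> N1 < j \<and> j < k \<and> k \<le> N2 \<and>
    r = r_H d1 d2 a b i l \<and> r = r_T d1 d2 a b j l \<and> r = r_T d1 d2 a b k l"
  note d = assms(1,2) and r = assms(3) and l = assms(4) and b = assms(5,6)
  have a: "a > 0"
  proof -
    have "0 < (b + 1)^2 / (2 * (1 - b))" using b by (intro divide_pos_pos) auto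
    thus ?thesis using assms(7) by linarith
  qed
  have ij: "i < j" and jk: "j < k" using ijk by auto
  have Ti: "mode_trace d1 d2 a b r (wave l i) = 0" using ijk r_H_iff by blast
  have Dj: "mode_det d1 d2 a b r (wave l j) = 0" and Dk: "mode_det d1 d2 a b r (wave l k) = 0"
    using ijk r_T_iff[OF b(1) d(1)] by blast+
  have bif: "Hopf_double_Turing_bifurcation d1 d2 a b r l"
    by (rule Hopf_double_Turing[OF d l b(1) a ij jk Ti Dj Dk])
  moreover have "(cond_A5' d1 d2 a b l \<or> cond_A6' d1 d2 a b l) \<and>
      r = r_H d1 d2 a b 0 l \<and> r = r_T d1 d2 a b j l \<and> r = r_T d1 d2 a b k l \<and> r = A0 a b"
    if st: "bifurcation_solutions d1 d2 a b r l R \<Lambda> U V \<and>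
       (\<forall>m. HT_stable d1 d2 a b (R m) (\<Lambda> m) (U m) (V m))" for R \<Lambda> U V
  proof -
    have no: False if "mode_det d1 d2 a b r (wave l n) < 0 \<or>
       (mode_trace d1 d2 a b r (wave l n) > 0 \<and> mode_det d1 d2 a b r (wave l n) > 0)" for n
      using no_stable_bifurcation[OF d l r b(1) a that] st by blast
    have i0: "i = 0"
    proof (rule ccontr)
      assume "i \<noteq> 0"
      hence "0 < wave l i" using wave_less_iff[OF l, of 0 i] by simp
      moreover have "mode_trace d1 d2 a b r (wave l 0) = (d1 + d2) * wave l i"
        using Ti by (simp add: mode_trace_def)
      moreover have "mode_det d1 d2 a b r (wave l 0) = - (r * (A0 a b + B0 a b))"
        by (simp add: mode_det_def algebra_simps)
      ultimately show False
        using no[of 0] d A0_plus_B0_neg[OF b(1), of a] r by (simp add: mult_pos_neg)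
    qed
    have kj: "k = j + 1"
    proof (rule ccontr)
      assume "k \<noteq> j + 1"
      hence "wave l j < wave l (j + 1)" "wave l (j + 1) < wave l k"
        using jk by (simp_all add: wave_less_iff[OF l])
      moreover have "mode_det d1 d2 a b r (wave l (j + 1))
        = d1 * d2 * (wave l (j + 1) - wave l j) * (wave l (j + 1) - wave l k)"
        by (rule mode_det_factor[OF Dj Dk]) (use jk wave_eq_iff[OF l] in simp)
      ultimately show False using no[of "j + 1"] d by (simp add: mult_pos_neg)
    qed
    have rA: "r = A0 a b" using Ti i0 by (simp add: mode_trace_def)
    have "cond_A6' d1 d2 a b l"
      using Dj Dk r ij unfolding rA kj by (intro marginal_A6'[OF d l b a, of j]) simp_all
    thus ?thesis using ijk i0 rA by simp
  qed
  ultimately show "Hopf_double_Turing_bifurcation d1 d2 a b r l \<and>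
           (\<forall>R \<Lambda> U V.
              bifurcation_solutions d1 d2 a b r l R \<Lambda> U V \<and>
              (\<forall>m. HT_stable d1 d2 a b (R m) (\<Lambda> m) (U m) (V m)) \<longrightarrow>
              (cond_A5' d1 d2 a b l \<or> cond_A6' d1 d2 a b l) \<and>
              r = r_H d1 d2 a b 0 l \<and> r = r_T d1 d2 a b j l \<and> r = r_T d1 d2 a b k l \<and>
              r = A0 a b)" by blast
qed

end
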